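(* Let $k\in\{1,2,3,\dots\}\cup\{\infty\}$ and let $(X,\|\cdot\|)$ be a separable real Banach space with a Schauder basis $\{e_i\}_{i\ge 1}$ that admits a $C^k$-smooth renorming. Then for every sequence $\{\varepsilon_N\}_{N\ge 0}$ of positive real numbers there is a $C^k$-smooth renorming $|||\cdot|||$ of $X$ such that for every $N\ge 0$ $$\bigl|\,|||x|||-\|x\|\,\bigr|\le \varepsilon_N\|x\|\qquad\text{for all }x\in X^N,$$ where $X^N:=\overline{\mathrm{span}}\{e_i\}_{i\ge N+1}$.
   Context: A renorming of $X$ is a norm on $X$ equivalent to the given norm $\|\cdot\|$. A norm is $C^k$-smooth if it is $k$ times continuously Fréchet differentiable on $X\setminus\{0\}$ (for $k=\infty$: infinitely Fréchet differentiable there). *)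

theory Defs
  imports "HOL-Analysis.Analysis" "HOL-Library.Extended_Nat"
begin

text \<open>
  The order-\<open>n\<close> Frechet derivative of \<open>f : X \<rightarrow> Y\<close> takes values in the iterated space
  \<open>L(X, L(X, \<dots> L(X, Y)))\<close>, whose type depends on \<open>n\<close>. As usual it is identified isometrically
  with the space of bounded \<open>n\<close>-linear maps \<open>X\<^sup>n \<rightarrow> Y\<close>. The tuple of arguments is a
  list of length \<open>n\<close>; values at lists of other lengths are irrelevant. The outermost argument
  (the direction of the last differentiation) is the head of the list.
\<close>

definition bounded_multilinear ::
    "nat \<Rightarrow> ('a::real_normed_vector list \<Rightarrow> 'b::real_normed_vector) \<Rightarrow> bool" where
  "bounded_multilinear n M \<longleftrightarrow>
     (\<forall>us vs. length us + 1 + length vs = n \<longrightarrow> linear (\<lambda>h. M (us @ h # vs))) \<and>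
     (\<exists>K. \<forall>hs. length hs = n \<longrightarrow> norm (M hs) \<le> K * prod_list (map norm hs))"

text \<open>The operator norm; it is only meaningful for bounded \<open>n\<close>-linear \<open>M\<close>.\<close>

definition multi_onorm ::
    "nat \<Rightarrow> ('a::real_normed_vector list \<Rightarrow> 'b::real_normed_vector) \<Rightarrow> real" where
  "multi_onorm n M = Sup {norm (M hs) | hs. length hs = n \<and> (\<forall>h\<in>set hs. norm h \<le> 1)}"

text \<open>
  \<open>f\<close> is \<open>k\<close> times continuously Frechet differentiable on the open set \<open>S\<close>, where
  \<open>k = \<infinity>\<close> means infinitely often. \<open>D n x\<close> is the \<open>n\<close>-th derivative at \<open>x\<close>; it is unique on
  \<open>S\<close> if it exists. The third condition says that \<open>D n\<close> is Frechet differentiable at \<open>x\<close>, as a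
  map into the bounded \<open>n\<close>-linear maps with the operator norm, with derivative
  \<open>h \<mapsto> D (n+1) x (h, \<dots>)\<close>.
\<close>

definition C_smooth_on ::
    "enat \<Rightarrow> 'a::real_normed_vector set \<Rightarrow> ('a \<Rightarrow> 'b::real_normed_vector) \<Rightarrow> bool" where
  "C_smooth_on k S f \<longleftrightarrow>
     (\<exists>D :: nat \<Rightarrow> 'a \<Rightarrow> 'a list \<Rightarrow> 'b.
        (\<forall>x\<in>S. D 0 x [] = f x) \<and>
        (\<forall>n. enat n \<le> k \<longrightarrow> (\<forall>x\<in>S. bounded_multilinear n (D n x))) \<and>
        (\<forall>n. enat n < k \<longrightarrow> (\<forall>x\<in>S.
           ((\<lambda>y. multi_onorm n (\<lambda>hs. D n y hs - D n x hs - D (Suc n) x ((y - x) # hs))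
                  / norm (y - x)) \<longlongrightarrow> 0) (at x))) \<and>
        (\<forall>n. enat n \<le> k \<longrightarrow> (\<forall>x\<in>S.
           ((\<lambda>y. multi_onorm n (\<lambda>hs. D n y hs - D n x hs)) \<longlongrightarrow> 0) (at x))))"

definition is_norm :: "('a::real_vector \<Rightarrow> real) \<Rightarrow> bool" where
  "is_norm p \<longleftrightarrow>
     (\<forall>x. 0 \<le> p x) \<and> (\<forall>x. p x = 0 \<longleftrightarrow> x = 0) \<and>
     (\<forall>a x. p (a *\<^sub>R x) = \<bar>a\<bar> * p x) \<and> (\<forall>x y. p (x + y) \<le> p x + p y)"

definition renorming :: "('a::real_normed_vector \<Rightarrow> real) \<Rightarrow> bool" where
  "renorming p \<longleftrightarrow>
     is_norm p \<and> (\<exists>c C. 0 < c \<and> 0 < C \<and> (\<forall>x. c * norm x \<le> p x \<and> p x \<le> C * norm x))"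

definition C_smooth_norm :: "enat \<Rightarrow> ('a::real_normed_vector \<Rightarrow> real) \<Rightarrow> bool" where
  "C_smooth_norm k p \<longleftrightarrow> C_smooth_on k (UNIV - {0}) p"

text \<open>Indices start at \<open>0\<close>: \<open>e i\<close> stands for the basis vector usually written \<open>e\<^sub>i\<^sub>+\<^sub>1\<close>.\<close>

definition schauder_basis :: "(nat \<Rightarrow> 'a::real_normed_vector) \<Rightarrow> bool" where
  "schauder_basis e \<longleftrightarrow> (\<forall>x. \<exists>!a :: nat \<Rightarrow> real. (\<lambda>i. a i *\<^sub>R e i) sums x)"

text \<open>The closed linear span of \<open>e\<^sub>i\<close>, \<open>i \<ge> N + 1\<close>, in one-based indexing.\<close>

definition tail_space :: "(nat \<Rightarrow> 'a::real_normed_vector) \<Rightarrow> nat \<Rightarrow> 'a set" where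
  "tail_space e N = closure (span (e ` {N..}))"

end

theory Submission
  imports Defs "HOL-Computational_Algebra.Polynomial"
begin

text \<open>
  Smooth norms are produced by gluing. Let \<open>h\<^sub>i\<close> be \<open>C\<^sup>k\<close> seminorms such that at every \<open>x \<noteq> 0\<close> all but finitely
  many \<open>h\<^sub>i x\<close> stay away from the supremum. For smooth convex \<open>\<phi>\<^sub>i\<close> vanishing up to \<open>1 - \<tau>\<^sub>i\<close> the sum of
  the \<open>\<phi>\<^sub>i \<circ> h\<^sub>i\<close> is locally finite near the boundary of its sublevel set, whose gauge is a \<open>C\<^sup>k\<close> norm close to the
  supremum of the \<open>h\<^sub>i\<close>: differentiate the implicit equation and bootstrap.

  Every equivalent norm \<open>\<omega>\<close> is a suitable supremum, up to a factor \<open>1 + \<epsilon>\<close>, of seminorms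
  \<open>\<bar>f\<bar> + \<rho> p (x - P\<^sub>n x)\<close>, where \<open>p\<close> is the given smooth norm, \<open>P\<^sub>n\<close> are the basis projections and \<open>f\<close> runs through
  finite sets of functionals chosen from a separable dual space. This gives uniform approximation.

  For the tails, let \<open>M = norm + r\<close> with \<open>r\<close> a weighted sum of the absolute values of the coordinates, so small that
  \<open>r x \<le> \<epsilon>\<^sub>N norm x\<close> on \<open>X\<^sup>N\<close>. It remains to put a \<open>C\<^sup>k\<close> norm between \<open>norm\<close> and \<open>M\<close>. Infimal
  convolutions \<open>w\<^sub>j\<close> of \<open>(1 + d\<^sub>j) norm\<close> on the range of \<open>P\<^sub>j\<close> and \<open>(1 - d\<^sub>j\<^sup>2) M\<close> tend to \<open>norm\<close> from strictly
  above and lie below \<open>(1 - d\<^sub>j\<^sup>2) M\<close>; their uniform smooth approximations can be glued.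
\<close>

section \<open>Differentiable multilinear fields\<close>

text \<open>The conclusion follows from \<open>norm x \<le> Q x \<le> M x\<close>. A single uniform
  approximation need not fit between the two: if the \<open>\<epsilon> N\<close> tend to 0, then
  \<open>M x / norm x\<close> comes arbitrarily close to 1 on far tails. This forces a family, each
  member a definite factor below \<open>M\<close>, whose supremum is at least the norm. Gluing needs
  local finiteness, and in both applications it has the same source. For every \<open>c\<close>
  above a limit function (\<open>\<omega>\<close>, respectively \<open>norm\<close>) only finitely
  many members exceed \<open>c\<close> at a given point, while at every nonzero point some member
  strictly exceeds the limit function. A level chosen between the two separates the finitely many
  relevant members from the rest. In the uniform approximation a finite net of functionals suffices
  on the finite-dimensional range of a projection, but not on the complementary tail. The resulting
  seminorms have two summands, each nonsmooth on its own kernel; hence gluing takes pairs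
  \<open>u\<close>, \<open>v\<close> and flattens each summand separately.\<close>

abbreviation pnorm :: "'a::real_normed_vector list \<Rightarrow> real" where
  "pnorm hs \<equiv> prod_list (map norm hs)"

lemma pnorm_nonneg: "0 \<le> pnorm hs"
  by (induction hs) auto

text \<open>Linearity in each slot, peeled off from the head so that inductions follow the list;
  \<open>mlin_iff\<close> recovers the form with \<open>us @ h # vs\<close> that
  \<open>bounded_multilinear\<close> uses.\<close>

fun mlin :: "nat \<Rightarrow> ('a::real_normed_vector list \<Rightarrow> real) \<Rightarrow> bool" where
  "mlin 0 M = True"
| "mlin (Suc n) M \<longleftrightarrow> (\<forall>hs. length hs = n \<longrightarrow> linear (\<lambda>h. M (h # hs))) \<and> (\<forall>h. mlin n (\<lambda>hs. M (h # hs)))"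

lemma mlin_iff:
  "mlin n M \<longleftrightarrow> (\<forall>us vs. length us + 1 + length vs = n \<longrightarrow> linear (\<lambda>h. M (us @ h # vs)))"
proof (induction n arbitrary: M)
  case 0
  then show ?case by simp
next
  case (Suc n)
  show ?case
  proof
    assume L: "mlin (Suc n) M"
    show "\<forall>us vs. length us + 1 + length vs = Suc n \<longrightarrow> linear (\<lambda>h. M (us @ h # vs))"
    proof (intro allI impI)
      fix us vs :: "'a list" assume len: "length us + 1 + length vs = Suc n"
      show "linear (\<lambda>h. M (us @ h # vs))"
      proof (cases us)
        case Nil
        then show ?thesis using L len by auto
      next
        case (Cons u us')
        have "mlin n (\<lambda>hs. M (u # hs))" using L by simp
        then show ?thesis using Cons len Suc.IH[of "\<lambda>hs. M (u # hs)"] by auto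
      qed
    qed
  next
    assume R: "\<forall>us vs. length us + 1 + length vs = Suc n \<longrightarrow> linear (\<lambda>h. M (us @ h # vs))"
    have "linear (\<lambda>h. M (h # hs))" if "length hs = n" for hs
      using R[rule_format, of "[]" hs] that by simp
    moreover have "mlin n (\<lambda>hs. M (h # hs))" for h
      unfolding Suc.IH using R[rule_format, of "h # _"] by simp
    ultimately show "mlin (Suc n) M" by simp
  qed
qed

definition mbounded :: "nat \<Rightarrow> ('a::real_normed_vector list \<Rightarrow> real) \<Rightarrow> bool" where
  "mbounded n M \<longleftrightarrow> (\<exists>K. \<forall>hs. length hs = n \<longrightarrow> \<bar>M hs\<bar> \<le> K * pnorm hs)"

lemma bounded_multilinear_iff: "bounded_multilinear n M \<longleftrightarrow> mlin n M \<and> mbounded n M"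
  unfolding bounded_multilinear_def mlin_iff mbounded_def by simp

lemma mboundedE:
  assumes "mbounded n M"
  obtains K where "0 < K" "\<And>hs. length hs = n \<Longrightarrow> \<bar>M hs\<bar> \<le> K * pnorm hs"
proof -
  obtain K where K: "\<And>hs. length hs = n \<Longrightarrow> \<bar>M hs\<bar> \<le> K * pnorm hs"
    using assms unfolding mbounded_def by auto
  have "\<bar>M hs\<bar> \<le> (\<bar>K\<bar> + 1) * pnorm hs" if "length hs = n" for hs
  proof -
    have "K * pnorm hs \<le> (\<bar>K\<bar> + 1) * pnorm hs"
      by (intro mult_right_mono pnorm_nonneg) simp
    then show ?thesis using K[OF that] by linarith
  qed
  then show thesis using that[of "\<bar>K\<bar> + 1"] by simp
qed

lemma bounded_multilinear_cong:
  assumes "\<And>hs. length hs = n \<Longrightarrow> M hs = M' hs"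
  shows "bounded_multilinear n M \<longleftrightarrow> bounded_multilinear n M'"
proof -
  have "(\<lambda>h. M (us @ h # vs)) = (\<lambda>h. M' (us @ h # vs))" if "length us + 1 + length vs = n" for us vs
    using that assms by auto
  then show ?thesis
    unfolding bounded_multilinear_def using assms by (auto cong: conj_cong imp_cong)
qed

lemma mlin_scale:
  assumes "mlin n M" "length hs = n"
  shows "M (map (\<lambda>h. c h *\<^sub>R h) hs) = prod_list (map c hs) * M hs"
  using assms
proof (induction n arbitrary: M hs)
  case 0
  then show ?case by simp
next
  case (Suc n)
  then obtain h hs' where hs: "hs = h # hs'" "length hs' = n" by (cases hs) auto
  have lin: "linear (\<lambda>h. M (h # hs'))" using Suc.prems hs by simp
  have "M (map (\<lambda>h. c h *\<^sub>R h) hs) = prod_list (map c hs') * M ((c h *\<^sub>R h) # hs')"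
    using Suc.IH[of "\<lambda>l. M ((c h *\<^sub>R h) # l)" hs'] Suc.prems hs by simp
  also have "M ((c h *\<^sub>R h) # hs') = c h * M (h # hs')"
    using linear_scale[OF lin] by simp
  finally show ?case using hs by simp
qed

lemma pnorm_eq_0: "pnorm hs = 0 \<longleftrightarrow> 0 \<in> set hs"
  by (induction hs) auto

lemma pnorm_le_1: "(\<forall>h\<in>set hs. norm h \<le> 1) \<Longrightarrow> pnorm hs \<le> 1"
  by (induction hs) (auto intro!: mult_le_one pnorm_nonneg)

text \<open>Normalise every argument and use homogeneity in each slot. An argument equal to 0 cannot
  be normalised, but then both sides vanish.\<close>

lemma multi_onorm_bound:
  fixes M :: "'a::real_normed_vector list \<Rightarrow> real"
  assumes bm: "bounded_multilinear n M" and len: "length hs = n"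
  shows "\<bar>M hs\<bar> \<le> multi_onorm n M * pnorm hs"
proof -
  obtain K where K: "0 < K" "\<And>hs. length hs = n \<Longrightarrow> \<bar>M hs\<bar> \<le> K * pnorm hs"
    using bm mboundedE unfolding bounded_multilinear_iff by metis
  show ?thesis
  proof (cases "0 \<in> set hs")
    case True
    then show ?thesis using K(2)[OF len] pnorm_eq_0[of hs] by simp
  next
    case False
    let ?c = "\<lambda>h::'a. inverse (norm h)"
    let ?hs = "map (\<lambda>h. ?c h *\<^sub>R h) hs"
    let ?A = "{norm (M hs) | hs. length hs = n \<and> (\<forall>h\<in>set hs. norm h \<le> 1)}"
    have bdd: "bdd_above ?A"
    proof (rule bdd_aboveI[of _ K])
      fix r assume "r \<in> ?A"
      then obtain gs where gs: "r = norm (M gs)" "length gs = n" "\<forall>h\<in>set gs. norm h \<le> 1" by auto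
      have "\<bar>M gs\<bar> \<le> K * pnorm gs" using K gs by auto
      also have "\<dots> \<le> K * 1" using K(1) pnorm_le_1[OF gs(3)] by (intro mult_left_mono) auto
      finally show "r \<le> K" using gs by simp
    qed
    have "inverse (norm h) * norm h \<le> 1" for h :: 'a by (cases "h = 0") auto
    then have "\<forall>h\<in>set ?hs. norm h \<le> 1" by auto
    then have "norm (M ?hs) \<in> ?A" using len by (intro CollectI exI[of _ ?hs]) simp
    then have "\<bar>M ?hs\<bar> \<le> multi_onorm n M"
      unfolding multi_onorm_def using cSup_upper[OF _ bdd] by force
    moreover have "M ?hs = prod_list (map ?c hs) * M hs"
      using mlin_scale[of n M hs ?c] bm len unfolding bounded_multilinear_iff by blast
    moreover have "prod_list (map ?c hs) * pnorm hs = 1"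
      using False by (induction hs) (auto simp: field_simps)
    moreover have "pnorm hs > 0" using False pnorm_eq_0[of hs] pnorm_nonneg[of hs] by linarith
    ultimately have a: "\<bar>M ?hs\<bar> \<le> multi_onorm n M" "M ?hs = prod_list (map ?c hs) * M hs"
        "prod_list (map ?c hs) * pnorm hs = 1" "pnorm hs > 0" by blast+
    define d v p where "d = prod_list (map ?c hs)" and "v = M ?hs" and "p = pnorm hs"
    note a = a[folded d_def v_def p_def]
    have "d > 0" using a(3,4) zero_less_mult_pos2[of d p] by simp
    then have "\<bar>v\<bar> * p = (d * p) * \<bar>M hs\<bar>" unfolding a(2) abs_mult by simp
    then have "\<bar>M hs\<bar> = \<bar>v\<bar> * p" unfolding a(3) by simp
    also have "\<dots> \<le> multi_onorm n M * p" using a(1,4) by (intro mult_right_mono) auto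
    finally show ?thesis unfolding p_def .
  qed
qed

lemma multi_onorm_le:
  fixes M :: "'a::real_normed_vector list \<Rightarrow> real"
  assumes "0 \<le> e" "\<And>hs. length hs = n \<Longrightarrow> \<bar>M hs\<bar> \<le> e * pnorm hs"
  shows "0 \<le> multi_onorm n M" "multi_onorm n M \<le> e"
proof -
  let ?A = "{norm (M hs) | hs. length hs = n \<and> (\<forall>h\<in>set hs. norm h \<le> 1)}"
  have ub: "r \<le> e" if r: "r \<in> ?A" for r
  proof -
    obtain gs where gs: "r = norm (M gs)" "length gs = n" "\<forall>h\<in>set gs. norm h \<le> 1"
      using CollectD[OF r] by (elim exE conjE) (rule that; assumption)
    have "\<bar>M gs\<bar> \<le> e * pnorm gs" using assms gs by auto
    also have "\<dots> \<le> e * 1" using assms pnorm_le_1[OF gs(3)] by (intro mult_left_mono) auto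
    finally show "r \<le> e" using gs by simp
  qed
  have mem: "norm (M (replicate n 0)) \<in> ?A"
    by (intro CollectI exI[of _ "replicate n 0"]) auto
  show "multi_onorm n M \<le> e"
    unfolding multi_onorm_def using mem ub by (intro cSup_least) blast+
  have "norm (M (replicate n 0)) \<le> multi_onorm n M"
    unfolding multi_onorm_def by (intro cSup_upper mem bdd_aboveI[of _ e] ub)
  then show "0 \<le> multi_onorm n M" by (rule order_trans[OF norm_ge_zero])
qed

text \<open>A field assigns to every point a function of argument lists. \<open>mcont\<close> and \<open>mder\<close> are continuity
  and Frechet differentiability of an \<open>n\<close>-linear field in the operator norm.\<close>

definition mcont :: "nat \<Rightarrow> ('a::real_normed_vector \<Rightarrow> 'a list \<Rightarrow> real) \<Rightarrow> 'a \<Rightarrow> bool" where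
  "mcont n F x \<longleftrightarrow> (\<forall>e>0. \<forall>\<^sub>F y in nhds x. \<forall>hs. length hs = n \<longrightarrow>
      \<bar>F y hs - F x hs\<bar> \<le> e * pnorm hs)"

definition mder :: "nat \<Rightarrow> ('a::real_normed_vector \<Rightarrow> 'a list \<Rightarrow> real) \<Rightarrow> ('a \<Rightarrow> 'a list \<Rightarrow> real) \<Rightarrow> 'a \<Rightarrow> bool" where
  "mder n F F' x \<longleftrightarrow> (\<forall>e>0. \<forall>\<^sub>F y in nhds x. \<forall>hs. length hs = n \<longrightarrow>
      \<bar>F y hs - F x hs - F' x ((y - x) # hs)\<bar> \<le> e * norm (y - x) * pnorm hs)"

text \<open>Each scalar evaluation \<open>F y (tl hs)\<close> is differentiated separately, in the
  direction \<open>hd hs\<close>. By uniqueness of scalar derivatives this agrees with every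
  operator norm derivative (\<open>mder_Dv\<close>), so \<open>CK\<close> can name the derivative
  instead of quantifying over one.\<close>

definition Dv :: "('a::real_normed_vector \<Rightarrow> 'a list \<Rightarrow> real) \<Rightarrow> 'a \<Rightarrow> 'a list \<Rightarrow> real" where
  "Dv F x hs = frechet_derivative (\<lambda>y. F y (tl hs)) (at x) (hd hs)"

text \<open>\<open>CK k n S F\<close>: the \<open>n\<close>-linear field \<open>F\<close> is \<open>k\<close> times continuously differentiable on \<open>S\<close>. The derivative
  of an \<open>n\<close>-linear field is an \<open>n + 1\<close>-linear field of the same HOL type, which makes induction on the
  order of differentiability possible; \<open>n\<close> changes in this recursion.\<close>

fun CK :: "nat \<Rightarrow> nat \<Rightarrow> 'a::real_normed_vector set \<Rightarrow> ('a \<Rightarrow> 'a list \<Rightarrow> real) \<Rightarrow> bool" where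
  "CK 0 n S F \<longleftrightarrow> (\<forall>x\<in>S. bounded_multilinear n (F x) \<and> mcont n F x)"
| "CK (Suc k) n S F \<longleftrightarrow> (\<forall>x\<in>S. bounded_multilinear n (F x) \<and> mcont n F x \<and> mder n F (Dv F) x)
      \<and> CK k (Suc n) S (Dv F)"

lemma CK_bm: "CK k n S F \<Longrightarrow> x \<in> S \<Longrightarrow> bounded_multilinear n (F x)"
  by (cases k) auto

lemma CK_mcont: "CK k n S F \<Longrightarrow> x \<in> S \<Longrightarrow> mcont n F x"
  by (cases k) auto

lemma CK_Suc: "CK (Suc k) n S F \<Longrightarrow> CK k n S F"
  by (induction k arbitrary: n F) auto

lemma CK_subset: "CK k n S F \<Longrightarrow> U \<subseteq> S \<Longrightarrow> CK k n U F"
  by (induction k arbitrary: n F) (simp, blast)+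

lemma CK_local:
  assumes "\<And>x. x \<in> S \<Longrightarrow> \<exists>U. x \<in> U \<and> CK k n U F"
  shows "CK k n S F"
  using assms
proof (induction k arbitrary: n F)
  case 0
  then show ?case by fastforce
next
  case (Suc k)
  have "CK k (Suc n) S (Dv F)"
    using Suc.prems by (intro Suc.IH) force
  then show ?case using Suc.prems by force
qed

lemma has_derivative_at_iff_eventually:
  fixes f :: "'a::real_normed_vector \<Rightarrow> real"
  assumes "bounded_linear f'"
  shows "(f has_derivative f') (at x) \<longleftrightarrow>
    (\<forall>e>0. \<forall>\<^sub>F y in nhds x. \<bar>f y - f x - f' (y - x)\<bar> \<le> e * norm (y - x))"
  unfolding has_derivative_at_alt eventually_nhds_metric
  using assms by (simp add: dist_norm)

lemma mder_has_derivative: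
  assumes bm: "bounded_multilinear (Suc n) (F' x)" and d: "mder n F F' x" and len: "length hs = n"
  shows "((\<lambda>y. F y hs) has_derivative (\<lambda>h. F' x (h # hs))) (at x)"
proof -
  have lin: "linear (\<lambda>h. F' x (h # hs))"
    using bm len unfolding bounded_multilinear_iff by simp
  obtain K where K: "0 < K" "\<And>hs. length hs = Suc n \<Longrightarrow> \<bar>F' x hs\<bar> \<le> K * pnorm hs"
    using bm mboundedE unfolding bounded_multilinear_iff by metis
  have bl: "bounded_linear (\<lambda>h. F' x (h # hs))"
  proof (rule bounded_linear_intro)
    show "norm (F' x (h # hs)) \<le> norm h * (K * pnorm hs)" for h
      using K(2)[of "h # hs"] len by (simp add: algebra_simps)
  qed (use linear_add[OF lin] linear_scale[OF lin] in simp_all)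
  show ?thesis
    unfolding has_derivative_at_iff_eventually[OF bl]
  proof (intro allI impI)
    fix e :: real assume e: "0 < e"
    define e' where "e' = e / (pnorm hs + 1)"
    have p: "pnorm hs \<ge> 0" by (rule pnorm_nonneg)
    have e': "e' > 0" using e p by (simp add: e'_def add_nonneg_pos)
    have "e' * pnorm hs \<le> e' * (pnorm hs + 1)" using e' by simp
    also have "\<dots> = e" using p by (simp add: e'_def add_nonneg_eq_0_iff)
    finally have le: "e' * pnorm hs \<le> e" .
    show "\<forall>\<^sub>F y in nhds x. \<bar>F y hs - F x hs - F' x ((y - x) # hs)\<bar> \<le> e * norm (y - x)"
      using d[unfolded mder_def, rule_format, OF e']
    proof eventually_elim
      case (elim y)
      then have "\<bar>F y hs - F x hs - F' x ((y - x) # hs)\<bar> \<le> (e' * pnorm hs) * norm (y - x)"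
        using len by (simp add: algebra_simps)
      also have "\<dots> \<le> e * norm (y - x)" using le by (rule mult_right_mono) simp
      finally show ?case .
    qed
  qed
qed

lemma mder_Dv:
  assumes "bounded_multilinear (Suc n) (F' x)" "mder n F F' x" "length hs = Suc n"
  shows "Dv F x hs = F' x hs"
proof -
  obtain h t where hs: "hs = h # t" "length t = n" using assms(3) by (cases hs) auto
  show ?thesis
    using frechet_derivative_at[OF mder_has_derivative[OF assms(1,2) hs(2)]] hs
    unfolding Dv_def by (metis list.sel(1) list.sel(3))
qed

lemma mder_cong:
  assumes "\<forall>\<^sub>F y in nhds x. \<forall>hs. length hs = n \<longrightarrow> F y hs = G y hs"
    "\<And>hs. length hs = Suc n \<Longrightarrow> F' x hs = G' x hs" "mder n F F' x"
  shows "mder n G G' x"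
  unfolding mder_def
proof (intro allI impI)
  fix e :: real assume "0 < e"
  note eventually_nhds_x_imp_x[OF assms(1)]
  then have x: "\<And>hs. length hs = n \<Longrightarrow> F x hs = G x hs" by blast
  show "\<forall>\<^sub>F y in nhds x. \<forall>hs. length hs = n \<longrightarrow>
      \<bar>G y hs - G x hs - G' x ((y - x) # hs)\<bar> \<le> e * norm (y - x) * pnorm hs"
    using assms(3)[unfolded mder_def, rule_format, OF \<open>0 < e\<close>] assms(1)
    by eventually_elim (use x assms(2) in auto)
qed

lemma mcont_cong:
  assumes "\<forall>\<^sub>F y in nhds x. \<forall>hs. length hs = n \<longrightarrow> F y hs = G y hs" "mcont n F x"
  shows "mcont n G x"
  unfolding mcont_def
proof (intro allI impI)
  fix e :: real assume "0 < e"
  note eventually_nhds_x_imp_x[OF assms(1)]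
  then have x: "\<And>hs. length hs = n \<Longrightarrow> F x hs = G x hs" by blast
  show "\<forall>\<^sub>F y in nhds x. \<forall>hs. length hs = n \<longrightarrow> \<bar>G y hs - G x hs\<bar> \<le> e * pnorm hs"
    using assms(2)[unfolded mcont_def, rule_format, OF \<open>0 < e\<close>] assms(1)
    by eventually_elim (use x in auto)
qed

text \<open>Openness turns equality on \<open>S\<close> into equality near each of its points, so
  \<open>mder\<close> passes from \<open>F\<close> to \<open>G\<close> and the two fields
  \<open>Dv\<close> agree again on \<open>S\<close>.\<close>

lemma CK_cong:
  assumes "open S" "\<And>x hs. x \<in> S \<Longrightarrow> length hs = n \<Longrightarrow> F x hs = G x hs" "CK k n S F"
  shows "CK k n S G"
  using assms(2,3)
proof (induction k arbitrary: n F G)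
  case (0 n F G)
  have ev: "\<forall>\<^sub>F y in nhds x. \<forall>hs. length hs = n \<longrightarrow> F y hs = G y hs" if "x \<in> S" for x
    using eventually_nhds_in_open[OF assms(1) that] by eventually_elim (use 0 in auto)
  show ?case
    using 0 mcont_cong[OF ev] bounded_multilinear_cong[of n "F _" "G _"] by auto
next
  case (Suc k n F G)
  have ev: "\<forall>\<^sub>F y in nhds x. \<forall>hs. length hs = n \<longrightarrow> F y hs = G y hs" if "x \<in> S" for x
    using eventually_nhds_in_open[OF assms(1) that] by eventually_elim (use Suc.prems in auto)
  have D: "Dv F x hs = Dv G x hs" if "x \<in> S" "length hs = Suc n" for x hs
  proof (rule sym, rule mder_Dv[where n = n])
    show "bounded_multilinear (Suc n) (Dv F x)"
      using CK_bm[of k "Suc n" S "Dv F" x] Suc.prems that by simp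
    show "mder n G (Dv F) x"
      using mder_cong[OF ev[OF that(1)], of "Dv F" "Dv F"] Suc.prems that by simp
  qed (rule that)
  have "CK k (Suc n) S (Dv G)"
    by (rule Suc.IH[of "Suc n" "Dv F"]) (use D Suc.prems in auto)
  moreover have "mder n G (Dv G) x" if "x \<in> S" for x
    using mder_cong[OF ev[OF that], of "Dv F" "Dv G"] Suc.prems D that by simp
  ultimately show ?case
    using Suc.prems mcont_cong[OF ev] bounded_multilinear_cong[of n "F _" "G _"] by auto
qed

lemma mder_imp_mcont:
  assumes "bounded_multilinear (Suc n) (F' x)" "mder n F F' x"
  shows "mcont n F x"
  unfolding mcont_def
proof (intro allI impI)
  fix e :: real assume e: "0 < e"
  obtain K where K: "0 < K" "\<And>hs. length hs = Suc n \<Longrightarrow> \<bar>F' x hs\<bar> \<le> K * pnorm hs"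
    using assms(1) mboundedE unfolding bounded_multilinear_iff by metis
  have "\<forall>\<^sub>F y in nhds x. dist y x < e / (K + 1)"
    using e K by (intro eventually_nhds_ball[unfolded ball_def, THEN eventually_mono, of "e / (K+1)"])
       (auto simp: dist_commute)
  then show "\<forall>\<^sub>F y in nhds x. \<forall>hs. length hs = n \<longrightarrow> \<bar>F y hs - F x hs\<bar> \<le> e * pnorm hs"
    using assms(2)[unfolded mder_def, rule_format, OF zero_less_one]
  proof eventually_elim
    case (elim y)
    show ?case
    proof (intro allI impI)
      fix hs :: "'a list" assume len: "length hs = n"
      have "\<bar>F' x ((y - x) # hs)\<bar> \<le> K * norm (y - x) * pnorm hs"
        using K(2)[of "(y - x) # hs"] len by simp
      moreover have "\<bar>F y hs - F x hs - F' x ((y - x) # hs)\<bar> \<le> norm (y - x) * pnorm hs"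
        using elim len by simp
      ultimately have "\<bar>F y hs - F x hs\<bar> \<le> (K * norm (y - x)) * pnorm hs + norm (y - x) * pnorm hs"
        by linarith
      also have "\<dots> = ((K + 1) * norm (y - x)) * pnorm hs" by (simp add: algebra_simps)
      also have "\<dots> \<le> e * pnorm hs"
        using elim(1) K(1) by (intro mult_right_mono pnorm_nonneg) (simp add: dist_norm field_simps)
      finally show "\<bar>F y hs - F x hs\<bar> \<le> e * pnorm hs" .
    qed
  qed
qed

text \<open>Allows an explicit derivative field \<open>F'\<close> in place of \<open>Dv F\<close>.
  The calculus rules below rest on it: each is an induction on the order of smoothness with a
  formula for \<open>F'\<close>.\<close>

lemma CK_SucI:
  assumes "open S" "\<And>x. x \<in> S \<Longrightarrow> bounded_multilinear n (F x)"
    "\<And>x. x \<in> S \<Longrightarrow> mder n F F' x" "CK k (Suc n) S F'"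
  shows "CK (Suc k) n S F"
proof -
  have bm: "bounded_multilinear (Suc n) (F' x)" if "x \<in> S" for x
    using CK_bm[OF assms(4) that] .
  have D: "F' x hs = Dv F x hs" if "x \<in> S" "length hs = Suc n" for x hs
    using mder_Dv[OF bm[OF that(1)] assms(3)[OF that(1)] that(2)] by simp
  have "CK k (Suc n) S (Dv F)"
    by (rule CK_cong[OF assms(1) D assms(4)])
  moreover have "mder n F (Dv F) x" if "x \<in> S" for x
    by (rule mder_cong[OF _ _ assms(3)[OF that]]) (use D that in auto)
  ultimately show ?thesis
    using assms(2) mder_imp_mcont[OF bm assms(3)] by auto
qed

lemma CK_Dv: "CK (Suc k) n S F \<Longrightarrow> CK k (Suc n) S (Dv F)"
  by simp

text \<open>Absorbs a constant factor in the error. The restriction \<open>e \<le> 1\<close> lets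
  products of two errors be bounded by a single one, as the product rule requires.\<close>

lemma mcontI:
  assumes "0 \<le> C" "\<And>e. 0 < e \<Longrightarrow> e \<le> 1 \<Longrightarrow> \<forall>\<^sub>F y in nhds x. \<forall>hs. length hs = n \<longrightarrow>
      \<bar>F y hs - F x hs\<bar> \<le> C * e * pnorm hs"
  shows "mcont n F x"
  unfolding mcont_def
proof (intro allI impI)
  fix e :: real assume e: "0 < e"
  define e' where "e' = min 1 (e / (C + 1))"
  have e': "0 < e'" "e' \<le> 1" using e assms(1) by (auto simp: e'_def)
  have "C * e' \<le> C * (e / (C + 1))" using assms(1) by (intro mult_left_mono) (auto simp: e'_def)
  also have "\<dots> \<le> e" using assms(1) e by (simp add: field_simps)
  finally have le: "C * e' \<le> e" .
  show "\<forall>\<^sub>F y in nhds x. \<forall>hs. length hs = n \<longrightarrow> \<bar>F y hs - F x hs\<bar> \<le> e * pnorm hs"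
    using assms(2)[OF e']
  proof eventually_elim
    case (elim y)
    have "C * e' * pnorm hs \<le> e * pnorm hs" for hs :: "'a list"
      using le by (intro mult_right_mono pnorm_nonneg)
    then show ?case using elim order_trans by blast
  qed
qed

lemma mderI:
  assumes "0 \<le> C" "\<And>e. 0 < e \<Longrightarrow> e \<le> 1 \<Longrightarrow> \<forall>\<^sub>F y in nhds x. \<forall>hs. length hs = n \<longrightarrow>
      \<bar>F y hs - F x hs - F' x ((y - x) # hs)\<bar> \<le> C * e * (norm (y - x) * pnorm hs)"
  shows "mder n F F' x"
  unfolding mder_def
proof (intro allI impI)
  fix e :: real assume e: "0 < e"
  define e' where "e' = min 1 (e / (C + 1))"
  have e': "0 < e'" "e' \<le> 1" using e assms(1) by (auto simp: e'_def)
  have "C * e' \<le> C * (e / (C + 1))" using assms(1) by (intro mult_left_mono) (auto simp: e'_def)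
  also have "\<dots> \<le> e" using assms(1) e by (simp add: field_simps)
  finally have le: "C * e' \<le> e" .
  show "\<forall>\<^sub>F y in nhds x. \<forall>hs. length hs = n \<longrightarrow>
     \<bar>F y hs - F x hs - F' x ((y - x) # hs)\<bar> \<le> e * norm (y - x) * pnorm hs"
    using assms(2)[OF e']
  proof eventually_elim
    case (elim y)
    have "C * e' * (norm (y - x) * pnorm hs) \<le> e * (norm (y - x) * pnorm hs)" for hs :: "'a list"
      using le by (intro mult_right_mono mult_nonneg_nonneg pnorm_nonneg) auto
    then show ?case unfolding mult.assoc[of e] using elim order_trans by blast
  qed
qed

lemma bounded_multilinear_const_zero: "bounded_multilinear n (\<lambda>hs. 0::real)"
  unfolding bounded_multilinear_def by (auto intro!: exI[of _ "0::real"] linearI)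

lemma CK_zero: "CK k n S (\<lambda>x hs. 0)"
proof (induction k arbitrary: n)
  case 0
  then show ?case by (simp add: bounded_multilinear_const_zero mcont_def pnorm_nonneg)
next
  case (Suc k)
  have "Dv (\<lambda>x hs. 0) = (\<lambda>(x::'a) hs. 0)" by (simp add: Dv_def fun_eq_iff)
  then show ?case using Suc
    by (simp add: bounded_multilinear_const_zero mcont_def mder_def pnorm_nonneg)
qed

lemma CK_const:
  assumes "bounded_multilinear n M"
  shows "CK k n S (\<lambda>x. M)"
proof -
  have "CK k n UNIV (\<lambda>x. M)"
  proof (cases k)
    case 0
    then show ?thesis by (simp add: assms mcont_def pnorm_nonneg)
  next
    case (Suc j)
    show ?thesis unfolding Suc
      by (rule CK_SucI[where F' = "\<lambda>x hs. 0"]) (simp_all add: assms CK_zero mder_def pnorm_nonneg)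
  qed
  then show ?thesis by (rule CK_subset) simp
qed

lemma bounded_multilinear_add:
  fixes M M' :: "'a::real_normed_vector list \<Rightarrow> real"
  assumes "bounded_multilinear n M" "bounded_multilinear n M'"
  shows "bounded_multilinear n (\<lambda>hs. M hs + M' hs)"
proof -
  obtain K where K: "\<And>hs. length hs = n \<Longrightarrow> \<bar>M hs\<bar> \<le> K * pnorm hs"
    using assms(1) mboundedE unfolding bounded_multilinear_iff by metis
  obtain K' where K': "\<And>hs. length hs = n \<Longrightarrow> \<bar>M' hs\<bar> \<le> K' * pnorm hs"
    using assms(2) mboundedE unfolding bounded_multilinear_iff by metis
  have "\<bar>M hs + M' hs\<bar> \<le> (K + K') * pnorm hs" if "length hs = n" for hs
    using K[OF that] K'[OF that] by (simp add: distrib_right)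
  then have "\<exists>K. \<forall>hs. length hs = n \<longrightarrow> norm (M hs + M' hs) \<le> K * pnorm hs" by auto
  moreover have "linear (\<lambda>h. M (us @ h # vs) + M' (us @ h # vs))" if "length us + 1 + length vs = n" for us vs
    using assms that unfolding bounded_multilinear_def by (intro linear_compose_add) blast+
  ultimately show ?thesis unfolding bounded_multilinear_def by blast
qed

lemma CK_add:
  assumes "open S" "CK k n S F" "CK k n S G"
  shows "CK k n S (\<lambda>x hs. F x hs + G x hs)"
  using assms(2,3)
proof (induction k arbitrary: n F G)
  case (0 n F G)
  have "mcont n (\<lambda>x hs. F x hs + G x hs) x" if "x \<in> S" for x
  proof (rule mcontI[of 2])
    fix e :: real assume "0 < e"
    have m: "mcont n F x" "mcont n G x" using 0 that by auto
    show "\<forall>\<^sub>F y in nhds x. \<forall>hs. length hs = n \<longrightarrow>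
      \<bar>F y hs + G y hs - (F x hs + G x hs)\<bar> \<le> 2 * e * pnorm hs"
      using m(1)[unfolded mcont_def, rule_format, OF \<open>0 < e\<close>] m(2)[unfolded mcont_def, rule_format, OF \<open>0 < e\<close>]
    proof eventually_elim
      case (elim y)
      show ?case
      proof (intro allI impI)
        fix hs :: "'a list" assume "length hs = n"
        then have "\<bar>F y hs - F x hs\<bar> \<le> e * pnorm hs" "\<bar>G y hs - G x hs\<bar> \<le> e * pnorm hs"
          using elim by auto
        then show "\<bar>F y hs + G y hs - (F x hs + G x hs)\<bar> \<le> 2 * e * pnorm hs" by linarith
      qed
    qed
  qed simp
  then show ?case using 0 by (simp add: bounded_multilinear_add)
next
  case (Suc k n F G)
  show ?case
  proof (rule CK_SucI[OF assms(1), where F' = "\<lambda>x hs. Dv F x hs + Dv G x hs"])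
    show "CK k (Suc n) S (\<lambda>x hs. Dv F x hs + Dv G x hs)"
      by (rule Suc.IH) (use Suc.prems in auto)
    show "bounded_multilinear n (\<lambda>hs. F x hs + G x hs)" if "x \<in> S" for x
      using Suc.prems that by (simp add: bounded_multilinear_add)
    show "mder n (\<lambda>x hs. F x hs + G x hs) (\<lambda>x hs. Dv F x hs + Dv G x hs) x" if "x \<in> S" for x
    proof (rule mderI[of 2])
      fix e :: real assume "0 < e"
      have m: "mder n F (Dv F) x" "mder n G (Dv G) x" using Suc.prems that by auto
      show "\<forall>\<^sub>F y in nhds x. \<forall>hs. length hs = n \<longrightarrow>
        \<bar>F y hs + G y hs - (F x hs + G x hs) - (Dv F x ((y - x) # hs) + Dv G x ((y - x) # hs))\<bar>
           \<le> 2 * e * (norm (y - x) * pnorm hs)"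
        using m(1)[unfolded mder_def, rule_format, OF \<open>0 < e\<close>] m(2)[unfolded mder_def, rule_format, OF \<open>0 < e\<close>]
      proof eventually_elim
        case (elim y)
        show ?case
        proof (intro allI impI)
          fix hs :: "'a list" assume "length hs = n"
          then have "\<bar>F y hs - F x hs - Dv F x ((y - x) # hs)\<bar> \<le> e * norm (y - x) * pnorm hs"
            "\<bar>G y hs - G x hs - Dv G x ((y - x) # hs)\<bar> \<le> e * norm (y - x) * pnorm hs"
            using elim by auto
          then show "\<bar>F y hs + G y hs - (F x hs + G x hs) - (Dv F x ((y - x) # hs) + Dv G x ((y - x) # hs))\<bar>
           \<le> 2 * e * (norm (y - x) * pnorm hs)" by (simp add: mult.assoc)
        qed
      qed
    qed simp
  qed
qed

text \<open>In the product \<open>mprod bs F G\<close> the mask \<open>bs\<close> says which factor receives which argument. Differentiation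
  prepends one argument and hence one bit, so the product rule needs no permutation of arguments.\<close>

fun sel :: "bool \<Rightarrow> bool list \<Rightarrow> 'a list \<Rightarrow> 'a list" where
  "sel b (c # cs) (h # hs) = (if b = c then h # sel b cs hs else sel b cs hs)"
| "sel b _ _ = []"

lemma length_sel: "length hs = length bs \<Longrightarrow> length (sel b bs hs) = count_list bs b"
  by (induction b bs hs rule: sel.induct) auto

lemma pnorm_sel: "length hs = length bs \<Longrightarrow> pnorm (sel True bs hs) * pnorm (sel False bs hs) = pnorm hs"
proof (induction bs arbitrary: hs)
  case (Cons c cs)
  then obtain h t where ht: "hs = h # t" "length t = length cs" by (cases hs) auto
  show ?case unfolding ht(1) list.map prod_list.Cons Cons.IH[OF ht(2), symmetric]
    by (cases c) (simp_all add: algebra_simps)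
qed simp

lemma mlin_mprod:
  assumes "mlin (count_list bs True) A" "mlin (count_list bs False) B"
  shows "mlin (length bs) (\<lambda>hs. A (sel True bs hs) * B (sel False bs hs))"
  using assms
proof (induction bs arbitrary: A B)
  case (Cons c cs)
  show ?case
  proof (cases c)
    case True
    have "linear (\<lambda>h. A (h # sel True cs hs) * B (sel False cs hs))" if "length hs = length cs" for hs
    proof -
      have "linear (\<lambda>h. A (h # sel True cs hs))" using Cons.prems(1) True length_sel[OF that] by simp
      from linear_compose[OF this, of "\<lambda>t. t * B (sel False cs hs)"]
      show ?thesis by (simp add: o_def linear_times_of_real linearI distrib_right)
    qed
    moreover have "mlin (length cs) (\<lambda>hs. A (h # sel True cs hs) * B (sel False cs hs))" for h
      using Cons.IH[of "\<lambda>l. A (h # l)" B] Cons.prems True by simp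
    ultimately show ?thesis using True by simp
  next
    case False
    have "linear (\<lambda>h. A (sel True cs hs) * B (h # sel False cs hs))" if "length hs = length cs" for hs
    proof -
      have "linear (\<lambda>h. B (h # sel False cs hs))" using Cons.prems(2) False length_sel[OF that] by simp
      from linear_compose[OF this, of "\<lambda>t. A (sel True cs hs) * t"]
      show ?thesis by (simp add: o_def linearI distrib_left)
    qed
    moreover have "mlin (length cs) (\<lambda>hs. A (sel True cs hs) * B (h # sel False cs hs))" for h
      using Cons.IH[of A "\<lambda>l. B (h # l)"] Cons.prems False by simp
    ultimately show ?thesis using False by simp
  qed
qed simp

definition mprod :: "bool list \<Rightarrow> ('a \<Rightarrow> 'a list \<Rightarrow> real) \<Rightarrow> ('a \<Rightarrow> 'a list \<Rightarrow> real) \<Rightarrow> 'a \<Rightarrow> 'a list \<Rightarrow> real" where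
  "mprod bs F G x hs = F x (sel True bs hs) * G x (sel False bs hs)"

lemma bounded_multilinear_mprod:
  assumes "bounded_multilinear (count_list bs True) (F x)" "bounded_multilinear (count_list bs False) (G x)"
  shows "bounded_multilinear (length bs) (mprod bs F G x)"
proof -
  obtain K where K: "K > 0" "\<And>hs. length hs = count_list bs True \<Longrightarrow> \<bar>F x hs\<bar> \<le> K * pnorm hs"
    using assms(1) mboundedE unfolding bounded_multilinear_iff by metis
  obtain K' where K': "K' > 0" "\<And>hs. length hs = count_list bs False \<Longrightarrow> \<bar>G x hs\<bar> \<le> K' * pnorm hs"
    using assms(2) mboundedE unfolding bounded_multilinear_iff by metis
  have "\<bar>mprod bs F G x hs\<bar> \<le> (K * K') * pnorm hs" if l: "length hs = length bs" for hs
  proof -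
    have "\<bar>mprod bs F G x hs\<bar> \<le> (K * pnorm (sel True bs hs)) * (K' * pnorm (sel False bs hs))"
      unfolding mprod_def abs_mult using K K' length_sel[OF l] pnorm_nonneg
      by (intro mult_mono mult_nonneg_nonneg) (auto intro: less_imp_le)
    then show ?thesis using pnorm_sel[OF l] by (simp add: mult_ac)
  qed
  then have "mbounded (length bs) (mprod bs F G x)" unfolding mbounded_def by blast
  moreover have "mlin (length bs) (mprod bs F G x)"
    using mlin_mprod[of bs "F x" "G x"] assms unfolding bounded_multilinear_iff mprod_def[abs_def] by simp
  ultimately show ?thesis unfolding bounded_multilinear_iff by simp
qed

lemma mcont_mprod:
  assumes "bounded_multilinear (count_list bs True) (F x)" "bounded_multilinear (count_list bs False) (G x)"
    "mcont (count_list bs True) F x" "mcont (count_list bs False) G x"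
  shows "mcont (length bs) (mprod bs F G) x"
proof -
  obtain K where K: "K > 0" "\<And>hs. length hs = count_list bs True \<Longrightarrow> \<bar>F x hs\<bar> \<le> K * pnorm hs"
    using assms(1) mboundedE unfolding bounded_multilinear_iff by metis
  obtain K' where K': "K' > 0" "\<And>hs. length hs = count_list bs False \<Longrightarrow> \<bar>G x hs\<bar> \<le> K' * pnorm hs"
    using assms(2) mboundedE unfolding bounded_multilinear_iff by metis
  show ?thesis
  proof (rule mcontI[of "K + K' + 1"])
    fix e :: real assume e: "0 < e" "e \<le> 1"
    show "\<forall>\<^sub>F y in nhds x. \<forall>hs. length hs = length bs \<longrightarrow>
       \<bar>mprod bs F G y hs - mprod bs F G x hs\<bar> \<le> (K + K' + 1) * e * pnorm hs"
      using assms(3)[unfolded mcont_def, rule_format, OF e(1)]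
        assms(4)[unfolded mcont_def, rule_format, OF e(1)]
    proof eventually_elim
      case (elim y)
      show ?case
      proof (intro allI impI)
        fix hs :: "'a list" assume l: "length hs = length bs"
        define s t where st: "s = sel True bs hs" "t = sel False bs hs"
        have len: "length s = count_list bs True" "length t = count_list bs False"
          using length_sel[OF l] st by auto
        have p: "0 \<le> pnorm s" "0 \<le> pnorm t" by (auto intro: pnorm_nonneg)
        have f: "\<bar>F x s\<bar> \<le> K * pnorm s" "\<bar>F y s - F x s\<bar> \<le> e * pnorm s"
          "\<bar>G x t\<bar> \<le> K' * pnorm t" "\<bar>G y t - G x t\<bar> \<le> e * pnorm t"
          using K K' elim len by auto
        have "\<bar>F y s * G y t - F x s * G x t\<bar> =
          \<bar>(F y s - F x s) * (G y t - G x t) + (F y s - F x s) * G x t + F x s * (G y t - G x t)\<bar>"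
          by (simp add: algebra_simps)
        also have "\<dots> \<le> \<bar>F y s - F x s\<bar> * \<bar>G y t - G x t\<bar> + \<bar>F y s - F x s\<bar> * \<bar>G x t\<bar> + \<bar>F x s\<bar> * \<bar>G y t - G x t\<bar>"
          by (intro order_trans[OF abs_triangle_ineq] add_mono) (simp_all add: abs_mult)
        also have "\<dots> \<le> (e * pnorm s) * (e * pnorm t) + (e * pnorm s) * (K' * pnorm t) + (K * pnorm s) * (e * pnorm t)"
          using f p e K(1) K'(1) by (intro add_mono mult_mono) auto
        also have "\<dots> = (e + K + K') * e * (pnorm s * pnorm t)" by (simp add: algebra_simps)
        also have "\<dots> \<le> (K + K' + 1) * e * (pnorm s * pnorm t)"
          using e p by (intro mult_right_mono mult_nonneg_nonneg) auto
        finally show "\<bar>mprod bs F G y hs - mprod bs F G x hs\<bar> \<le> (K + K' + 1) * e * pnorm hs"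
          using pnorm_sel[OF l] by (simp add: mprod_def st)
      qed
    qed
  qed (use K K' in auto)
qed

lemma mder_mprod:
  assumes "bounded_multilinear (count_list bs True) (F x)" "bounded_multilinear (count_list bs False) (G x)"
    "bounded_multilinear (Suc (count_list bs True)) (F' x)"
    "mder (count_list bs True) F F' x" "mder (count_list bs False) G G' x" "mcont (count_list bs False) G x"
  shows "mder (length bs) (mprod bs F G) (\<lambda>x hs. mprod (True # bs) F' G x hs + mprod (False # bs) F G' x hs) x"
proof -
  obtain K where K: "K > 0" "\<And>hs. length hs = count_list bs True \<Longrightarrow> \<bar>F x hs\<bar> \<le> K * pnorm hs"
    using assms(1) mboundedE unfolding bounded_multilinear_iff by metis
  obtain K' where K': "K' > 0" "\<And>hs. length hs = count_list bs False \<Longrightarrow> \<bar>G x hs\<bar> \<le> K' * pnorm hs"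
    using assms(2) mboundedE unfolding bounded_multilinear_iff by metis
  obtain L where L: "L > 0" "\<And>hs. length hs = Suc (count_list bs True) \<Longrightarrow> \<bar>F' x hs\<bar> \<le> L * pnorm hs"
    using assms(3) mboundedE unfolding bounded_multilinear_iff by metis
  show ?thesis
  proof (rule mderI[of "K + K' + L + 1"])
    fix e :: real assume e: "0 < e" "e \<le> 1"
    show "\<forall>\<^sub>F y in nhds x. \<forall>hs. length hs = length bs \<longrightarrow>
       \<bar>mprod bs F G y hs - mprod bs F G x hs - (mprod (True # bs) F' G x ((y - x) # hs) + mprod (False # bs) F G' x ((y - x) # hs))\<bar>
       \<le> (K + K' + L + 1) * e * (norm (y - x) * pnorm hs)"
      using assms(4)[unfolded mder_def, rule_format, OF e(1)]
        assms(5)[unfolded mder_def, rule_format, OF e(1)]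
        assms(6)[unfolded mcont_def, rule_format, OF e(1)]
    proof eventually_elim
      case (elim y)
      show ?case
      proof (intro allI impI)
        fix hs :: "'a list" assume l: "length hs = length bs"
        define s t n where st: "s = sel True bs hs" "t = sel False bs hs" "n = norm (y - x)"
        have len: "length s = count_list bs True" "length t = count_list bs False"
          using length_sel[OF l] st by auto
        have p: "0 \<le> pnorm s" "0 \<le> pnorm t" "0 \<le> n" by (auto intro: pnorm_nonneg simp: st)
        define f g where fg: "f = F' x ((y - x) # s)" "g = G' x ((y - x) # t)"
        have f: "\<bar>F x s\<bar> \<le> K * pnorm s" "\<bar>F y s - F x s - f\<bar> \<le> e * n * pnorm s"
          "\<bar>G x t\<bar> \<le> K' * pnorm t" "\<bar>G y t - G x t\<bar> \<le> e * pnorm t"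
          "\<bar>G y t - G x t - g\<bar> \<le> e * n * pnorm t"
          unfolding fg st(3) using K(2)[OF len(1)] K'(2)[OF len(2)] elim(1)[rule_format, OF len(1)]
            elim(2)[rule_format, OF len(2)] elim(3)[rule_format, OF len(2)] by blast+
        have ff: "\<bar>f\<bar> \<le> L * n * pnorm s" using L(2)[of "(y-x) # s"] len by (simp add: fg st(3) mult.assoc)
        \<comment> \<open>Only the last term uses differentiability of \<open>G\<close>. In the
          others the first factor is already of order \<open>norm (y - x)\<close>, so continuity of
          \<open>G\<close> is enough there.\<close>
        have "\<bar>F y s * G y t - F x s * G x t - (f * G x t + F x s * g)\<bar> =
          \<bar>(F y s - F x s - f) * (G y t - G x t) + (F y s - F x s - f) * G x t + f * (G y t - G x t)
            + F x s * (G y t - G x t - g)\<bar>"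
          by (simp add: algebra_simps)
        also have "\<dots> \<le> \<bar>F y s - F x s - f\<bar> * \<bar>G y t - G x t\<bar> + \<bar>F y s - F x s - f\<bar> * \<bar>G x t\<bar>
            + \<bar>f\<bar> * \<bar>G y t - G x t\<bar> + \<bar>F x s\<bar> * \<bar>G y t - G x t - g\<bar>"
          by (intro order_trans[OF abs_triangle_ineq] add_mono) (simp_all add: abs_mult)
        also have "\<dots> \<le> (e * n * pnorm s) * (e * pnorm t) + (e * n * pnorm s) * (K' * pnorm t)
            + (L * n * pnorm s) * (e * pnorm t) + (K * pnorm s) * (e * n * pnorm t)"
          by (intro add_mono mult_mono f ff) (use p e K(1) K'(1) L(1) in \<open>simp_all\<close>)
        also have "\<dots> = (e + K + K' + L) * e * (n * (pnorm s * pnorm t))" by (simp add: algebra_simps)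
        also have "\<dots> \<le> (K + K' + L + 1) * e * (n * (pnorm s * pnorm t))"
          using e p by (intro mult_right_mono mult_nonneg_nonneg) auto
        finally show "\<bar>mprod bs F G y hs - mprod bs F G x hs - (mprod (True # bs) F' G x ((y - x) # hs)
            + mprod (False # bs) F G' x ((y - x) # hs))\<bar> \<le> (K + K' + L + 1) * e * (norm (y - x) * pnorm hs)"
          using pnorm_sel[OF l] by (simp add: mprod_def st fg)
      qed
    qed
  qed (use K K' L in auto)
qed

lemma CK_mprod:
  assumes "open S" "CK k (count_list bs True) S F" "CK k (count_list bs False) S G"
  shows "CK k (length bs) S (mprod bs F G)"
  using assms(2,3)
proof (induction k arbitrary: bs F G)
  case (0 bs F G)
  then show ?case by (auto intro!: bounded_multilinear_mprod mcont_mprod)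
next
  case (Suc k bs F G)
  show ?case
  proof (rule CK_SucI[OF assms(1), where F' = "\<lambda>x hs. mprod (True # bs) (Dv F) G x hs + mprod (False # bs) F (Dv G) x hs"])
    have "CK k (length (True # bs)) S (mprod (True # bs) (Dv F) G)"
      using Suc.prems CK_Suc[OF Suc.prems(2)] by (intro Suc.IH) auto
    moreover have "CK k (length (False # bs)) S (mprod (False # bs) F (Dv G))"
      using Suc.prems CK_Suc[OF Suc.prems(1)] by (intro Suc.IH) auto
    ultimately show "CK k (Suc (length bs)) S (\<lambda>x hs. mprod (True # bs) (Dv F) G x hs + mprod (False # bs) F (Dv G) x hs)"
      using CK_add[OF assms(1)] by simp
  next
    fix x assume x: "x \<in> S"
    show "bounded_multilinear (length bs) (mprod bs F G x)"
      using Suc.prems x by (auto intro!: bounded_multilinear_mprod)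
    show "mder (length bs) (mprod bs F G) (\<lambda>x hs. mprod (True # bs) (Dv F) G x hs + mprod (False # bs) F (Dv G) x hs) x"
      using Suc.prems x CK_bm[OF CK_Dv[OF Suc.prems(1)] x]
      by (intro mder_mprod) auto
  qed
qed

text \<open>The mask consisting of \<open>False\<close> only hands every argument to
  \<open>G\<close> and leaves \<open>F\<close> as a scalar factor.\<close>

lemma CK_mult:
  assumes "open S" "CK k 0 S F" "CK k n S G"
  shows "CK k n S (\<lambda>x hs. F x [] * G x hs)"
proof -
  have len: "length hs = n \<Longrightarrow> sel False (replicate n False) hs = hs \<and> sel True (replicate n False) hs = []"
    for hs :: "'a list"
    by (induction hs arbitrary: n) auto
  have count: "count_list (replicate n False) True = 0" "count_list (replicate n False) False = n"
    by (induction n) auto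
  have "CK k n S (mprod (replicate n False) F G)"
    using CK_mprod[OF assms(1), of k "replicate n False" F G] assms(2,3) unfolding count length_replicate by blast
  from CK_cong[OF assms(1) _ this] show ?thesis
    unfolding mprod_def using len by simp
qed

lemma mder_0_iff:
  assumes "bounded_multilinear 1 (F' x)"
  shows "mder 0 F F' x \<longleftrightarrow> ((\<lambda>y. F y []) has_derivative (\<lambda>h. F' x [h])) (at x)"
proof
  assume "mder 0 F F' x"
  then show "((\<lambda>y. F y []) has_derivative (\<lambda>h. F' x [h])) (at x)"
    using mder_has_derivative[of 0 F' x F "[]"] assms by simp
next
  assume d: "((\<lambda>y. F y []) has_derivative (\<lambda>h. F' x [h])) (at x)"
  then have bl: "bounded_linear (\<lambda>h. F' x [h])" by (rule has_derivative_bounded_linear)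
  show "mder 0 F F' x"
    using d unfolding has_derivative_at_iff_eventually[OF bl] mder_def by simp
qed

lemma bounded_multilinear_1_iff:
  "bounded_multilinear 1 M \<longleftrightarrow> bounded_linear (\<lambda>h. M [h] :: real)"
proof
  assume b: "bounded_multilinear 1 M"
  then have lin: "linear (\<lambda>h. M [h])" unfolding bounded_multilinear_iff by simp
  obtain K where K: "K > 0" "\<And>hs. length hs = 1 \<Longrightarrow> \<bar>M hs\<bar> \<le> K * pnorm hs"
    using b mboundedE unfolding bounded_multilinear_iff by metis
  show "bounded_linear (\<lambda>h. M [h])"
    by (rule bounded_linear_intro[where K = K])
      (use linear_add[OF lin] linear_scale[OF lin] K(2)[of "[_]"] in \<open>auto simp: mult.commute\<close>)
next
  assume b: "bounded_linear (\<lambda>h. M [h])"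
  then obtain K where K: "\<And>h. norm (M [h]) \<le> norm h * K" using bounded_linear.bounded by metis
  have "\<bar>M hs\<bar> \<le> K * pnorm hs" if "length hs = 1" for hs
    using that K by (cases hs) (auto simp: mult.commute)
  then show "bounded_multilinear 1 M"
    unfolding bounded_multilinear_iff mbounded_def
    using b bounded_linear.linear by auto
qed

lemma bounded_multilinear_0: "bounded_multilinear 0 (M :: _ \<Rightarrow> real)"
  unfolding bounded_multilinear_iff mbounded_def by (auto intro!: exI[of _ "\<bar>M []\<bar>"])

lemma mcont_0_iff: "mcont 0 F x \<longleftrightarrow> isCont (\<lambda>y. F y []) x"
proof -
  have "mcont 0 F x \<longleftrightarrow> ((\<lambda>y. F y []) \<longlongrightarrow> F x []) (nhds x)"
  proof
    assume "mcont 0 F x"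
    then show "((\<lambda>y. F y []) \<longlongrightarrow> F x []) (nhds x)"
    proof (intro tendstoI)
      fix e :: real assume "0 < e"
      then have "\<forall>\<^sub>F y in nhds x. \<bar>F y [] - F x []\<bar> \<le> e / 2"
        using \<open>mcont 0 F x\<close> unfolding mcont_def by (auto dest!: spec[of _ "e / 2"])
      then show "\<forall>\<^sub>F y in nhds x. dist (F y []) (F x []) < e"
        by eventually_elim (use \<open>0 < e\<close> in \<open>simp add: dist_real_def\<close>)
    qed
  next
    assume t: "((\<lambda>y. F y []) \<longlongrightarrow> F x []) (nhds x)"
    show "mcont 0 F x"
      unfolding mcont_def
    proof (intro allI impI)
      fix e :: real assume "0 < e"
      from tendstoD[OF t this]
      show "\<forall>\<^sub>F y in nhds x. \<forall>hs. length hs = 0 \<longrightarrow> \<bar>F y hs - F x hs\<bar> \<le> e * pnorm hs"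
        by eventually_elim (simp add: dist_real_def)
    qed
  qed
  then show ?thesis
    using tendsto_at_iff_tendsto_nhds[of "\<lambda>y. F y []" x] unfolding isCont_def by blast
qed

lemma has_derivative_Dv:
  assumes "CK (Suc k) 0 S F" "x \<in> S"
  shows "((\<lambda>y. F y []) has_derivative (\<lambda>h. Dv F x [h])) (at x)"
  using assms CK_bm[OF CK_Dv[OF assms(1)] assms(2)] mder_0_iff[of "Dv F" x F] by simp

lemma CK_Suc_0I:
  assumes "open S" "\<And>x. x \<in> S \<Longrightarrow> ((\<lambda>y. F y []) has_derivative (\<lambda>h. F' x [h])) (at x)" "CK k 1 S F'"
  shows "CK (Suc k) 0 S F"
proof (rule CK_SucI[OF assms(1), where F' = F'])
  show "mder 0 F F' x" if "x \<in> S" for x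
    using mder_0_iff[of F' x F] CK_bm[OF assms(3) that] assms(2)[OF that] by simp
qed (use assms bounded_multilinear_0 in auto)

text \<open>The derivative of \<open>D j\<close> after \<open>F\<close> is \<open>D (Suc j)\<close>
  after \<open>F\<close>, times \<open>Dv F\<close>. The index \<open>j\<close> therefore shifts
  during the induction on \<open>k\<close>, and the whole sequence \<open>D\<close> has to be given
  in advance.\<close>

lemma CK_comp:
  assumes S: "open S" and T: "open T" and D: "\<And>n t. t \<in> T \<Longrightarrow> (D n has_real_derivative D (Suc n) t) (at t)"
    and "CK k 0 S F" "\<And>x. x \<in> S \<Longrightarrow> F x [] \<in> T"
  shows "CK k 0 S (\<lambda>x hs. D j (F x []))"
  using assms(4,5)
proof (induction k arbitrary: j)
  case 0
  have "isCont (\<lambda>y. D j (F y [])) x" if "x \<in> S" for x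
    using 0 that DERIV_isCont[OF D] mcont_0_iff[of F x]
    by (intro isCont_o2[where f = "\<lambda>y. F y []" and g = "D j"]) auto
  then show ?case by (simp add: bounded_multilinear_0 mcont_0_iff)
next
  case (Suc k)
  show ?case
  proof (rule CK_Suc_0I[OF S, where F' = "\<lambda>x hs. D (Suc j) (F x []) * Dv F x hs"])
    show "CK k 1 S (\<lambda>x hs. D (Suc j) (F x []) * Dv F x hs)"
      using Suc.IH[of "Suc j"] Suc.prems CK_Suc[OF Suc.prems(1)]
      by (intro CK_mult[OF S, where F = "\<lambda>x hs. D (Suc j) (F x [])"]) auto
    fix x assume x: "x \<in> S"
    have "(D j has_derivative (\<lambda>h. h * D (Suc j) (F x []))) (at (F x []))"
      using D[OF Suc.prems(2)[OF x], of j] unfolding has_field_derivative_def mult.commute[of _ "D (Suc j) (F x [])"] .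
    from has_derivative_compose[OF has_derivative_Dv[OF Suc.prems(1) x] this]
    show "((\<lambda>y. D j (F y [])) has_derivative (\<lambda>h. D (Suc j) (F x []) * Dv F x [h])) (at x)"
      by (simp add: mult.commute)
  qed
qed

lemma CK_linear:
  assumes "bounded_linear f"
  shows "CK k 0 S (\<lambda>x hs. f x)"
proof -
  have "CK k 0 UNIV (\<lambda>x hs. f x)"
  proof (cases k)
    case 0
    then show ?thesis
      by (simp add: bounded_multilinear_0 mcont_0_iff assms linear_continuous_at)
  next
    case (Suc j)
    show ?thesis unfolding Suc
      by (rule CK_Suc_0I[where F' = "\<lambda>x hs. f (hd hs)"])
        (auto intro!: CK_const bounded_linear_imp_has_derivative
          simp: assms bounded_multilinear_1_iff[unfolded One_nat_def])
  qed
  then show ?thesis by (rule CK_subset) simp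
qed

lemma pnorm_map_le:
  assumes "\<And>h. norm (T h) \<le> K * norm h" "0 \<le> K"
  shows "pnorm (map T hs) \<le> K ^ length hs * pnorm hs"
proof (induction hs)
  case (Cons h hs)
  have "norm (T h) * pnorm (map T hs) \<le> (K * norm h) * (K ^ length hs * pnorm hs)"
    using assms Cons by (intro mult_mono pnorm_nonneg) auto
  then show ?case by (simp add: mult_ac)
qed simp

text \<open>For a linear inner map each derivative merely has its arguments transported by
  \<open>map T\<close>, so no further terms arise under repeated differentiation.\<close>

lemma CK_precomp:
  fixes T :: "'b::real_normed_vector \<Rightarrow> 'a::real_normed_vector"
  assumes S: "open S" and T: "bounded_linear T" and "CK k n S F"
  shows "CK k n (T -` S) (\<lambda>x hs. F (T x) (map T hs))"
proof -
  obtain K where K: "0 < K" "\<And>h. norm (T h) \<le> norm h * K"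
    using bounded_linear.pos_bounded[OF T] by blast
  have oT: "open (T -` S)"
    using S continuous_open_vimage linear_continuous_at[OF T] by blast
  have p: "pnorm (map T hs) \<le> K ^ length hs * pnorm hs" for hs
    using pnorm_map_le[of T K] K by (simp add: mult.commute)
  have ev: "\<forall>\<^sub>F y in nhds x. P (T y)" if "\<forall>\<^sub>F y in nhds (T x). P y" for P x
  proof -
    have "filterlim T (nhds (T x)) (nhds x)"
      using linear_continuous_at[OF T] by (simp add: isCont_def tendsto_at_iff_tendsto_nhds)
    then show ?thesis using that unfolding filterlim_iff by blast
  qed
  have bm: "bounded_multilinear n (\<lambda>hs. M (map T hs))" if "bounded_multilinear n M" for n and M :: "_ \<Rightarrow> real"
  proof -
    obtain L where L: "L > 0" "\<And>hs. length hs = n \<Longrightarrow> \<bar>M hs\<bar> \<le> L * pnorm hs"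
      using \<open>bounded_multilinear n M\<close> mboundedE unfolding bounded_multilinear_iff by blast
    have "\<bar>M (map T hs)\<bar> \<le> (L * K ^ n) * pnorm hs" if "length hs = n" for hs
      using L(2)[of "map T hs"] mult_left_mono[OF p[of hs], of L] L(1) that unfolding length_map mult.assoc by (intro order_trans[OF L(2)[of "map T hs"]]) auto
    moreover have "linear (\<lambda>h. M (map T us @ T h # map T vs))" if "length us + 1 + length vs = n" for us vs
    proof -
      have "linear (\<lambda>h. M (map T us @ h # map T vs))"
        using \<open>bounded_multilinear n M\<close> that unfolding bounded_multilinear_def by simp
      from linear_compose[OF bounded_linear.linear[OF T] this] show ?thesis by (simp add: o_def)
    qed
    ultimately show ?thesis unfolding bounded_multilinear_def by auto
  qed
  show ?thesis using assms(3)
  proof (induction k arbitrary: n F)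
    case (0 n F)
    have "mcont n (\<lambda>x hs. F (T x) (map T hs)) x" if "T x \<in> S" for x
    proof (rule mcontI[of "K ^ n"])
      fix e :: real assume e: "0 < e"
      have "mcont n F (T x)" using 0 that by simp
      from ev[OF this[unfolded mcont_def, rule_format, OF e]]
      show "\<forall>\<^sub>F y in nhds x. \<forall>hs. length hs = n \<longrightarrow>
        \<bar>F (T y) (map T hs) - F (T x) (map T hs)\<bar> \<le> K ^ n * e * pnorm hs"
      proof eventually_elim
        case (elim y)
        show ?case
        proof (intro allI impI)
          fix hs :: "'b list" assume l: "length hs = n"
          have "\<bar>F (T y) (map T hs) - F (T x) (map T hs)\<bar> \<le> e * pnorm (map T hs)"
            using elim[rule_format, of "map T hs"] l by (simp only: length_map)
          also have "\<dots> \<le> e * (K ^ n * pnorm hs)" using p[of hs] e l by (intro mult_left_mono) auto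
          finally show "\<bar>F (T y) (map T hs) - F (T x) (map T hs)\<bar> \<le> K ^ n * e * pnorm hs"
            by (simp add: mult_ac)
        qed
      qed
    qed (use K in simp)
    then show ?case using 0 bm by simp
  next
    case (Suc k n F)
    show ?case
    proof (rule CK_SucI[OF oT, where F' = "\<lambda>x hs. Dv F (T x) (map T hs)"])
      show "CK k (Suc n) (T -` S) (\<lambda>x hs. Dv F (T x) (map T hs))"
        using Suc.IH[of "Suc n" "Dv F"] Suc.prems by simp
      show "bounded_multilinear n (\<lambda>hs. F (T x) (map T hs))" if "x \<in> T -` S" for x
        using Suc.prems that bm by simp
      fix x assume x: "x \<in> T -` S"
      show "mder n (\<lambda>x hs. F (T x) (map T hs)) (\<lambda>x hs. Dv F (T x) (map T hs)) x"
      proof (rule mderI[of "K ^ Suc n"])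
        fix e :: real assume e: "0 < e"
        have "mder n F (Dv F) (T x)" using Suc.prems x by simp
        from ev[OF this[unfolded mder_def, rule_format, OF e]]
        show "\<forall>\<^sub>F y in nhds x. \<forall>hs. length hs = n \<longrightarrow>
          \<bar>F (T y) (map T hs) - F (T x) (map T hs) - Dv F (T x) (map T ((y - x) # hs))\<bar>
          \<le> K ^ Suc n * e * (norm (y - x) * pnorm hs)"
        proof eventually_elim
          case (elim y)
          show ?case
          proof (intro allI impI)
            fix hs :: "'b list" assume l: "length hs = n"
            have "\<bar>F (T y) (map T hs) - F (T x) (map T hs) - Dv F (T x) (map T ((y - x) # hs))\<bar>
                \<le> e * (norm (T y - T x) * pnorm (map T hs))"
              using elim[rule_format, of "map T hs"] l
              by (simp add: linear_diff[OF bounded_linear.linear[OF T]] mult.assoc)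
            also have "\<dots> \<le> e * ((norm (y - x) * K) * (K ^ n * pnorm hs))"
              using p[of hs] e l K(1) K(2)[of "y - x"]
              by (intro mult_left_mono mult_mono)
                (auto simp: linear_diff[OF bounded_linear.linear[OF T]] simp del: map_map intro!: pnorm_nonneg)
            finally show "\<bar>F (T y) (map T hs) - F (T x) (map T hs) - Dv F (T x) (map T ((y - x) # hs))\<bar>
                \<le> K ^ Suc n * e * (norm (y - x) * pnorm hs)"
              by (simp add: mult_ac)
          qed
        qed
      qed (use K in simp)
    qed
  qed
qed

lemma bounded_multilinear_diff:
  fixes M M' :: "'a::real_normed_vector list \<Rightarrow> real"
  assumes "bounded_multilinear n M" "bounded_multilinear n M'"
  shows "bounded_multilinear n (\<lambda>hs. M hs - M' hs)"
proof -
  have "bounded_multilinear n (\<lambda>hs. - M' hs)"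
    using assms(2) unfolding bounded_multilinear_def
    by (auto intro!: linear_compose_neg)
  from bounded_multilinear_add[OF assms(1) this] show ?thesis by simp
qed

lemma bounded_multilinear_Cons:
  fixes M :: "'a::real_normed_vector list \<Rightarrow> real"
  assumes "bounded_multilinear (Suc n) M"
  shows "bounded_multilinear n (\<lambda>hs. M (h # hs))"
proof -
  obtain K where K: "\<And>hs. length hs = Suc n \<Longrightarrow> \<bar>M hs\<bar> \<le> K * pnorm hs"
    using assms mboundedE unfolding bounded_multilinear_iff by metis
  have "\<bar>M (h # hs)\<bar> \<le> (K * norm h) * pnorm hs" if "length hs = n" for hs
    using K[of "h # hs"] that by (simp add: mult.assoc)
  then show ?thesis
    using assms unfolding bounded_multilinear_iff mbounded_def by auto
qed

lemma mcontI_multi_onorm: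
  assumes "open S" "x \<in> S" and bm: "\<And>y. y \<in> S \<Longrightarrow> bounded_multilinear n (F y)"
    and lim: "((\<lambda>y. multi_onorm n (\<lambda>hs. F y hs - F x hs)) \<longlongrightarrow> 0) (at x)"
  shows "mcont n F x"
  unfolding mcont_def
proof (intro allI impI)
  fix e :: real assume e: "0 < e"
  have ev: "\<forall>\<^sub>F y in nhds x. y \<noteq> x \<longrightarrow> \<bar>multi_onorm n (\<lambda>hs. F y hs - F x hs)\<bar> < e"
    using tendstoD[OF lim e] unfolding eventually_at_filter dist_real_def by simp
  show "\<forall>\<^sub>F y in nhds x. \<forall>hs. length hs = n \<longrightarrow> \<bar>F y hs - F x hs\<bar> \<le> e * pnorm hs"
    using ev eventually_nhds_in_open[OF assms(1,2)]
  proof eventually_elim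
    case (elim y)
    show ?case
    proof (intro allI impI)
      fix hs :: "'a list" assume l: "length hs = n"
      show "\<bar>F y hs - F x hs\<bar> \<le> e * pnorm hs"
      proof (cases "y = x")
        case True
        then show ?thesis using e pnorm_nonneg[of hs] by simp
      next
        case False
        have "\<bar>F y hs - F x hs\<bar> \<le> multi_onorm n (\<lambda>hs. F y hs - F x hs) * pnorm hs"
          by (rule multi_onorm_bound[OF bounded_multilinear_diff[OF bm bm] l]) (use elim assms in auto)
        also have "\<dots> \<le> e * pnorm hs"
          using elim False by (intro mult_right_mono pnorm_nonneg) auto
        finally show ?thesis .
      qed
    qed
  qed
qed

lemma mderI_multi_onorm:
  assumes "open S" "x \<in> S" and bm: "\<And>y. y \<in> S \<Longrightarrow> bounded_multilinear n (F y)"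
    and bm': "bounded_multilinear (Suc n) (F' x)"
    and lim: "((\<lambda>y. multi_onorm n (\<lambda>hs. F y hs - F x hs - F' x ((y - x) # hs)) / norm (y - x)) \<longlongrightarrow> 0) (at x)"
  shows "mder n F F' x"
  unfolding mder_def
proof (intro allI impI)
  fix e :: real assume e: "0 < e"
  have ev: "\<forall>\<^sub>F y in nhds x. y \<noteq> x \<longrightarrow>
      \<bar>multi_onorm n (\<lambda>hs. F y hs - F x hs - F' x ((y - x) # hs)) / norm (y - x)\<bar> < e"
    using tendstoD[OF lim e] unfolding eventually_at_filter dist_real_def by simp
  show "\<forall>\<^sub>F y in nhds x. \<forall>hs. length hs = n \<longrightarrow>
     \<bar>F y hs - F x hs - F' x ((y - x) # hs)\<bar> \<le> e * norm (y - x) * pnorm hs"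
    using ev eventually_nhds_in_open[OF assms(1,2)]
  proof eventually_elim
    case (elim y)
    show ?case
    proof (intro allI impI)
      fix hs :: "'a list" assume l: "length hs = n"
      have bmM: "bounded_multilinear n (\<lambda>hs. F y hs - F x hs - F' x ((y - x) # hs))"
        using elim(2) assms(2) by (intro bounded_multilinear_diff bm bounded_multilinear_Cons bm')
      note b = multi_onorm_bound[OF bmM l]
      show "\<bar>F y hs - F x hs - F' x ((y - x) # hs)\<bar> \<le> e * norm (y - x) * pnorm hs"
      proof (cases "y = x")
        case True
        have "\<bar>F' x (0 # hs)\<bar> = 0"
          using bm' l linear_0[of "\<lambda>h. F' x (h # hs)"] unfolding bounded_multilinear_iff by simp
        then show ?thesis using True by simp
      next
        case False
        note b
        also have "multi_onorm n (\<lambda>hs. F y hs - F x hs - F' x ((y - x) # hs)) * pnorm hs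
            \<le> (e * norm (y - x)) * pnorm hs"
          using elim(1) False by (intro mult_right_mono pnorm_nonneg) (auto simp: abs_less_iff field_simps)
        finally show ?thesis .
      qed
    qed
  qed
qed

text \<open>Induction on the remaining order \<open>m\<close>, coupled to the degree
  \<open>j\<close> already reached by \<open>m + j \<le> k\<close>. Only finite orders occur, also
  when \<open>k\<close> is infinite.\<close>

lemma C_smooth_on_imp_CK:
  fixes f :: "'a::real_normed_vector \<Rightarrow> real"
  assumes S: "open S" and "C_smooth_on k S f" "enat n \<le> k"
  shows "CK n 0 S (\<lambda>x hs. f x)"
proof -
  obtain D :: "nat \<Rightarrow> 'a \<Rightarrow> 'a list \<Rightarrow> real" where D0: "\<And>x. x \<in> S \<Longrightarrow> D 0 x [] = f x"
    and bm: "\<And>n x. enat n \<le> k \<Longrightarrow> x \<in> S \<Longrightarrow> bounded_multilinear n (D n x)"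
    and der: "\<And>n x. enat n < k \<Longrightarrow> x \<in> S \<Longrightarrow>
           ((\<lambda>y. multi_onorm n (\<lambda>hs. D n y hs - D n x hs - D (Suc n) x ((y - x) # hs))
                  / norm (y - x)) \<longlongrightarrow> 0) (at x)"
    and cont: "\<And>n x. enat n \<le> k \<Longrightarrow> x \<in> S \<Longrightarrow>
           ((\<lambda>y. multi_onorm n (\<lambda>hs. D n y hs - D n x hs)) \<longlongrightarrow> 0) (at x)"
    using assms(2) unfolding C_smooth_on_def by blast
  have "CK m j S (D j)" if "enat (m + j) \<le> k" for m j
    using that
  proof (induction m arbitrary: j)
    case 0
    then show ?case using bm cont mcontI_multi_onorm[OF S, of _ j "D j"] by simp
  next
    case (Suc m)
    have j: "enat j < k" "enat j \<le> k" "enat (Suc j) \<le> k"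
      using Suc.prems by (cases k; simp)+
    show ?case
    proof (rule CK_SucI[OF S])
      show "CK m (Suc j) S (D (Suc j))" using Suc by simp
      show "bounded_multilinear j (D j x)" if "x \<in> S" for x using bm j that by simp
      show "mder j (D j) (D (Suc j)) x" if "x \<in> S" for x
        by (rule mderI_multi_onorm[OF S that]) (use bm der j that in auto)
    qed
  qed
  from this[of n 0] assms(3) have "CK n 0 S (D 0)" by simp
  then show ?thesis by (rule CK_cong[OF S, rotated]) (simp add: D0)
qed

lemma mcont_multi_onorm:
  assumes "mcont n F x"
  shows "((\<lambda>y. multi_onorm n (\<lambda>hs. F y hs - F x hs)) \<longlongrightarrow> 0) (at x)"
proof (rule tendstoI)
  fix e :: real assume e: "0 < e"
  have "\<forall>\<^sub>F y in nhds x. dist (multi_onorm n (\<lambda>hs. F y hs - F x hs)) 0 < e"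
    using assms[unfolded mcont_def, rule_format, OF half_gt_zero[OF e]]
  proof eventually_elim
    case (elim y)
    then show ?case using multi_onorm_le[of "e/2" n "\<lambda>hs. F y hs - F x hs"] e
      by (simp add: dist_real_def)
  qed
  then show "\<forall>\<^sub>F y in at x. dist (multi_onorm n (\<lambda>hs. F y hs - F x hs)) 0 < e"
    by (simp add: eventually_at_filter eventually_mono)
qed

lemma mder_multi_onorm:
  assumes "mder n F F' x"
  shows "((\<lambda>y. multi_onorm n (\<lambda>hs. F y hs - F x hs - F' x ((y - x) # hs)) / norm (y - x)) \<longlongrightarrow> 0) (at x)"
proof (rule tendstoI)
  fix e :: real assume e: "0 < e"
  have "\<forall>\<^sub>F y in nhds x. y \<noteq> x \<longrightarrow>
      dist (multi_onorm n (\<lambda>hs. F y hs - F x hs - F' x ((y - x) # hs)) / norm (y - x)) 0 < e"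
    using assms[unfolded mder_def, rule_format, OF half_gt_zero[OF e]]
  proof eventually_elim
    case (elim y)
    note m = multi_onorm_le[of "e/2 * norm (y - x)" n "\<lambda>hs. F y hs - F x hs - F' x ((y - x) # hs)"]
    show ?case
    proof
      assume "y \<noteq> x"
      then have p: "norm (y - x) > 0" by simp
      have "0 \<le> multi_onorm n (\<lambda>hs. F y hs - F x hs - F' x ((y - x) # hs))"
        "multi_onorm n (\<lambda>hs. F y hs - F x hs - F' x ((y - x) # hs)) \<le> e/2 * norm (y - x)"
        using m e elim by auto
      moreover have "e/2 * norm (y - x) < e * norm (y - x)" using e p by simp
      ultimately have "0 \<le> multi_onorm n (\<lambda>hs. F y hs - F x hs - F' x ((y - x) # hs))"
        "multi_onorm n (\<lambda>hs. F y hs - F x hs - F' x ((y - x) # hs)) < e * norm (y - x)" by linarith+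
      then show "dist (multi_onorm n (\<lambda>hs. F y hs - F x hs - F' x ((y - x) # hs)) / norm (y - x)) 0 < e"
        using p by (simp add: dist_real_def divide_less_eq)
    qed
  qed
  then show "\<forall>\<^sub>F y in at x. dist (multi_onorm n (\<lambda>hs. F y hs - F x hs - F' x ((y - x) # hs)) / norm (y - x)) 0 < e"
    by (simp add: eventually_at_filter)
qed

text \<open>The iterates of \<open>Dv\<close> do not depend on the order under consideration, so one
  sequence \<open>D\<close> serves all orders at once. This is what the case of infinite
  \<open>k\<close> demands.\<close>

lemma CK_imp_C_smooth_on:
  fixes f :: "'a::real_normed_vector \<Rightarrow> real"
  assumes CK: "\<And>n. enat n \<le> k \<Longrightarrow> CK n 0 S (\<lambda>x hs. f x)"
  shows "C_smooth_on k S f"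
proof -
  define D where "D = (\<lambda>n. (Dv ^^ n) (\<lambda>x hs. f x))"
  have CKD: "CK m j S (D j)" if "enat (m + j) \<le> k" for m j
    using that
  proof (induction j arbitrary: m)
    case 0
    then show ?case using CK by (simp add: D_def)
  next
    case (Suc j)
    then have "CK (Suc m) j S (D j)" by (simp del: CK.simps)
    then show ?case by (simp add: D_def)
  qed
  have "bounded_multilinear n (D n x)" "mcont n (D n) x" if "enat n \<le> k" "x \<in> S" for n x
    using CKD[of 0 n] that by auto
  moreover have "mder n (D n) (D (Suc n)) x" if "enat n < k" "x \<in> S" for n x
  proof -
    have "enat (Suc 0 + n) \<le> k" using that by (cases k) auto
    from CKD[OF this] that show ?thesis by (simp add: D_def)
  qed
  ultimately show ?thesis
    unfolding C_smooth_on_def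
    by (intro exI[of _ D] conjI allI impI ballI mcont_multi_onorm mder_multi_onorm) (auto simp: D_def)
qed

section \<open>Convex smooth functions of a real variable\<close>

definition smooth_seq :: "(nat \<Rightarrow> real \<Rightarrow> real) \<Rightarrow> bool" where
  "smooth_seq D \<longleftrightarrow> (\<forall>n t. (D n has_real_derivative D (Suc n) t) (at t))"

text \<open>The functions \<open>P(1/t) exp(-1/t)\<close>, extended by \<open>0\<close> to \<open>t \<le> 0\<close>, are closed under differentiation.\<close>

definition flatP :: "real poly \<Rightarrow> real \<Rightarrow> real" where
  "flatP P t = (if 0 < t then poly P (inverse t) * exp (- inverse t) else 0)"

lemma poly_exp_tendsto_0: "((\<lambda>y::real. poly P y * exp (- y)) \<longlongrightarrow> 0) at_top"
proof -
  have "((\<lambda>y::real. \<Sum>i\<le>degree P. coeff P i * (y ^ i / exp y)) \<longlongrightarrow> (\<Sum>i\<le>degree P. coeff P i * 0)) at_top"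
    by (intro tendsto_sum tendsto_mult tendsto_const tendsto_power_div_exp_0)
  moreover have "(\<lambda>y::real. \<Sum>i\<le>degree P. coeff P i * (y ^ i / exp y)) = (\<lambda>y. poly P y * exp (- y))"
    by (simp add: fun_eq_iff poly_altdef exp_minus sum_distrib_right divide_inverse mult.assoc)
  ultimately show ?thesis by simp
qed

lemma flatP_tendsto_0: "(flatP P \<longlongrightarrow> 0) (at 0)"
proof -
  have "(flatP P \<longlongrightarrow> 0) (at_left 0)"
    by (rule tendsto_eventually) (auto simp: flatP_def eventually_at_filter)
  moreover have "((\<lambda>t. poly P (inverse t) * exp (- inverse t)) \<longlongrightarrow> 0) (at_right 0)"
    by (rule filterlim_compose[OF poly_exp_tendsto_0 filterlim_inverse_at_top_right])
  then have "(flatP P \<longlongrightarrow> 0) (at_right 0)"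
    by (rule Lim_transform_eventually) (auto simp: flatP_def eventually_at_filter)
  ultimately show ?thesis by (simp add: filterlim_split_at_real)
qed

text \<open>Division by \<open>t\<close> stays within the class; this yields the difference quotient
  at 0.\<close>

lemma flatP_mult_t: "t * flatP ([:0, 1:] * P) t = flatP P t"
  by (simp add: flatP_def)

text \<open>With \<open>y = 1 / t\<close> the derivative of \<open>y\<close> is
  \<open>- y\<^sup>2\<close>, and \<open>P y * exp (- y)\<close> has \<open>y\<close>-derivative
  \<open>(pderiv P - P) y * exp (- y)\<close>; hence the factor \<open>[:0, 0, 1:]\<close> and the
  sign.\<close>

lemma flatP_deriv: "(flatP P has_real_derivative flatP ([:0, 0, 1:] * (P - pderiv P)) t) (at t)"
proof (cases "t = 0")
  case True
  have "((\<lambda>h. flatP P h / h) \<longlongrightarrow> 0) (at 0)"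
  proof (rule Lim_transform_eventually[OF flatP_tendsto_0[of "[:0, 1:] * P"]])
    show "\<forall>\<^sub>F h in at 0. flatP ([:0, 1:] * P) h = flatP P h / h"
      unfolding eventually_at_filter
      using flatP_mult_t[of _ P] by (intro always_eventually) (auto simp: field_simps)
  qed
  then show ?thesis unfolding True DERIV_def by (simp add: flatP_def)
next
  case False
  show ?thesis
  proof (cases "t < 0")
    case True
    have "((\<lambda>t. 0) has_real_derivative 0) (at t)" by simp
    then have "(flatP P has_real_derivative 0) (at t)"
      by (rule has_field_derivative_transform_within_open[where S = "{..<0}"])
        (use True in \<open>auto simp: flatP_def\<close>)
    then show ?thesis using True by (simp add: flatP_def)
  next
    case False
    with \<open>t \<noteq> 0\<close> have t: "t > 0" by simp
    have "((\<lambda>t. poly P (inverse t) * exp (- inverse t)) has_real_derivative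
        flatP ([:0, 0, 1:] * (P - pderiv P)) t) (at t)"
      using t by (auto intro!: derivative_eq_intros DERIV_chain2[OF poly_DERIV]
          simp: flatP_def algebra_simps power2_eq_square power_inverse divide_inverse)
    then show ?thesis
      by (rule has_field_derivative_transform_within_open[where S = "{0<..}"])
        (use t in \<open>auto simp: flatP_def\<close>)
  qed
qed

text \<open>The starting polynomial \<open>1 + y\<close> comes from differentiating
  \<open>t * exp (- 1 / t)\<close>, which gives \<open>(1 + 1 / t) * exp (- 1 / t)\<close>.\<close>

fun flatQ :: "nat \<Rightarrow> real poly" where
  "flatQ 0 = [:1, 1:]"
| "flatQ (Suc n) = [:0, 0, 1:] * (flatQ n - pderiv (flatQ n))"

text \<open>\<open>t exp(-1/t)\<close> and its derivatives; unlike \<open>exp(-1/t)\<close> it is convex on the whole line, with second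
  derivative \<open>exp(-1/t)/t\<^sup>3\<close>.\<close>

fun ramp :: "nat \<Rightarrow> real \<Rightarrow> real" where
  "ramp 0 t = t * flatP 1 t"
| "ramp (Suc n) t = flatP (flatQ n) t"

declare ramp.simps [simp del]

lemma smooth_seq_ramp: "smooth_seq ramp"
  unfolding smooth_seq_def
proof (intro allI)
  fix n t
  show "(ramp n has_real_derivative ramp (Suc n) t) (at t)"
  proof (cases n)
    case 0
    have "((\<lambda>t. t * flatP 1 t) has_real_derivative
        t * flatP ([:0, 0, 1:] * (1 - pderiv 1)) t + 1 * flatP 1 t) (at t)"
      by (rule DERIV_mult'[OF DERIV_ident flatP_deriv])
    moreover have "t * flatP ([:0, 0, 1:] * (1 - pderiv 1)) t + 1 * flatP 1 t = flatP [:1, 1:] t"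
      by (simp add: flatP_def field_simps)
    ultimately show ?thesis unfolding 0 by (simp add: ramp.simps[abs_def] del: mult_pCons_left)
  next
    case (Suc m)
    have "ramp (Suc m) = flatP (flatQ m)" "ramp (Suc (Suc m)) = flatP (flatQ (Suc m))" by (auto simp: ramp.simps)
    then show ?thesis unfolding Suc flatQ.simps by (simp only: flatP_deriv)
  qed
qed

lemma ramp_zero: "t \<le> 0 \<Longrightarrow> ramp n t = 0"
  by (cases n) (auto simp: flatP_def ramp.simps)

lemma ramp_pos: "0 < t \<Longrightarrow> 0 < ramp 0 t"
  by (simp add: flatP_def ramp.simps)

lemma ramp_nonneg: "0 \<le> ramp 0 t"
  by (simp add: flatP_def ramp.simps)

lemma ramp_le: "0 \<le> t \<Longrightarrow> ramp 0 t \<le> t"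
  by (simp add: flatP_def ramp.simps mult_left_le)

lemma ramp_ge: "t - 1 \<le> ramp 0 t"
proof (cases "0 < t")
  case True
  have "t * (1 - inverse t) \<le> t * exp (- inverse t)"
    using exp_ge_add_one_self[of "- inverse t"] True by (intro mult_left_mono) auto
  then show ?thesis using True by (simp add: flatP_def ramp.simps algebra_simps)
qed (simp add: ramp_zero)

lemma mono_ramp: "mono (ramp 0)"
proof (rule monoI)
  fix x y :: real assume "x \<le> y"
  then show "ramp 0 x \<le> ramp 0 y"
  proof (rule DERIV_nonneg_imp_nondecreasing)
    show "\<exists>d. (ramp 0 has_real_derivative d) (at t) \<and> 0 \<le> d" for t
    proof (intro exI conjI)
      show "(ramp 0 has_real_derivative ramp (Suc 0) t) (at t)"
        using smooth_seq_ramp unfolding smooth_seq_def by blast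
      show "0 \<le> ramp (Suc 0) t" by (simp add: ramp.simps flatP_def)
    qed
  qed
qed

lemma convex_ramp: "convex_on UNIV (ramp 0)"
proof (rule f''_ge0_imp_convex[where f' = "ramp 1" and f'' = "ramp 2"])
  show "0 \<le> ramp 2 t" for t
    by (simp add: numeral_2_eq_2 flatP_def pderiv_pCons ramp.simps)
qed (use smooth_seq_ramp in \<open>auto simp: smooth_seq_def numeral_2_eq_2\<close>)

lemma smooth_seq_affine:
  assumes "smooth_seq D"
  shows "smooth_seq (\<lambda>n t. c * s ^ n * D n (s * t + r))"
  unfolding smooth_seq_def
proof (intro allI)
  fix n t
  have "((\<lambda>t. D n (s * t + r)) has_real_derivative D (Suc n) (s * t + r) * s) (at t)"
    by (rule DERIV_chain2[of "D n"]) (use assms in \<open>auto simp: smooth_seq_def intro!: derivative_eq_intros\<close>)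
  from DERIV_cmult[OF this, of "c * s ^ n"]
  show "((\<lambda>t. c * s ^ n * D n (s * t + r)) has_real_derivative c * s ^ Suc n * D (Suc n) (s * t + r)) (at t)"
    by (simp add: mult_ac)
qed

lemma convex_on_affine:
  assumes "convex_on UNIV (f :: real \<Rightarrow> real)" "0 \<le> c"
  shows "convex_on UNIV (\<lambda>t. c * f (s * t + r))"
proof (rule convex_onI)
  fix t x y :: real assume t: "0 < t" "t < 1"
  have "s * ((1 - t) *\<^sub>R x + t *\<^sub>R y) + r = (1 - t) *\<^sub>R (s * x + r) + t *\<^sub>R (s * y + r)"
    by (simp add: algebra_simps)
  then have "f (s * ((1 - t) *\<^sub>R x + t *\<^sub>R y) + r) \<le> (1 - t) * f (s * x + r) + t * f (s * y + r)"
    using convex_onD[OF assms(1), of t "s * x + r" "s * y + r"] t by simp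
  from mult_left_mono[OF this assms(2)]
  show "c * f (s * ((1 - t) *\<^sub>R x + t *\<^sub>R y) + r) \<le> (1 - t) * (c * f (s * x + r)) + t * (c * f (s * y + r))"
    by (simp add: algebra_simps)
qed simp

text \<open>The ramp rescaled to \<open>\<sigma> * ramp 0 (t / \<sigma> - 1)\<close>. Flatness near
  0 removes the singularity of a seminorm on its kernel, while the loss of at most
  \<open>2 * \<sigma>\<close> hardly changes its values.\<close>

lemma smooth_flat_identity:
  assumes "0 < \<sigma>"
  obtains D where "smooth_seq D" "convex_on UNIV (D 0)" "mono (D 0)" "\<And>n t. t \<le> \<sigma> \<Longrightarrow> D n t = 0"
    "\<And>t. t - 2 * \<sigma> \<le> D 0 t" "\<And>t. 0 \<le> t \<Longrightarrow> D 0 t \<le> t" "\<And>t. 0 \<le> D 0 t"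
proof
  let ?D = "\<lambda>n t. \<sigma> * inverse \<sigma> ^ n * ramp n (inverse \<sigma> * t + (- 1))"
  show "smooth_seq ?D" by (rule smooth_seq_affine[OF smooth_seq_ramp])
  show "convex_on UNIV (?D 0)"
    using convex_on_affine[OF convex_ramp, of \<sigma> "inverse \<sigma>" "-1"] assms by simp
  have "mono (\<lambda>t. \<sigma> * ramp 0 (inverse \<sigma> * t + (- 1)))"
    using assms by (intro monoI mult_left_mono monoD[OF mono_ramp]) auto
  then show "mono (?D 0)" by simp
  show "?D n t = 0" if "t \<le> \<sigma>" for n t
    using that assms ramp_zero[of "inverse \<sigma> * t + (- 1)" n] by (simp add: field_simps)
  show "t - 2 * \<sigma> \<le> ?D 0 t" for t
  proof -
    have "\<sigma> * (inverse \<sigma> * t + (- 1) - 1) \<le> \<sigma> * ramp 0 (inverse \<sigma> * t + (- 1))"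
      using ramp_ge[of "inverse \<sigma> * t + (- 1)"] assms by (intro mult_left_mono) auto
    moreover have "\<sigma> * (inverse \<sigma> * t + (- 1) - 1) = t - 2 * \<sigma>" using assms by (simp add: field_simps)
    ultimately show ?thesis by simp
  qed
  show "0 \<le> ?D 0 t" for t using ramp_nonneg assms by (simp)
  show "?D 0 t \<le> t" if "0 \<le> t" for t
  proof (cases "inverse \<sigma> * t + (- 1) \<le> 0")
    case True
    then show ?thesis using that ramp_zero[OF True, of 0] by (simp)
  next
    case False
    then have "\<sigma> * ramp 0 (inverse \<sigma> * t + (- 1)) \<le> \<sigma> * (inverse \<sigma> * t + (- 1))"
      using ramp_le[of "inverse \<sigma> * t + (- 1)"] assms by (intro mult_left_mono) auto
    moreover have "\<sigma> * (inverse \<sigma> * t + (- 1)) = t - \<sigma>" using assms by (simp add: field_simps)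
    ultimately have "\<sigma> * ramp 0 (inverse \<sigma> * t + (- 1)) \<le> t" using assms by linarith
    then show ?thesis by simp
  qed
qed

lemma smooth_barrier:
  assumes "a < b"
  obtains D where "smooth_seq D" "convex_on UNIV (D 0)" "mono (D 0)" "\<And>n t. t \<le> a \<Longrightarrow> D n t = 0"
    "\<And>t. b \<le> t \<Longrightarrow> 1 < D 0 t" "\<And>t. 0 \<le> D 0 t"
proof
  \<comment> \<open>Normalised to the value 2 at \<open>b\<close>; monotonicity keeps the function
    above 1 from there on.\<close>
  define c where "c = 2 / ramp 0 (b - a)"
  have c: "c > 0" "c * ramp 0 (b - a) = 2" using ramp_pos[of "b - a"] assms by (auto simp: c_def)
  let ?D = "\<lambda>n t. c * 1 ^ n * ramp n (1 * t + (- a))"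
  show "smooth_seq ?D" by (rule smooth_seq_affine[OF smooth_seq_ramp])
  show "convex_on UNIV (?D 0)"
    using convex_on_affine[OF convex_ramp, of c 1 "-a"] c by simp
  have m: "mono (\<lambda>t. c * ramp 0 (1 * t + (- a)))"
    using c by (intro monoI mult_left_mono monoD[OF mono_ramp]) auto
  then show "mono (?D 0)" by simp
  show "?D n t = 0" if "t \<le> a" for n t
    using that ramp_zero[of "1 * t + (- a)" n] by simp
  show "1 < ?D 0 t" if "b \<le> t" for t
    using monoD[OF m that] c(2) by (simp)
  show "0 \<le> ?D 0 t" for t using ramp_nonneg c by (simp)
qed

section \<open>Smooth seminorms\<close>

definition seminorm :: "('a::real_normed_vector \<Rightarrow> real) \<Rightarrow> bool" where
  "seminorm u \<longleftrightarrow> (\<forall>x. 0 \<le> u x) \<and> (\<forall>a x. u (a *\<^sub>R x) = \<bar>a\<bar> * u x) \<and>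
     (\<forall>x y. u (x + y) \<le> u x + u y) \<and> (\<exists>L. \<forall>x. u x \<le> L * norm x)"

lemma seminormD:
  assumes "seminorm u"
  shows "0 \<le> u x" "u (a *\<^sub>R x) = \<bar>a\<bar> * u x" "u (x + y) \<le> u x + u y" "u 0 = 0" "u (- x) = u x"
    "\<bar>u x - u y\<bar> \<le> u (x - y)"
proof -
  show nn: "0 \<le> u x" and sc: "u (a *\<^sub>R x) = \<bar>a\<bar> * u x" and tri: "u (x + y) \<le> u x + u y" for x y a
    using assms unfolding seminorm_def by auto
  show "u 0 = 0" using sc[of 0 0] by simp
  show minus: "u (- x) = u x" for x using sc[of "-1" x] by simp
  have "u x - u y \<le> u (x - y)" for x y using tri[of "x - y" y] by simp
  from this[of x y] this[of y x] minus[of "x - y"] show "\<bar>u x - u y\<bar> \<le> u (x - y)" by simp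
qed

lemma seminorm_bound:
  assumes "seminorm u"
  obtains L where "0 < L" "\<And>x. u x \<le> L * norm x" "\<And>x y. \<bar>u x - u y\<bar> \<le> L * norm (x - y)"
proof -
  obtain L where L: "\<And>x. u x \<le> L * norm x" using assms unfolding seminorm_def by auto
  have 1: "u x \<le> (\<bar>L\<bar> + 1) * norm x" for x
    using L[of x] mult_right_mono[of L "\<bar>L\<bar> + 1" "norm x"] norm_ge_zero[of x] abs_ge_self[of L] by linarith
  show ?thesis
    using that[of "\<bar>L\<bar> + 1"] 1 order_trans[OF seminormD(6)[OF assms] 1] by simp
qed

lemma seminorm_isCont:
  assumes "seminorm u" shows "isCont u x"
proof -
  obtain L where L: "0 < L" "\<And>x y. \<bar>u x - u y\<bar> \<le> L * norm (x - y)"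
    using seminorm_bound[OF assms] by metis
  have "((\<lambda>y. u y - u x) \<longlongrightarrow> 0) (at x)"
  proof (rule Lim_null_comparison)
    show "\<forall>\<^sub>F y in at x. norm (u y - u x) \<le> L * norm (y - x)" using L by simp
    have "((\<lambda>y. L * norm (y - x)) \<longlongrightarrow> L * norm (x - x)) (at x)" by (intro tendsto_intros)
    then show "((\<lambda>y. L * norm (y - x)) \<longlongrightarrow> 0) (at x)" by simp
  qed
  then show ?thesis unfolding isCont_def using LIM_zero_iff by blast
qed

lemma open_seminorm_support:
  assumes "seminorm u" shows "open {x. u x \<noteq> 0}"
  using open_Collect_neq[of u "\<lambda>x. 0"] seminorm_isCont[OF assms] by (simp add: continuous_at_imp_continuous_on)

lemma seminorm_norm: "seminorm (norm :: 'a::real_normed_vector \<Rightarrow> real)"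
  unfolding seminorm_def by (intro conjI exI[of _ 1] allI norm_triangle_ineq) auto

lemma seminorm_add:
  assumes "seminorm u" "seminorm v" shows "seminorm (\<lambda>x. u x + v x)"
proof -
  obtain K L where "\<And>x. u x \<le> K * norm x" "\<And>x. v x \<le> L * norm x"
    using assms unfolding seminorm_def by auto
  then have "u x + v x \<le> (K + L) * norm x" for x by (simp add: distrib_right add_mono)
  moreover have "u (x + y) + v (x + y) \<le> (u x + v x) + (u y + v y)" for x y
    using seminormD(3)[OF assms(1), of x y] seminormD(3)[OF assms(2), of x y] by simp
  ultimately show ?thesis
    unfolding seminorm_def using seminormD(1,2)[OF assms(1)] seminormD(1,2)[OF assms(2)]
    by (intro conjI exI[of _ "K + L"] allI) (auto simp: distrib_left)
qed

lemma seminorm_scale: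
  assumes "seminorm u" "0 \<le> r" shows "seminorm (\<lambda>x. r * u x)"
proof -
  obtain K where "\<And>x. u x \<le> K * norm x" using assms(1) unfolding seminorm_def by auto
  then have "r * u x \<le> (r * K) * norm x" for x using assms(2) by (simp add: mult.assoc mult_left_mono)
  moreover have "r * u (x + y) \<le> r * u x + r * u y" for x y
    using mult_left_mono[OF seminormD(3)[OF assms(1), of x y] assms(2)] by (simp add: distrib_left)
  ultimately show ?thesis
    unfolding seminorm_def using seminormD(1,2)[OF assms(1)] assms(2)
    by (intro conjI exI[of _ "r * K"] allI) auto
qed

lemma seminorm_precomp:
  assumes u: "seminorm u" and T: "bounded_linear T"
  shows "seminorm (\<lambda>x. u (T x))"
proof -
  interpret bounded_linear T by fact
  obtain L where L: "0 < L" "\<And>x. u x \<le> L * norm x" "\<And>x y. \<bar>u x - u y\<bar> \<le> L * norm (x - y)"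
    by (rule seminorm_bound[OF u]) (rule that)
  obtain K where K: "\<And>x. norm (T x) \<le> norm x * K" using bounded by blast
  have "u (T x) \<le> (L * K) * norm x" for x
    using order_trans[OF L(2)[of "T x"] mult_left_mono[OF K[of x], of L]] L(1) by (simp add: mult_ac)
  then show ?thesis
    unfolding seminorm_def using seminormD(1,2,3)[OF u]
    by (intro conjI exI[of _ "L * K"] allI) (auto simp: add scaleR)
qed

lemma renorming_seminorm:
  assumes "renorming p" shows "seminorm p"
proof -
  obtain C where "\<And>x. p x \<le> C * norm x" using assms unfolding renorming_def by blast
  then show ?thesis using assms unfolding renorming_def is_norm_def seminorm_def by auto
qed

lemma renormingI:
  assumes s: "seminorm u" and c: "0 < c" "\<And>x. c * norm x \<le> u x"
  shows "renorming u"
proof -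
  obtain L where L: "0 < L" "\<And>x. u x \<le> L * norm x" "\<And>x y. \<bar>u x - u y\<bar> \<le> L * norm (x - y)"
    by (rule seminorm_bound[OF s]) (rule that)
  have "u x = 0 \<longleftrightarrow> x = 0" for x
  proof
    assume "u x = 0"
    then have "c * norm x \<le> 0" using c(2)[of x] by simp
    then show "x = 0" using c(1) by (simp add: mult_le_0_iff)
  qed (simp add: seminormD(4)[OF s])
  then have "is_norm u" unfolding is_norm_def using seminormD(1,2,3)[OF s] by auto
  then show ?thesis unfolding renorming_def using c L by (intro conjI exI[of _ c] exI[of _ L]) auto
qed

lemma convex_on_seminorm: "seminorm u \<Longrightarrow> convex_on UNIV u"
proof (rule convex_onI)
  fix t x y assume s: "seminorm u" and t: "0 < t" "t < (1::real)"
  show "u ((1 - t) *\<^sub>R x + t *\<^sub>R y) \<le> (1 - t) * u x + t * u y"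
    using seminormD(3)[OF s, of "(1 - t) *\<^sub>R x" "t *\<^sub>R y"] seminormD(2)[OF s] t by simp
qed simp

lemma convex_on_mono_comp:
  assumes "convex_on UNIV f" "convex_on UNIV \<phi>" "mono (\<phi> :: real \<Rightarrow> real)"
  shows "convex_on UNIV (\<lambda>x. \<phi> (f x))"
proof (rule convex_onI)
  fix t x y assume t: "0 < t" "t < (1::real)"
  have "\<phi> (f ((1 - t) *\<^sub>R x + t *\<^sub>R y)) \<le> \<phi> ((1 - t) *\<^sub>R f x + t *\<^sub>R f y)"
    using convex_onD[OF assms(1), of t x y] t by (intro monoD[OF assms(3)]) auto
  also have "\<dots> \<le> (1 - t) * \<phi> (f x) + t * \<phi> (f y)"
    using convex_onD[OF assms(2), of t "f x" "f y"] t by auto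
  finally show "\<phi> (f ((1 - t) *\<^sub>R x + t *\<^sub>R y)) \<le> (1 - t) * \<phi> (f x) + t * \<phi> (f y)" .
qed simp

text \<open>A nonzero seminorm is not differentiable at any point of its kernel, so smoothness is
  asked off the kernel only. Quantifying over all finite orders covers infinite
  \<open>k\<close>.\<close>

definition C_seminorm :: "enat \<Rightarrow> ('a::real_normed_vector \<Rightarrow> real) \<Rightarrow> bool" where
  "C_seminorm k u \<longleftrightarrow> seminorm u \<and> (\<forall>n. enat n \<le> k \<longrightarrow> CK n 0 {x. u x \<noteq> 0} (\<lambda>x hs. u x))"

text \<open>Smoothness of \<open>\<Psi>\<close> along \<open>x \<mapsto> g x *\<^sub>R x\<close> for a scalar function \<open>g\<close>. For functions built from
  homogeneous pieces this needs only scalar compositions, which avoids a chain rule for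
  vector-valued inner functions.\<close>

definition radially_C :: "enat \<Rightarrow> ('a::real_normed_vector \<Rightarrow> real) \<Rightarrow> ('a \<Rightarrow> 'a \<Rightarrow> real) \<Rightarrow> bool" where
  "radially_C k \<Psi> \<Psi>' \<longleftrightarrow> (\<forall>y. (\<Psi> has_derivative \<Psi>' y) (at y)) \<and>
     (\<forall>U n g. open U \<longrightarrow> CK n 0 U (\<lambda>x hs. g x) \<longrightarrow> (\<forall>x\<in>U. 0 < g x) \<longrightarrow> enat n < k \<longrightarrow>
        CK n 0 U (\<lambda>x hs. \<Psi> (g x *\<^sub>R x)) \<and> CK n 0 U (\<lambda>x hs. \<Psi>' (g x *\<^sub>R x) x) \<and>
        CK n 1 U (\<lambda>x hs. \<Psi>' (g x *\<^sub>R x) (hd hs)))"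

lemma radially_C_zero: "radially_C k (\<lambda>x. 0) (\<lambda>x h. 0)"
  unfolding radially_C_def by (auto simp: CK_zero)

lemma radially_C_add:
  assumes "radially_C k f f'" "radially_C k g g'"
  shows "radially_C k (\<lambda>x. f x + g x) (\<lambda>x h. f' x h + g' x h)"
  using assms unfolding radially_C_def
  by (auto intro!: has_derivative_add CK_add)

lemma radially_C_sum:
  assumes "\<And>i. i \<in> A \<Longrightarrow> radially_C k (f i) (f' i)"
  shows "radially_C k (\<lambda>x. \<Sum>i\<in>A. f i x) (\<lambda>x h. \<Sum>i\<in>A. f' i x h)"
  using assms
  by (induction A rule: infinite_finite_induct) (auto simp: radially_C_zero radially_C_add)

lemma CK_comp_scalar:
  assumes "open S" "open T" "\<And>n t. t \<in> T \<Longrightarrow> (D n has_real_derivative D (Suc n) t) (at t)"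
    and "CK k 0 S (\<lambda>x hs. f x)" "\<And>x. x \<in> S \<Longrightarrow> f x \<in> T"
  shows "CK k 0 S (\<lambda>x hs. D j (f x))"
  using CK_comp[of S T D k "\<lambda>x hs. f x" j] assms by blast

lemma smooth_seqD: "smooth_seq D \<Longrightarrow> (D n has_real_derivative D (Suc n) t) (at t)"
  unfolding smooth_seq_def by blast

lemma CK_smooth_seq:
  assumes "open S" "smooth_seq D" "CK k 0 S (\<lambda>x hs. f x)"
  shows "CK k 0 S (\<lambda>x hs. D j (f x))"
  by (rule CK_comp_scalar[where D = D, OF assms(1) open_UNIV _ assms(3)])
    (auto simp: smooth_seqD[OF assms(2)])

lemma radially_C_comp:
  assumes f: "radially_C k f f'" and D: "smooth_seq D"
  shows "radially_C k (\<lambda>x. D 0 (f x)) (\<lambda>x h. D 1 (f x) * f' x h)"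
  unfolding radially_C_def
proof (intro conjI allI impI)
  fix y
  have "(D 0 has_derivative (\<lambda>h. D 1 (f y) * h)) (at (f y))"
    using smooth_seqD[OF D, of 0 "f y"] unfolding has_field_derivative_def by simp
  moreover have "(f has_derivative f' y) (at y)" using f unfolding radially_C_def by blast
  ultimately show "((\<lambda>x. D 0 (f x)) has_derivative (\<lambda>h. D 1 (f y) * f' y h)) (at y)"
    by (rule has_derivative_compose[rotated])
next
  fix U n and g :: "'a \<Rightarrow> real"
  assume U: "open U" and g: "CK n 0 U (\<lambda>x hs. g x)" "\<forall>x\<in>U. 0 < g x" "enat n < k"
  have F: "CK n 0 U (\<lambda>x hs. f (g x *\<^sub>R x))" "CK n 0 U (\<lambda>x hs. f' (g x *\<^sub>R x) x)"
    "CK n 1 U (\<lambda>x hs. f' (g x *\<^sub>R x) (hd hs))"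
    using f U g unfolding radially_C_def by blast+
  have c: "CK n 0 U (\<lambda>x hs. D j (f (g x *\<^sub>R x)))" for j
    by (rule CK_smooth_seq[OF U D F(1)])
  show "CK n 0 U (\<lambda>x hs. D 0 (f (g x *\<^sub>R x)))" by (rule c)
  show "CK n 0 U (\<lambda>x hs. D 1 (f (g x *\<^sub>R x)) * f' (g x *\<^sub>R x) x)"
    by (rule CK_mult[OF U c F(2)])
  show "CK n 1 U (\<lambda>x hs. D 1 (f (g x *\<^sub>R x)) * f' (g x *\<^sub>R x) (hd hs))"
    by (rule CK_mult[OF U c F(3)])
qed

text \<open>Homogeneity turns every field along \<open>g x *\<^sub>R x\<close> into a scalar
  expression: \<open>u\<close> scales by \<open>g x\<close>, the derivative of \<open>u\<close> is
  homogeneous of degree 0 (\<open>hom\<close>), and applied to \<open>x\<close> it returns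
  \<open>u x\<close> (\<open>euler\<close>).\<close>

lemma radially_C_seminorm:
  assumes u: "C_seminorm k u" and k: "1 \<le> k" and D: "smooth_seq D"
    and flat: "0 < \<sigma>" "\<And>n t. t \<le> \<sigma> \<Longrightarrow> D n t = 0"
  shows "radially_C k (\<lambda>x. D 0 (u x)) (\<lambda>x h. D 1 (u x) * Dv (\<lambda>x hs. u x) x [h])"
proof -
  have sn: "seminorm u" using u unfolding C_seminorm_def by simp
  have cont: "continuous_on UNIV u"
    using seminorm_isCont[OF sn] by (simp add: continuous_at_imp_continuous_on)
  define V where "V = {x. u x \<noteq> 0}"
  have oV: "open V"
    unfolding V_def using open_Collect_neq[OF cont continuous_on_const] .
  let ?u' = "Dv (\<lambda>x hs. u x)"
  have d: "(u has_derivative (\<lambda>h. ?u' x [h])) (at x)" if "x \<in> V" for x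
  proof (rule has_derivative_Dv[of 0 V "\<lambda>x hs. u x", OF _ that])
    show "CK (Suc 0) 0 V (\<lambda>x hs. u x)"
      using u k unfolding C_seminorm_def V_def by (simp add: one_enat_def del: CK.simps)
  qed
  have hom: "?u' (c *\<^sub>R x) [h] = ?u' x [h]" if x: "x \<in> V" and c: "0 < c" for c x h
  proof -
    have cx: "c *\<^sub>R x \<in> V" using x c seminormD(2)[OF sn] by (simp add: V_def)
    have "((\<lambda>y. inverse c *\<^sub>R y) has_derivative (\<lambda>h. inverse c *\<^sub>R h)) (at (c *\<^sub>R x))"
      by (intro bounded_linear_imp_has_derivative bounded_linear_scaleR_right)
    moreover have "(u has_derivative (\<lambda>h. ?u' x [h])) (at (inverse c *\<^sub>R (c *\<^sub>R x)))"
      using d[OF x] c by simp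
    ultimately have "((\<lambda>y. u (inverse c *\<^sub>R y)) has_derivative (\<lambda>h. ?u' x [inverse c *\<^sub>R h])) (at (c *\<^sub>R x))"
      by (rule has_derivative_compose)
    from has_derivative_mult_right[OF this, of c]
    moreover have "(\<lambda>y. c * u (inverse c *\<^sub>R y)) = u"
      using c by (simp add: seminormD(2)[OF sn] fun_eq_iff)
    ultimately have "(u has_derivative (\<lambda>h. c * ?u' x [inverse c *\<^sub>R h])) (at (c *\<^sub>R x))"
      by simp
    from has_derivative_unique[OF d[OF cx] this]
    have "?u' (c *\<^sub>R x) [h] = c * ?u' x [inverse c *\<^sub>R h]" by (rule fun_cong)
    also have "\<dots> = ?u' x [h]"
      using linear_scale[OF has_derivative_linear[OF d[OF x]], of "inverse c" h] c by simp
    finally show ?thesis .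
  qed
  have euler: "?u' x [x] = u x" if x: "x \<in> V" for x
  proof -
    have "((\<lambda>t. t *\<^sub>R x) has_derivative (\<lambda>t. t *\<^sub>R x)) (at 1)"
      by (intro bounded_linear_imp_has_derivative bounded_linear_scaleR_left)
    moreover have "(u has_derivative (\<lambda>h. ?u' x [h])) (at (1 *\<^sub>R x))" using d[OF x] by simp
    ultimately have "((\<lambda>t. u (t *\<^sub>R x)) has_derivative (\<lambda>t. ?u' x [t *\<^sub>R x])) (at 1)"
      by (rule has_derivative_compose)
    moreover have "((\<lambda>t. u (t *\<^sub>R x)) has_derivative (\<lambda>t. t * u x)) (at 1)"
    proof (rule has_derivative_transform_within_open[of "\<lambda>t. t * u x" _ _ _ "{0<..}"])
      show "((\<lambda>t. t * u x) has_derivative (\<lambda>t. t * u x)) (at 1)"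
        by (intro bounded_linear_imp_has_derivative bounded_linear_mult_left)
    qed (auto simp: seminormD(2)[OF sn])
    ultimately have "(\<lambda>t. ?u' x [t *\<^sub>R x]) = (\<lambda>t. t * u x)" by (rule has_derivative_unique)
    from fun_cong[OF this, of 1] show ?thesis by simp
  qed
  show ?thesis
    unfolding radially_C_def
  proof (intro conjI allI impI)
    fix y
    show "((\<lambda>x. D 0 (u x)) has_derivative (\<lambda>h. D 1 (u y) * ?u' y [h])) (at y)"
    proof (cases "y \<in> V")
      case True
      have "(D 0 has_derivative (\<lambda>h. D 1 (u y) * h)) (at (u y))"
        using smooth_seqD[OF D, of 0 "u y"] unfolding has_field_derivative_def by simp
      then show ?thesis by (rule has_derivative_compose[OF d[OF True]])
    next
      case False
      then have y: "u y = 0" by (simp add: V_def)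
      have z: "((\<lambda>x. 0) has_derivative (\<lambda>h. 0)) (at y)" by simp
      have "((\<lambda>x. D 0 (u x)) has_derivative (\<lambda>h. 0)) (at y)"
        by (rule has_derivative_transform_within_open[OF z open_Collect_less[OF cont continuous_on_const, of \<sigma>]])
          (use y flat in \<open>simp_all add: less_imp_le\<close>)
      then show ?thesis using y flat by simp
    qed
  next
    fix U n and g :: "'a \<Rightarrow> real"
    assume U: "open U" and g: "CK n 0 U (\<lambda>x hs. g x)" "\<forall>x\<in>U. 0 < g x" and n: "enat n < k"
    have gc: "continuous_on U g"
      using CK_mcont[OF g(1)] mcont_0_iff[of "\<lambda>x hs. g x"]
      by (simp add: continuous_at_imp_continuous_on)
    \<comment> \<open>On \<open>W1\<close> the homogeneity formulas apply. On \<open>W2\<close>,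
      which contains all points of \<open>U\<close> in the kernel, flatness of \<open>D\<close>
      makes the three fields vanish identically.\<close>
    define W1 where "W1 = U \<inter> V"
    define W2 where "W2 = {x \<in> U. g x * u x < \<sigma>}"
    have o1: "open W1" unfolding W1_def using U oV by auto
    have "open (U \<inter> (\<lambda>x. g x * u x) -` {..<\<sigma>})"
      using gc continuous_on_subset[OF cont, of U] U
      by (intro continuous_open_preimage continuous_on_mult) auto
    then have o2: "open W2" unfolding W2_def by (simp add: Int_def vimage_def)
    have cover: "x \<in> W1 \<or> x \<in> W2" if "x \<in> U" for x
      using that flat by (auto simp: W1_def W2_def V_def)
    have gu: "u (g x *\<^sub>R x) = g x * u x" if "x \<in> U" for x
      using seminormD(2)[OF sn, of "g x" x] g(2) that by (simp add: less_imp_le)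
    have g1: "CK n 0 W1 (\<lambda>x hs. g x)" using CK_subset[OF g(1)] by (simp add: W1_def)
    \<comment> \<open>The strict inequality \<open>enat n < k\<close> in \<open>radially_C\<close>
      pays for the derivative of \<open>u\<close>.\<close>
    have "enat (Suc n) \<le> k" using n by (simp add: Suc_ile_eq)
    then have "CK (Suc n) 0 V (\<lambda>x hs. u x)" using u unfolding C_seminorm_def V_def by blast
    then have u1: "CK (Suc n) 0 W1 (\<lambda>x hs. u x)" by (rule CK_subset) (simp add: W1_def)
    have gu1: "CK n 0 W1 (\<lambda>x hs. g x * u x)"
      by (rule CK_mult[OF o1 g1 CK_Suc[OF u1]])
    have Du1: "CK n 0 W1 (\<lambda>x hs. D j (g x * u x))" for j
      by (rule CK_smooth_seq[OF o1 D gu1])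
    have Dz: "D j (u (g x *\<^sub>R x)) = 0" if "x \<in> W2" for x j
      using gu[of x] flat(2) that by (simp add: W2_def)
    have glue: "CK n m U F" if G: "CK n m W1 G" "\<And>x hs. x \<in> W1 \<Longrightarrow> length hs = m \<Longrightarrow> G x hs = F x hs"
      and z: "\<And>x hs. x \<in> W2 \<Longrightarrow> length hs = m \<Longrightarrow> 0 = F x hs" for F G m
    proof (rule CK_local)
      fix x assume "x \<in> U"
      have "CK n m W1 F" by (rule CK_cong[OF o1 G(2,1)])
      moreover have "CK n m W2 F" by (rule CK_cong[OF o2 z CK_zero])
      ultimately show "\<exists>W. x \<in> W \<and> CK n m W F" using cover[OF \<open>x \<in> U\<close>] by blast
    qed
    have W1D: "x \<in> U" "x \<in> V" "0 < g x" if "x \<in> W1" for x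
      using that g(2) by (auto simp: W1_def)
    show "CK n 0 U (\<lambda>x hs. D 0 (u (g x *\<^sub>R x)))"
    proof (rule glue[OF Du1])
      show "D 0 (g x * u x) = D 0 (u (g x *\<^sub>R x))" if "x \<in> W1" for x
        using gu[OF W1D(1)[OF that]] by simp
    qed (simp add: Dz)
    have 1: "CK n 0 W1 (\<lambda>x hs. D 1 (g x * u x) * u x)"
      by (rule CK_mult[OF o1 Du1 CK_Suc[OF u1]])
    show "CK n 0 U (\<lambda>x hs. D 1 (u (g x *\<^sub>R x)) * ?u' (g x *\<^sub>R x) [x])"
    proof (rule glue[OF 1])
      show "D 1 (g x * u x) * u x = D 1 (u (g x *\<^sub>R x)) * ?u' (g x *\<^sub>R x) [x]" if "x \<in> W1" for x
        unfolding gu[OF W1D(1)[OF that]] hom[OF W1D(2,3)[OF that]] euler[OF W1D(2)[OF that]] ..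
    qed (simp add: Dz)
    have 2: "CK n 1 W1 (\<lambda>x hs. D 1 (g x * u x) * ?u' x hs)"
      using CK_mult[OF o1 Du1[of 1] CK_Dv[OF u1]] by simp
    show "CK n 1 U (\<lambda>x hs. D 1 (u (g x *\<^sub>R x)) * ?u' (g x *\<^sub>R x) [hd hs])"
    proof (rule glue[OF 2])
      fix x and hs :: "'a list" assume x: "x \<in> W1" and "length hs = 1"
      then obtain h where hs: "hs = [h]" by (cases hs) auto
      show "D 1 (g x * u x) * ?u' x hs = D 1 (u (g x *\<^sub>R x)) * ?u' (g x *\<^sub>R x) [hd hs]"
        unfolding gu[OF W1D(1)[OF x]] hom[OF W1D(2,3)[OF x]] hs list.sel ..
    qed (simp add: Dz)
  qed
qed

section \<open>Gluing smooth seminorms\<close>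

lemma inverse_deriv_seq:
  fixes t :: real assumes "t \<in> {0<..}"
  shows "((\<lambda>t. (-1) ^ n * fact n * inverse t ^ Suc n) has_real_derivative
     (-1) ^ Suc n * fact (Suc n) * inverse t ^ Suc (Suc n)) (at t)"
proof -
  have "(inverse has_real_derivative - (inverse t ^ Suc (Suc 0))) (at t)"
    using DERIV_inverse[of t UNIV] assms by simp
  from DERIV_cmult[OF DERIV_power[OF this, of "Suc n"], of "(-1) ^ n * fact n"]
  show ?thesis by (simp add: algebra_simps)
qed

lemma CK_inverse:
  assumes "open S" "CK k 0 S (\<lambda>x hs. f x)" "\<And>x. x \<in> S \<Longrightarrow> 0 < f x"
  shows "CK k 0 S (\<lambda>x hs. inverse (f x))"
  using CK_comp_scalar[where j = 0 and D = "\<lambda>n t. (-1) ^ n * fact n * inverse t ^ Suc n",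
      OF assms(1) open_greaterThan inverse_deriv_seq assms(2)] assms(3) by simp

text \<open>The implicit function is known beforehand to be locally Lipschitz. Expanding
  \<open>\<Phi> (g y *\<^sub>R y) = 1\<close> to first order gives
  \<open>(g y - g x) * A x + g x * A (y - x)\<close> up to an error of smaller order, and
  \<open>A x > 0\<close> allows solving for \<open>g y - g x\<close>.\<close>

lemma has_derivative_inverse_gauge:
  fixes q :: "'a::real_normed_vector \<Rightarrow> real"
  assumes A: "(\<Phi> has_derivative A) (at (inverse (q x) *\<^sub>R x))"
    and lip: "\<And>x y. \<bar>q x - q y\<bar> \<le> L * norm (x - y)" and L: "0 < L"
    and U: "open U" "x \<in> U" and pos: "\<And>y. y \<in> U \<Longrightarrow> 0 < q y"
    and eq: "\<And>y. y \<in> U \<Longrightarrow> \<Phi> (inverse (q y) *\<^sub>R y) = 1"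
    and nz: "0 < A x"
  shows "((\<lambda>y. inverse (q y)) has_derivative (\<lambda>h. - inverse (q x) * inverse (A x) * A h)) (at x)"
proof -
  define g where "g = (\<lambda>y. inverse (q y))"
  have qx: "0 < q x" using pos U by simp
  have blA: "bounded_linear A" by (rule has_derivative_bounded_linear[OF A])
  have linA: "linear A" using bounded_linear.linear[OF blA] .
  obtain KA where KA: "0 < KA" "\<And>h. norm (A h) \<le> norm h * KA" using bounded_linear.pos_bounded[OF blA] by blast
  define M where "M = 2 * L / (q x)\<^sup>2"
  have M: "0 < M" using L qx by (simp add: M_def)
  have contq: "isCont q x"
  proof -
    have "((\<lambda>y. q y - q x) \<longlongrightarrow> 0) (at x)"
    proof (rule Lim_null_comparison)
      show "\<forall>\<^sub>F y in at x. norm (q y - q x) \<le> L * norm (y - x)" using lip by simp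
      have "((\<lambda>y. L * norm (y - x)) \<longlongrightarrow> L * norm (x - x)) (at x)" by (intro tendsto_intros)
      then show "((\<lambda>y. L * norm (y - x)) \<longlongrightarrow> 0) (at x)" by simp
    qed
    then show ?thesis unfolding isCont_def using LIM_zero_iff by blast
  qed
  have "((\<lambda>y. q y) \<longlongrightarrow> q x) (nhds x)"
    using contq unfolding isCont_def tendsto_at_iff_tendsto_nhds .
  from order_tendstoD(1)[OF this, of "q x / 2"] qx
  have evq: "\<forall>\<^sub>F y in nhds x. q x / 2 < q y" by simp
  have evg: "\<forall>\<^sub>F y in nhds x. \<bar>g y - g x\<bar> \<le> M * norm (y - x)"
    using evq
  proof eventually_elim
    case (elim y)
    have qy: "0 < q y" using elim qx by simp
    have "g y - g x = (q x - q y) * (g y * g x)"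
      using qx qy by (simp add: g_def field_simps)
    then have "\<bar>g y - g x\<bar> = \<bar>q x - q y\<bar> * (g y * g x)" using qx qy by (simp add: g_def abs_mult)
    also have "\<dots> \<le> (L * norm (y - x)) * (2 / q x * g x)"
    proof (rule mult_mono)
      show "\<bar>q x - q y\<bar> \<le> L * norm (y - x)" using lip[of x y] by (simp add: norm_minus_commute)
      have "g y \<le> 2 / q x" using elim qx qy by (simp add: g_def field_simps)
      then show "g y * g x \<le> 2 / q x * g x" using qx by (intro mult_right_mono) (auto simp: g_def)
    qed (use L qx qy in \<open>auto simp: g_def\<close>)
    also have "\<dots> = M * norm (y - x)" by (simp add: M_def g_def power2_eq_square field_simps)
    finally show ?case .
  qed
  define C where "C = M * norm x + g x + M"
  have gx: "0 < g x" using qx by (simp add: g_def)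
  have C: "0 < C" unfolding C_def using M gx by (simp add: add_nonneg_pos)
  have ev1: "\<forall>\<^sub>F y in nhds x. norm (y - x) < 1"
    using eventually_nhds_ball[of 1 x] by (simp add: ball_def dist_norm norm_minus_commute)
  have evC: "\<forall>\<^sub>F y in nhds x. norm (g y *\<^sub>R y - g x *\<^sub>R x) \<le> C * norm (y - x)"
    using evg ev1
  proof eventually_elim
    case (elim y)
    have "g y *\<^sub>R y - g x *\<^sub>R x = (g y - g x) *\<^sub>R x + (g y - g x) *\<^sub>R (y - x) + g x *\<^sub>R (y - x)"
      by (simp add: algebra_simps)
    also have "norm \<dots> \<le> \<bar>g y - g x\<bar> * norm x + \<bar>g y - g x\<bar> * norm (y - x) + g x * norm (y - x)"
      using gx by (intro order_trans[OF norm_triangle_ineq] add_mono) simp_all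
    also have "\<dots> \<le> (M * norm (y - x)) * norm x + (M * norm (y - x)) * 1 + g x * norm (y - x)"
      using elim M gx by (intro add_mono mult_mono) auto
    also have "\<dots> = C * norm (y - x)" by (simp add: C_def algebra_simps)
    finally show ?case .
  qed
  have bl: "bounded_linear (\<lambda>h. - g x * inverse (A x) * A h)"
    by (intro bounded_linear_mult_right[THEN bounded_linear_compose] blA)
  have "(g has_derivative (\<lambda>h. - g x * inverse (A x) * A h)) (at x)"
    unfolding has_derivative_at_iff_eventually[OF bl]
  proof (intro allI impI)
    fix e :: real assume e: "0 < e"
    \<comment> \<open>There are two errors, the remainder of \<open>\<Phi>\<close> and the product
      \<open>(g y - g x) * A (y - x)\<close>. The constants \<open>e1\<close> and \<open>d\<close>
      give each of them half of the tolerance \<open>e * A x\<close>.\<close>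
    define e1 where "e1 = e * A x / (2 * C)"
    have e1: "0 < e1" using e nz C by (simp add: e1_def)
    define d where "d = e * A x / (2 * M * KA)"
    have d: "0 < d" using e nz M KA by (simp add: d_def)
    have "filterlim (\<lambda>y. g y *\<^sub>R y) (nhds (g x *\<^sub>R x)) (nhds x)"
    proof -
      have "isCont g x" unfolding g_def using contq qx by (intro continuous_intros) auto
      then have "isCont (\<lambda>y. g y *\<^sub>R y) x" by (intro continuous_intros)
      then show ?thesis unfolding isCont_def
        using tendsto_at_iff_tendsto_nhds[of "\<lambda>y. g y *\<^sub>R y" x] by blast
    qed
    moreover have "\<forall>\<^sub>F z in nhds (g x *\<^sub>R x). \<bar>\<Phi> z - \<Phi> (g x *\<^sub>R x) - A (z - g x *\<^sub>R x)\<bar> \<le> e1 * norm (z - g x *\<^sub>R x)"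
      using A e1 unfolding has_derivative_at_iff_eventually[OF blA] g_def by blast
    ultimately have ev\<Phi>: "\<forall>\<^sub>F y in nhds x. \<bar>\<Phi> (g y *\<^sub>R y) - \<Phi> (g x *\<^sub>R x) - A (g y *\<^sub>R y - g x *\<^sub>R x)\<bar>
        \<le> e1 * norm (g y *\<^sub>R y - g x *\<^sub>R x)"
      unfolding filterlim_iff by blast
    have evd: "\<forall>\<^sub>F y in nhds x. norm (y - x) < d"
      using eventually_nhds_ball[OF d, of x] by (simp add: ball_def dist_norm norm_minus_commute)
    show "\<forall>\<^sub>F y in nhds x. \<bar>g y - g x - - g x * inverse (A x) * A (y - x)\<bar> \<le> e * norm (y - x)"
      using ev\<Phi> evd evC evg eventually_nhds_in_open[OF U]
    proof eventually_elim
      case (elim y)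
      have F1: "\<Phi> (g y *\<^sub>R y) = 1" "\<Phi> (g x *\<^sub>R x) = 1" using eq elim(5) U by (auto simp: g_def)
      define R where "R = A (g y *\<^sub>R y - g x *\<^sub>R x)"
      have "\<bar>R\<bar> \<le> e1 * norm (g y *\<^sub>R y - g x *\<^sub>R x)" using elim(1) F1 by (simp add: R_def)
      also have "\<dots> \<le> e1 * (C * norm (y - x))" using elim(3) e1 by (intro mult_left_mono) auto
      also have "\<dots> = e / 2 * A x * norm (y - x)" using C by (simp add: e1_def)
      finally have R: "\<bar>R\<bar> \<le> e / 2 * A x * norm (y - x)" .
      have "g y *\<^sub>R y - g x *\<^sub>R x = (g y - g x) *\<^sub>R x + (g y - g x) *\<^sub>R (y - x) + g x *\<^sub>R (y - x)"
        by (simp add: algebra_simps)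
      then have Re: "R = (g y - g x) * A x + (g y - g x) * A (y - x) + g x * A (y - x)"
        unfolding R_def by (simp add: linear_add[OF linA] linear_scale[OF linA])
      have "\<bar>(g y - g x) * A (y - x)\<bar> \<le> (M * d) * (norm (y - x) * KA)"
      proof -
        have "\<bar>g y - g x\<bar> \<le> M * d" using elim(2,4) M mult_left_mono[of "norm (y - x)" d M] by linarith
        then show ?thesis unfolding abs_mult using KA(2)[of "y - x"] M d by (intro mult_mono) auto
      qed
      also have "\<dots> = e / 2 * A x * norm (y - x)" using M KA(1) by (simp add: d_def)
      finally have B: "\<bar>(g y - g x) * A (y - x)\<bar> \<le> e / 2 * A x * norm (y - x)" .
      have "(g y - g x - - g x * inverse (A x) * A (y - x)) * A x = R - (g y - g x) * A (y - x)"
        using nz by (simp add: Re field_simps)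
      then have "\<bar>g y - g x - - g x * inverse (A x) * A (y - x)\<bar> * A x = \<bar>R - (g y - g x) * A (y - x)\<bar>"
        using nz by (metis abs_mult abs_of_pos)
      also have "\<dots> \<le> \<bar>R\<bar> + \<bar>(g y - g x) * A (y - x)\<bar>" by (rule abs_triangle_ineq4)
      also have "\<dots> \<le> e / 2 * A x * norm (y - x) + e / 2 * A x * norm (y - x)" by (rule add_mono[OF R B])
      also have "\<dots> = (e * norm (y - x)) * A x" by (simp add: algebra_simps)
      finally show ?case using nz mult_right_le_imp_le by blast
    qed
  qed
  then show ?thesis by (simp add: g_def)
qed

text \<open>The derivative of \<open>g = 1 / q\<close> is expressed through \<open>g\<close> and
  \<open>\<Phi>'\<close> along \<open>g x *\<^sub>R x\<close>. By \<open>radially_C\<close> it is as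
  smooth as \<open>g\<close> while \<open>n < k\<close>, so every step of the induction gains one
  order.\<close>

lemma CK_gauge:
  fixes q :: "'a::real_normed_vector \<Rightarrow> real"
  assumes \<Phi>: "radially_C k \<Phi> \<Phi>'"
    and lip: "\<And>x y. \<bar>q x - q y\<bar> \<le> L * norm (x - y)" and L: "0 < L"
    and U: "open U" and pos: "\<And>y. y \<in> U \<Longrightarrow> 0 < q y"
    and eq: "\<And>y. y \<in> U \<Longrightarrow> \<Phi> (inverse (q y) *\<^sub>R y) = 1"
    and nz: "\<And>y. y \<in> U \<Longrightarrow> 0 < \<Phi>' (inverse (q y) *\<^sub>R y) y"
    and n: "enat n \<le> k"
  shows "CK n 0 U (\<lambda>x hs. q x)"
proof -
  define g where "g = (\<lambda>y. inverse (q y))"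
  have gpos: "\<forall>y\<in>U. 0 < g y" using pos by (simp add: g_def)
  have d: "(\<Phi> has_derivative \<Phi>' y) (at y)" for y using \<Phi> unfolding radially_C_def by blast
  have gd: "(g has_derivative (\<lambda>h. - g x * inverse (\<Phi>' (g x *\<^sub>R x) x) * \<Phi>' (g x *\<^sub>R x) h)) (at x)" if "x \<in> U" for x
    using has_derivative_inverse_gauge[OF d lip L U that pos eq nz[OF that]] by (simp add: g_def)
  have "CK n 0 U (\<lambda>x hs. g x)"
    using n
  proof (induction n)
    case 0
    have "isCont g x" if "x \<in> U" for x using has_derivative_continuous[OF gd[OF that]] by simp
    then show ?case by (simp add: bounded_multilinear_0 mcont_0_iff)
  next
    case (Suc n)
    have nk: "enat n < k" using Suc.prems by (simp add: Suc_ile_eq)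
    then have g: "CK n 0 U (\<lambda>x hs. g x)" using Suc.IH by simp
    have 1: "CK n 0 U (\<lambda>x hs. \<Phi>' (g x *\<^sub>R x) x)" "CK n 1 U (\<lambda>x hs. \<Phi>' (g x *\<^sub>R x) (hd hs))"
      using \<Phi> U g gpos nk unfolding radially_C_def by blast+
    have 2: "CK n 0 U (\<lambda>x hs. inverse (\<Phi>' (g x *\<^sub>R x) x))"
      using nz by (intro CK_inverse[OF U 1(1)]) (simp add: g_def)
    have 3: "CK n 0 U (\<lambda>x hs. (-1) * g x)"
      by (rule CK_mult[OF U _ g]) (intro CK_const bounded_multilinear_0)
    show ?case
    proof (rule CK_Suc_0I[OF U])
      show "CK n 1 U (\<lambda>x hs. (-1) * g x * inverse (\<Phi>' (g x *\<^sub>R x) x) * \<Phi>' (g x *\<^sub>R x) (hd hs))"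
        by (rule CK_mult[OF U CK_mult[OF U 3 2] 1(2)])
      show "((\<lambda>y. g y) has_derivative (\<lambda>h. (-1) * g x * inverse (\<Phi>' (g x *\<^sub>R x) x) * \<Phi>' (g x *\<^sub>R x) (hd [h]))) (at x)"
        if "x \<in> U" for x using gd[OF that] by simp
    qed
  qed
  from CK_inverse[OF U this] gpos show ?thesis by (simp add: g_def)
qed

text \<open>The Minkowski functional of \<open>K\<close>. Closedness makes the threshold attained,
  which gives the last equivalence also at \<open>t = q x\<close>; homogeneity and the triangle
  inequality are then read off from membership in \<open>K\<close>.\<close>

lemma gauge_norm:
  fixes K :: "'a::real_normed_vector set"
  assumes K: "convex K" "closed K" "\<And>x. x \<in> K \<Longrightarrow> - x \<in> K"
    and r: "0 < r" "cball 0 r \<subseteq> K" and R: "0 < R" "K \<subseteq> cball 0 R"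
  obtains q where "is_norm q" "\<And>x. norm x / R \<le> q x" "\<And>x. q x \<le> norm x / r"
    "\<And>x t. 0 < t \<Longrightarrow> q x \<le> t \<longleftrightarrow> inverse t *\<^sub>R x \<in> K"
proof -
  define S where "S = (\<lambda>x. {t. 0 < t \<and> inverse t *\<^sub>R x \<in> K})"
  define q where "q = (\<lambda>x. Inf (S x))"
  have bdd: "bdd_below (S x)" for x unfolding S_def by (rule bdd_belowI[of _ 0]) auto
  have zK: "0 \<in> K" using r by auto
  have up: "t \<in> S x" if "s \<in> S x" "s \<le> t" for s t x
  proof -
    have st: "0 < s" "0 < t" "inverse s *\<^sub>R x \<in> K" using that by (auto simp: S_def)
    have "(1 - s / t) *\<^sub>R 0 + (s / t) *\<^sub>R (inverse s *\<^sub>R x) \<in> K"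
      using st that(2) by (intro convexD_alt[OF K(1) zK]) auto
    then show ?thesis using st by (simp add: S_def field_simps)
  qed
  have inS: "t \<in> S x" if "0 < t" "norm x \<le> r * t" for t x
  proof -
    have "norm (inverse t *\<^sub>R x) \<le> r" using that by (simp add: field_simps)
    then show ?thesis using that r by (auto simp: S_def)
  qed
  have low: "norm x \<le> R * t" if "t \<in> S x" for t x
  proof -
    have "norm (inverse t *\<^sub>R x) \<le> R" using that R by (auto simp: S_def)
    then show ?thesis using that by (simp add: S_def field_simps)
  qed
  have ne: "S x \<noteq> {}" for x
  proof -
    have "norm x / r + 1 \<in> S x" using r by (intro inS) (auto simp: field_simps add_pos_nonneg)
    then show ?thesis by blast
  qed
  have key: "q x \<le> t \<longleftrightarrow> inverse t *\<^sub>R x \<in> K" if t: "0 < t" for x t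
  proof
    assume le: "q x \<le> t"
    have "t + inverse (real (Suc n)) \<in> S x" for n
    proof -
      have "q x < t + inverse (real (Suc n))" using le by (simp add: add_pos_pos less_le_trans[OF _ order_refl] add_increasing2 le_less_trans[of "q x" t])
      then obtain s where "s \<in> S x" "s < t + inverse (real (Suc n))"
        unfolding q_def using cInf_lessD[OF ne] by blast
      then show ?thesis using up by (meson less_imp_le)
    qed
    then have c: "inverse (t + inverse (real (Suc n))) *\<^sub>R x \<in> K" for n by (auto simp: S_def)
    have "(\<lambda>n. inverse (t + inverse (real (Suc n))) *\<^sub>R x) \<longlonglongrightarrow> inverse (t + 0) *\<^sub>R x"
      using t by (intro tendsto_intros LIMSEQ_inverse_real_of_nat) auto
    from closed_sequentially[OF K(2) c this] show "inverse t *\<^sub>R x \<in> K" by simp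
  next
    assume "inverse t *\<^sub>R x \<in> K"
    then have "t \<in> S x" using t by (simp add: S_def)
    then show "q x \<le> t" unfolding q_def by (rule cInf_lower[OF _ bdd])
  qed
  have lower: "norm x / R \<le> q x" for x
    unfolding q_def
    by (rule cInf_greatest[OF ne]) (use low R in \<open>simp add: field_simps\<close>)
  have nn: "0 \<le> q x" for x using order_trans[OF _ lower[of x]] R by simp
  have upper: "q x \<le> norm x / r" for x
  proof (rule field_le_epsilon)
    fix e :: real assume e: "0 < e"
    have "norm x / r + e \<in> S x" using e r by (intro inS) (auto simp: field_simps add_nonneg_pos)
    then show "q x \<le> norm x / r + e" unfolding q_def by (rule cInf_lower[OF _ bdd])
  qed
  have eqI: "a = b" if "0 \<le> a" "0 \<le> b" "\<And>t. 0 < t \<Longrightarrow> a \<le> t \<longleftrightarrow> b \<le> t" for a b :: real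
  proof (rule antisym; rule field_le_epsilon)
    fix e :: real assume "0 < e"
    then show "a \<le> b + e" "b \<le> a + e" using that(1,2) that(3)[of "b + e"] that(3)[of "a + e"] by auto
  qed
  have z: "q 0 = 0" using upper[of 0] nn[of 0] by simp
  have symK: "- x \<in> K \<longleftrightarrow> x \<in> K" for x using K(3)[of x] K(3)[of "- x"] by auto
  have hom: "q (a *\<^sub>R x) = \<bar>a\<bar> * q x" for a x
  proof (cases "a = 0")
    case True
    then show ?thesis using z by simp
  next
    case False
    show ?thesis
    proof (rule eqI)
      fix t :: real assume t: "0 < t"
      have "\<bar>a\<bar> * q x \<le> t \<longleftrightarrow> q x \<le> t / \<bar>a\<bar>" using False by (simp add: field_simps)
      also have "\<dots> \<longleftrightarrow> inverse (t / \<bar>a\<bar>) *\<^sub>R x \<in> K" using False t by (intro key) simp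
      also have "\<dots> \<longleftrightarrow> inverse t *\<^sub>R a *\<^sub>R x \<in> K"
        using symK[of "inverse t *\<^sub>R a *\<^sub>R x"] by (cases "a > 0") (auto simp: field_simps)
      also have "\<dots> \<longleftrightarrow> q (a *\<^sub>R x) \<le> t" using key[OF t] by simp
      finally show "q (a *\<^sub>R x) \<le> t \<longleftrightarrow> \<bar>a\<bar> * q x \<le> t" by simp
    qed (use nn in auto)
  qed
  have tri: "q (x + y) \<le> q x + q y" for x y
  proof (rule field_le_epsilon)
    fix e :: real assume e: "0 < e"
    define s t where "s = q x + e / 2" and "t = q y + e / 2"
    have st: "0 < s" "0 < t" using nn[of x] nn[of y] e by (auto simp: s_def t_def)
    have "inverse s *\<^sub>R x \<in> K" "inverse t *\<^sub>R y \<in> K"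
      using key[OF st(1), of x] key[OF st(2), of y] e by (simp_all add: s_def t_def)
    then have "(1 - t / (s + t)) *\<^sub>R (inverse s *\<^sub>R x) + (t / (s + t)) *\<^sub>R (inverse t *\<^sub>R y) \<in> K"
      using st by (intro convexD_alt[OF K(1)]) auto
    moreover have "(1 - t / (s + t)) * inverse s = inverse (s + t)" "t / (s + t) * inverse t = inverse (s + t)"
      using st by (simp_all add: field_simps)
    ultimately have "inverse (s + t) *\<^sub>R (x + y) \<in> K"
      by (simp only: scaleR_right_distrib scaleR_scaleR)
    then have "q (x + y) \<le> s + t" using key[of "s + t"] st by simp
    then show "q (x + y) \<le> q x + q y + e" by (simp add: s_def t_def)
  qed
  have "q x = 0 \<longleftrightarrow> x = 0" for x
    using lower[of x] z R by (auto simp: divide_le_0_iff)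
  then have "is_norm q" unfolding is_norm_def using nn hom tri by blast
  then show thesis using that lower upper key by blast
qed

text \<open>Each seminorm is first flattened near its own kernel, where it would be nonsmooth, and
  the barrier is applied to the sum. Monotone convex outer functions preserve convexity.\<close>

lemma smooth_barrier_of_seminorms:
  assumes u: "C_seminorm k u" and v: "C_seminorm k v" and k: "1 \<le> k" and \<tau>: "0 < \<tau>"
  obtains \<Psi> \<Psi>' where "radially_C k \<Psi> \<Psi>'" "convex_on UNIV \<Psi>" "\<And>x. 0 \<le> \<Psi> x" "\<And>x. \<Psi> (- x) = \<Psi> x"
    "\<And>x. u x + v x \<le> 1 - \<tau> \<Longrightarrow> \<Psi> x = 0" "\<And>x. 1 \<le> u x + v x \<Longrightarrow> 1 < \<Psi> x"
proof -
  have su: "seminorm u" and sv: "seminorm v" using u v unfolding C_seminorm_def by auto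
  \<comment> \<open>Each flattening loses at most \<open>2 * \<sigma>\<close>, both together
    \<open>\<tau> / 2\<close>. Thus \<open>u x + v x \<ge> 1\<close> still leads beyond
    \<open>1 - \<tau> / 2\<close>, where the barrier exceeds 1.\<close>
  define \<sigma> where "\<sigma> = \<tau> / 8"
  have \<sigma>: "0 < \<sigma>" using \<tau> by (simp add: \<sigma>_def)
  obtain B where B: "smooth_seq B" "convex_on UNIV (B 0)" "mono (B 0)" "\<And>n t. t \<le> \<sigma> \<Longrightarrow> B n t = 0"
    "\<And>t. t - 2 * \<sigma> \<le> B 0 t" "\<And>t. 0 \<le> t \<Longrightarrow> B 0 t \<le> t" "\<And>t. 0 \<le> B 0 t"
    using smooth_flat_identity[OF \<sigma>] by blast
  obtain P where P: "smooth_seq P" "convex_on UNIV (P 0)" "mono (P 0)" "\<And>n t. t \<le> 1 - \<tau> \<Longrightarrow> P n t = 0"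
    "\<And>t. 1 - \<tau> / 2 \<le> t \<Longrightarrow> 1 < P 0 t" "\<And>t. 0 \<le> P 0 t"
    using smooth_barrier[of "1 - \<tau>" "1 - \<tau> / 2"] \<tau> by auto
  show ?thesis
  proof (rule that)
    show "radially_C k (\<lambda>x. P 0 (B 0 (u x) + B 0 (v x)))
      (\<lambda>x h. P 1 (B 0 (u x) + B 0 (v x)) * (B 1 (u x) * Dv (\<lambda>x hs. u x) x [h] + B 1 (v x) * Dv (\<lambda>x hs. v x) x [h]))"
      by (intro radially_C_comp[OF _ P(1)] radially_C_add radially_C_seminorm[OF _ k B(1) \<sigma> B(4)] u v)
    show "convex_on UNIV (\<lambda>x. P 0 (B 0 (u x) + B 0 (v x)))"
      by (intro convex_on_mono_comp[OF _ P(2,3)] convex_on_add convex_on_mono_comp[OF _ B(2,3)]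
          convex_on_seminorm su sv)
    show "0 \<le> P 0 (B 0 (u x) + B 0 (v x))" for x by (rule P)
    show "P 0 (B 0 (u (- x)) + B 0 (v (- x))) = P 0 (B 0 (u x) + B 0 (v x))" for x
      using seminormD(5)[OF su] seminormD(5)[OF sv] by simp
    show "P 0 (B 0 (u x) + B 0 (v x)) = 0" if "u x + v x \<le> 1 - \<tau>" for x
      using that B(6)[OF seminormD(1)[OF su, of x]] B(6)[OF seminormD(1)[OF sv, of x]]
      by (intro P) linarith
    show "1 < P 0 (B 0 (u x) + B 0 (v x))" if "1 \<le> u x + v x" for x
      using that B(5)[of "u x"] B(5)[of "v x"] \<tau> by (intro P) (simp add: \<sigma>_def)
  qed
qed

text \<open>Near the boundary of its unit ball, a supremum of seminorms with the strict inequality below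
  is governed by finitely many of them, so the sum of the barriers is locally finite there and its
  sublevel set has a smooth gauge.\<close>

theorem smooth_gluing:
  fixes u v :: "'i \<Rightarrow> 'a::real_normed_vector \<Rightarrow> real"
  assumes k: "1 \<le> k"
    and u: "\<And>i. i \<in> I \<Longrightarrow> C_seminorm k (u i)" and v: "\<And>i. i \<in> I \<Longrightarrow> C_seminorm k (v i)"
    and L: "0 < L" "\<And>i x. i \<in> I \<Longrightarrow> u i x + v i x \<le> L * norm x"
    and \<tau>: "\<And>i. i \<in> I \<Longrightarrow> 0 < \<tau> i" "\<And>i. i \<in> I \<Longrightarrow> \<tau> i \<le> 1 / 2"
      "\<And>c. 0 < c \<Longrightarrow> finite {i \<in> I. c < \<tau> i}"
    and \<kappa>: "0 < \<kappa>"
    and strict: "\<And>x. x \<noteq> 0 \<Longrightarrow> \<exists>i\<in>I. \<exists>c. c < u i x + v i x \<and> \<kappa> * norm x \<le> u i x + v i x \<and>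
        finite {j \<in> I. c < u j x + v j x}"
  obtains q where "renorming q" "C_smooth_norm k q" "\<And>i x. i \<in> I \<Longrightarrow> u i x + v i x \<le> q x"
    "\<And>b x. 0 < b \<Longrightarrow> (\<And>i. i \<in> I \<Longrightarrow> u i x + v i x \<le> (1 - \<tau> i) * b) \<Longrightarrow> q x \<le> b"
proof -
  define h where "h = (\<lambda>i x. u i x + v i x)"
  have su: "seminorm (u i)" and sv: "seminorm (v i)" if "i \<in> I" for i
    using u[OF that] v[OF that] unfolding C_seminorm_def by auto
  have h_scale: "h i (a *\<^sub>R x) = \<bar>a\<bar> * h i x" if "i \<in> I" for i a x
    using seminormD(2)[OF su[OF that]] seminormD(2)[OF sv[OF that]] by (simp add: h_def distrib_left)
  have h_lip: "h i y \<le> h i x + L * norm (y - x)" if "i \<in> I" for i x y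
    using seminormD(3)[OF su[OF that], of "y - x" x] seminormD(3)[OF sv[OF that], of "y - x" x]
      L(2)[OF that, of "y - x"] by (simp add: h_def)
  have h0: "h i 0 = 0" if "i \<in> I" for i using h_scale[OF that, of 0 0] by simp

  \<comment> \<open>Barriers of the single seminorms\<close>
  have "\<forall>i\<in>I. \<exists>\<Psi> \<Psi>'. radially_C k \<Psi> \<Psi>' \<and> convex_on UNIV \<Psi> \<and> (\<forall>x. 0 \<le> \<Psi> x) \<and> (\<forall>x. \<Psi> (- x) = \<Psi> x) \<and>
    (\<forall>x. h i x \<le> 1 - \<tau> i \<longrightarrow> \<Psi> x = 0) \<and> (\<forall>x. 1 \<le> h i x \<longrightarrow> 1 < \<Psi> x)"
  proof
    fix i assume i: "i \<in> I"
    show "\<exists>\<Psi> \<Psi>'. radially_C k \<Psi> \<Psi>' \<and> convex_on UNIV \<Psi> \<and> (\<forall>x. 0 \<le> \<Psi> x) \<and> (\<forall>x. \<Psi> (- x) = \<Psi> x) \<and>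
    (\<forall>x. h i x \<le> 1 - \<tau> i \<longrightarrow> \<Psi> x = 0) \<and> (\<forall>x. 1 \<le> h i x \<longrightarrow> 1 < \<Psi> x)"
      unfolding h_def
    proof (rule smooth_barrier_of_seminorms[OF u[OF i] v[OF i] k \<tau>(1)[OF i]])
      fix f f' assume f: "radially_C k f f'" "convex_on UNIV f" "\<And>x. 0 \<le> f x" "\<And>x. f (- x) = f x"
        "\<And>x. u i x + v i x \<le> 1 - \<tau> i \<Longrightarrow> f x = 0" "\<And>x. 1 \<le> u i x + v i x \<Longrightarrow> 1 < f x"
      show "\<exists>\<Psi> \<Psi>'. radially_C k \<Psi> \<Psi>' \<and> convex_on UNIV \<Psi> \<and> (\<forall>x. 0 \<le> \<Psi> x) \<and> (\<forall>x. \<Psi> (- x) = \<Psi> x) \<and>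
        (\<forall>x. u i x + v i x \<le> 1 - \<tau> i \<longrightarrow> \<Psi> x = 0) \<and> (\<forall>x. 1 \<le> u i x + v i x \<longrightarrow> 1 < \<Psi> x)"
        by (intro exI[of _ f] exI[of _ f'] conjI allI impI f)
    qed
  qed
  from bchoice[OF this] obtain \<Psi> where "\<forall>i\<in>I. \<exists>\<Psi>'. radially_C k (\<Psi> i) \<Psi>' \<and> convex_on UNIV (\<Psi> i) \<and>
      (\<forall>x. 0 \<le> \<Psi> i x) \<and> (\<forall>x. \<Psi> i (- x) = \<Psi> i x) \<and>
      (\<forall>x. h i x \<le> 1 - \<tau> i \<longrightarrow> \<Psi> i x = 0) \<and> (\<forall>x. 1 \<le> h i x \<longrightarrow> 1 < \<Psi> i x)" ..
  from bchoice[OF this] obtain \<Psi>' where \<Psi>: "\<forall>i\<in>I. radially_C k (\<Psi> i) (\<Psi>' i) \<and> convex_on UNIV (\<Psi> i) \<and>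
      (\<forall>x. 0 \<le> \<Psi> i x) \<and> (\<forall>x. \<Psi> i (- x) = \<Psi> i x) \<and>
      (\<forall>x. h i x \<le> 1 - \<tau> i \<longrightarrow> \<Psi> i x = 0) \<and> (\<forall>x. 1 \<le> h i x \<longrightarrow> 1 < \<Psi> i x)" ..
  have \<Psi>0: "\<Psi> i x = 0" if "i \<in> I" "h i x \<le> 1 - \<tau> i" for i x using \<Psi> that by blast
  have \<Psi>1: "1 < \<Psi> i x" if "i \<in> I" "1 \<le> h i x" for i x using \<Psi> that by blast
  have \<Psi>nn: "0 \<le> \<Psi> i x" if "i \<in> I" for i x using \<Psi> that by blast
  have \<Psi>cont: "continuous_on UNIV (\<Psi> i)" if "i \<in> I" for i
    using \<Psi> that unfolding radially_C_def
    by (intro continuous_at_imp_continuous_on) (blast intro: has_derivative_continuous)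

  \<comment> \<open>The convex body and its gauge\<close>
  define K where "K = {x. \<forall>A. finite A \<longrightarrow> A \<subseteq> I \<longrightarrow> (\<Sum>i\<in>A. \<Psi> i x) \<le> 1}"
  have Kint: "K = (\<Inter>A\<in>{A. finite A \<and> A \<subseteq> I}. {x. (\<Sum>i\<in>A. \<Psi> i x) \<le> 1})"
    unfolding K_def by auto
  have sum_convex: "convex_on UNIV (\<lambda>x. \<Sum>i\<in>A. \<Psi> i x)" if "A \<subseteq> I" for A
    using that
  proof (induction A rule: infinite_finite_induct)
    case (insert i A)
    then show ?case using \<Psi> convex_on_add[of UNIV "\<Psi> i" "\<lambda>x. \<Sum>i\<in>A. \<Psi> i x"] by simp
  qed (auto simp: convex_on_const)
  have K1: "convex K"
    unfolding Kint
  proof (rule convex_INT)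
    fix A assume "A \<in> {A. finite A \<and> A \<subseteq> I}"
    then have c: "convex_on UNIV (\<lambda>x. \<Sum>i\<in>A. \<Psi> i x)" using sum_convex by simp
    show "convex {x. (\<Sum>i\<in>A. \<Psi> i x) \<le> 1}"
    proof (rule convexI)
      fix x y and s t :: real assume xy: "x \<in> {x. (\<Sum>i\<in>A. \<Psi> i x) \<le> 1}" "y \<in> {x. (\<Sum>i\<in>A. \<Psi> i x) \<le> 1}"
        and st: "0 \<le> s" "0 \<le> t" "s + t = 1"
      have "(\<Sum>i\<in>A. \<Psi> i (s *\<^sub>R x + t *\<^sub>R y)) \<le> s * (\<Sum>i\<in>A. \<Psi> i x) + t * (\<Sum>i\<in>A. \<Psi> i y)"
        using c st unfolding convex_on_def by blast
      also have "\<dots> \<le> s * 1 + t * 1" using xy st by (intro add_mono mult_left_mono) auto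
      finally show "s *\<^sub>R x + t *\<^sub>R y \<in> {x. (\<Sum>i\<in>A. \<Psi> i x) \<le> 1}" using st by simp
    qed
  qed
  have K2: "closed K"
    unfolding Kint
  proof (intro closed_INT ballI)
    fix A assume "A \<in> {A. finite A \<and> A \<subseteq> I}"
    then have "continuous_on UNIV (\<lambda>x. \<Sum>i\<in>A. \<Psi> i x)"
      using \<Psi>cont by (intro continuous_on_sum) auto
    from closed_Collect_le[OF this continuous_on_const]
    show "closed {x. (\<Sum>i\<in>A. \<Psi> i x) \<le> 1}" .
  qed
  have K3: "- x \<in> K" if "x \<in> K" for x
  proof -
    have "(\<Sum>i\<in>A. \<Psi> i (- x)) = (\<Sum>i\<in>A. \<Psi> i x)" if "A \<subseteq> I" for A
      using \<Psi> that by (intro sum.cong) auto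
    then show ?thesis using that unfolding K_def by simp
  qed
  have K_zero: "x \<in> K" if "\<And>i. i \<in> I \<Longrightarrow> h i x \<le> 1 - \<tau> i" for x
  proof -
    have "(\<Sum>i\<in>A. \<Psi> i x) = 0" if A: "A \<subseteq> I" for A
      using \<Psi>0 \<open>\<And>i. i \<in> I \<Longrightarrow> h i x \<le> 1 - \<tau> i\<close> A by (intro sum.neutral) auto
    then show ?thesis unfolding K_def by simp
  qed
  have K_h: "h i x < 1" if "x \<in> K" "i \<in> I" for i x
  proof (rule ccontr)
    assume "\<not> h i x < 1"
    then have "1 < \<Psi> i x" using \<Psi>1 that by simp
    moreover have "(\<Sum>j\<in>{i}. \<Psi> j x) \<le> 1" using that unfolding K_def by blast
    ultimately show False by simp
  qed
  \<comment> \<open>On this ball \<open>h i x \<le> 1 / 2 \<le> 1 - \<tau> i\<close>, so all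
    barriers vanish.\<close>
  have K4: "cball 0 (1 / (2 * L)) \<subseteq> K"
  proof
    fix x :: 'a assume "x \<in> cball 0 (1 / (2 * L))"
    then have "L * norm x \<le> 1 / 2" using L(1) by (simp add: field_simps)
    then show "x \<in> K" using L(2)[of _ x] \<tau>(2) by (intro K_zero) (force simp: h_def)
  qed
  have K5: "K \<subseteq> cball 0 (1 / \<kappa>)"
  proof
    fix x assume x: "x \<in> K"
    show "x \<in> cball 0 (1 / \<kappa>)"
    proof (cases "x = 0")
      case False
      from strict[OF this] obtain i where "i \<in> I" "\<kappa> * norm x \<le> h i x" unfolding h_def by blast
      then have "\<kappa> * norm x \<le> 1" using K_h[OF x] by force
      then show ?thesis using \<kappa> by (simp add: field_simps)
    qed (use \<kappa> in simp)
  qed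
  have pos: "0 < 1 / (2 * L)" "0 < 1 / \<kappa>" using L \<kappa> by auto
  obtain q where q: "is_norm q" "\<And>x. norm x / (1 / \<kappa>) \<le> q x" "\<And>x. q x \<le> norm x / (1 / (2 * L))"
    and key: "\<And>x t. 0 < t \<Longrightarrow> q x \<le> t \<longleftrightarrow> inverse t *\<^sub>R x \<in> K"
    by (rule gauge_norm[OF K1 K2 K3 pos(1) K4 pos(2) K5], assumption) (rule that, assumption+)
  have qb: "\<kappa> * norm x \<le> q x" "q x \<le> (2 * L) * norm x" for x
    using q(2,3)[of x] by (simp_all add: mult.commute)
  have ren: "renorming q"
    unfolding renorming_def using q(1) qb \<kappa> L(1) by (intro conjI exI[of _ \<kappa>] exI[of _ "2 * L"]) auto
  have qpos: "0 < q x" if "x \<noteq> 0" for x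
    using q(1) that unfolding is_norm_def by (simp add: order.strict_iff_order)
  have qsn: "seminorm q"
    unfolding seminorm_def using q(1)[unfolded is_norm_def] qb(2) by (intro conjI exI[of _ "2 * L"]) auto
  have q_scale: "q (a *\<^sub>R x) = \<bar>a\<bar> * q x" for a x using seminormD(2)[OF qsn] .
  have K_unit: "inverse (q x) *\<^sub>R x \<in> K" if "x \<noteq> 0" for x using key[OF qpos[OF that], of x] by simp
  have h_le: "h i x \<le> q x" if i: "i \<in> I" for i x
  proof (cases "x = 0")
    case True
    then show ?thesis using h0[OF i] seminormD(4)[OF qsn] by simp
  next
    case False
    have "h i (inverse (q x) *\<^sub>R x) < 1" by (rule K_h[OF K_unit[OF False] i])
    then show ?thesis using h_scale[OF i] qpos[OF False] by (simp add: field_simps)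
  qed
  have le_b: "q x \<le> b" if b: "0 < b" "\<And>i. i \<in> I \<Longrightarrow> h i x \<le> (1 - \<tau> i) * b" for b x
  proof -
    have "h i (inverse b *\<^sub>R x) \<le> 1 - \<tau> i" if i: "i \<in> I" for i
    proof -
      have "h i (inverse b *\<^sub>R x) = inverse b * h i x" using b(1) h_scale[OF i, of "inverse b" x] by simp
      also have "\<dots> \<le> inverse b * ((1 - \<tau> i) * b)" using b(1) by (intro mult_left_mono b(2)[OF i]) simp
      also have "\<dots> = 1 - \<tau> i" using b(1) by (simp add: field_simps)
      finally show ?thesis .
    qed
    then show ?thesis using key[OF b(1)] K_zero by blast
  qed
  obtain L' where L': "0 < L'" "\<And>x y. \<bar>q x - q y\<bar> \<le> L' * norm (x - y)" using seminorm_bound[OF qsn] by metis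

  \<comment> \<open>Smoothness of the gauge near a nonzero point\<close>
  have local: "\<exists>U. x0 \<in> U \<and> CK n 0 U (\<lambda>x hs. q x)" if x0: "x0 \<noteq> 0" and n: "enat n \<le> k" for x0 n
  proof -
    define y0 where "y0 = inverse (q x0) *\<^sub>R x0"
    have y0K: "y0 \<in> K" and y00: "y0 \<noteq> 0" using K_unit[OF x0] qpos[OF x0] x0 by (auto simp: y0_def)
    obtain i0 c where i0: "i0 \<in> I" "c < h i0 y0" "finite {j \<in> I. c < h j y0}"
      using strict[OF y00] unfolding h_def by blast
    have c1: "c < 1" using i0 K_h[OF y0K i0(1)] by simp
    \<comment> \<open>The indices that can be active near \<open>y0\<close>. For \<open>j\<close>
      outside \<open>A\<close> and \<open>y\<close> within \<open>r = (1 - c) / (2 * L)\<close> of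
      \<open>y0\<close>, \<open>h j y \<le> c + (1 - c) / 2 \<le> 1 - (1 - c) / 4 \<le> 1 - \<tau>
      j\<close>, so the barrier of \<open>j\<close> vanishes.\<close>
    define A where "A = {j \<in> I. c < h j y0} \<union> {j \<in> I. (1 - c) / 4 < \<tau> j}"
    have finA: "finite A" unfolding A_def using i0(3) \<tau>(3)[of "(1 - c) / 4"] c1 by simp
    have AI: "A \<subseteq> I" by (auto simp: A_def)
    define r where "r = (1 - c) / (2 * L)"
    have r: "0 < r" using c1 L by (simp add: r_def)
    have out: "\<Psi> j y = 0" if "y \<in> ball y0 r" "j \<in> I" "j \<notin> A" for y j
    proof (rule \<Psi>0[OF that(2)])
      have "L * norm (y - y0) \<le> L * r" using that(1) L(1) by (simp add: dist_norm norm_minus_commute)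
      also have "L * r = (1 - c) / 2" using L(1) by (simp add: r_def)
      finally have "L * norm (y - y0) \<le> (1 - c) / 2" .
      moreover have "h j y0 \<le> c" using that by (auto simp: A_def)
      ultimately have "h j y \<le> c + (1 - c) / 2" using h_lip[OF that(2), of y y0] by linarith
      then show "h j y \<le> 1 - \<tau> j" using that c1 by (simp add: A_def field_simps)
    qed
    define \<Phi> where "\<Phi> = (\<lambda>x. \<Sum>i\<in>A. \<Psi> i x)"
    define \<Phi>' where "\<Phi>' = (\<lambda>x h. \<Sum>i\<in>A. \<Psi>' i x h)"
    have rc: "radially_C k \<Phi> \<Phi>'" unfolding \<Phi>_def \<Phi>'_def using \<Psi> AI by (intro radially_C_sum) auto
    have \<Phi>der: "(\<Phi> has_derivative \<Phi>' y) (at y)" for y using rc unfolding radially_C_def by blast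
    have \<Phi>K: "y \<in> K" if "y \<in> ball y0 r" "\<Phi> y \<le> 1" for y
      unfolding K_def
    proof (intro CollectI allI impI)
      fix B assume B: "finite B" "B \<subseteq> I"
      have "(\<Sum>i\<in>B. \<Psi> i y) = (\<Sum>i\<in>B \<inter> A. \<Psi> i y)"
        using B out[OF that(1)] by (intro sum.mono_neutral_right) auto
      also have "\<dots> \<le> (\<Sum>i\<in>A. \<Psi> i y)" using finA AI \<Psi>nn by (intro sum_mono2) auto
      finally show "(\<Sum>i\<in>B. \<Psi> i y) \<le> 1" using that(2) by (simp add: \<Phi>_def)
    qed
    define U where "U = {x. x \<noteq> 0 \<and> inverse (q x) *\<^sub>R x \<in> ball y0 r}"
    have "continuous_on (-{0}) (\<lambda>x. inverse (q x) *\<^sub>R x)"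
    proof (intro continuous_on_scaleR continuous_on_inverse continuous_on_id ballI)
      show "continuous_on (-{0}) q"
        using seminorm_isCont[OF qsn] by (simp add: continuous_at_imp_continuous_on)
      show "q x \<noteq> 0" if "x \<in> -{0}" for x using qpos[of x] that by simp
    qed
    from continuous_open_preimage[OF this _ open_ball, of y0 r]
    have oU: "open U" unfolding U_def by (simp add: vimage_def Int_def open_Compl)
    \<comment> \<open>A value below 1 would persist slightly further out on the same ray; those
      points would lie in \<open>K\<close> although their gauge exceeds 1.\<close>
    have eq1: "\<Phi> (inverse (q x) *\<^sub>R x) = 1" if x: "x \<in> U" for x
    proof (rule ccontr)
      assume ne: "\<Phi> (inverse (q x) *\<^sub>R x) \<noteq> 1"
      define y where "y = inverse (q x) *\<^sub>R x"
      have xn: "x \<noteq> 0" and yb: "y \<in> ball y0 r" using x by (auto simp: U_def y_def)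
      have "\<Phi> y \<le> 1" using K_unit[OF xn] finA AI unfolding K_def \<Phi>_def y_def by blast
      then have lt: "\<Phi> y < 1" using ne by (simp add: y_def)
      have qy: "q y = 1" using q_scale qpos[OF xn] by (simp add: y_def)
      have "((\<lambda>s. s *\<^sub>R y) \<longlongrightarrow> 1 *\<^sub>R y) (at_right 1)" by (intro tendsto_intros)
      then have lim: "((\<lambda>s. s *\<^sub>R y) \<longlongrightarrow> y) (at_right 1)" by simp
      have "(\<Phi> \<longlongrightarrow> \<Phi> y) (nhds y)"
        using has_derivative_continuous[OF \<Phi>der[of y]] unfolding isCont_def tendsto_at_iff_tendsto_nhds .
      then have "((\<lambda>s. \<Phi> (s *\<^sub>R y)) \<longlongrightarrow> \<Phi> y) (at_right 1)" using lim by (rule filterlim_compose)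
      then have "\<forall>\<^sub>F s in at_right 1. \<Phi> (s *\<^sub>R y) < 1" using lt by (rule order_tendstoD)
      moreover have "\<forall>\<^sub>F s in at_right 1. s *\<^sub>R y \<in> ball y0 r"
        using topological_tendstoD[OF lim open_ball yb] .
      moreover have "\<forall>\<^sub>F s in at_right (1::real). 1 < s" by (rule eventually_at_right_less)
      ultimately have "\<forall>\<^sub>F s in at_right (1::real). False"
      proof eventually_elim
        case (elim s)
        then have "s *\<^sub>R y \<in> K" by (intro \<Phi>K) auto
        then have "q (s *\<^sub>R y) \<le> 1" using key[of 1 "s *\<^sub>R y"] by simp
        then show False using q_scale[of s y] qy elim by simp
      qed
      then show False by simp
    qed
    \<comment> \<open>Convexity with \<open>\<Phi> 0 = 0\<close> and \<open>\<Phi> y = 1\<close>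
      gives \<open>\<Phi> (t *\<^sub>R y) \<le> t\<close> for \<open>t < 1\<close>, so the radial
      derivative at \<open>y\<close> is at least 1.\<close>
    have nz: "0 < \<Phi>' (inverse (q x) *\<^sub>R x) x" if x: "x \<in> U" for x
    proof -
      define y where "y = inverse (q x) *\<^sub>R x"
      have xn: "x \<noteq> 0" using x by (simp add: U_def)
      have \<Phi>0: "\<Phi> 0 = 0" unfolding \<Phi>_def using AI h0 \<tau>(2) by (intro sum.neutral) (force intro!: \<Psi>0)
      have cv: "convex_on UNIV \<Phi>" unfolding \<Phi>_def by (rule sum_convex[OF AI])
      have lin: "linear (\<Phi>' y)" by (rule has_derivative_linear[OF \<Phi>der])
      have "((\<lambda>t. t *\<^sub>R y) has_derivative (\<lambda>t. t *\<^sub>R y)) (at 1)"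
        by (intro bounded_linear_imp_has_derivative bounded_linear_scaleR_left)
      moreover have "(\<Phi> has_derivative \<Phi>' y) (at (1 *\<^sub>R y))" using \<Phi>der by simp
      ultimately have "((\<lambda>t. \<Phi> (t *\<^sub>R y)) has_derivative (\<lambda>t. \<Phi>' y (t *\<^sub>R y))) (at 1)"
        by (rule has_derivative_compose)
      then have "((\<lambda>t. \<Phi> (t *\<^sub>R y)) has_field_derivative \<Phi>' y y) (at 1)"
        unfolding has_field_derivative_def by (simp add: linear_scale[OF lin] mult.commute[of _ "\<Phi>' y y"])
      then have "((\<lambda>t. (\<Phi> (t *\<^sub>R y) - \<Phi> (1 *\<^sub>R y)) / (t - 1)) \<longlongrightarrow> \<Phi>' y y) (at_left 1)"
        unfolding has_field_derivative_iff by (rule tendsto_mono[OF at_le, rotated]) simp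
      moreover have "\<forall>\<^sub>F t in at_left (1::real). 1 \<le> (\<Phi> (t *\<^sub>R y) - \<Phi> (1 *\<^sub>R y)) / (t - 1)"
      proof -
        have "\<forall>\<^sub>F t in at_left (1::real). t \<in> {0<..<1}" by (rule eventually_at_left_real) simp
        then show ?thesis
        proof eventually_elim
          case (elim t)
          have "\<Phi> ((1 - t) *\<^sub>R 0 + t *\<^sub>R y) \<le> (1 - t) * \<Phi> 0 + t * \<Phi> y"
            using elim by (intro convex_onD[OF cv]) auto
          then have "\<Phi> (t *\<^sub>R y) \<le> t" using \<Phi>0 eq1[OF x] by (simp add: y_def)
          then show ?case using elim eq1[OF x] by (simp add: y_def neg_le_divide_eq)
        qed
      qed
      ultimately have "1 \<le> \<Phi>' y y"
        by (rule tendsto_lowerbound) simp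
      moreover have "\<Phi>' y x = q x * \<Phi>' y y"
        unfolding y_def[symmetric] using linear_scale[OF lin, of "q x" y] qpos[OF xn] by (simp add: y_def)
      ultimately show ?thesis using qpos[OF xn] by (simp add: y_def)
    qed
    have "CK n 0 U (\<lambda>x hs. q x)"
    proof (rule CK_gauge[where k = k and q = q and \<Phi> = \<Phi> and \<Phi>' = \<Phi>' and L = L'])
      show "radially_C k \<Phi> \<Phi>'" by (rule rc)
      show "\<bar>q x - q y\<bar> \<le> L' * norm (x - y)" for x y by (rule L'(2))
      show "0 < q y" if "y \<in> U" for y using that qpos by (simp add: U_def)
      show "\<Phi> (inverse (q y) *\<^sub>R y) = 1" if "y \<in> U" for y by (rule eq1[OF that])
      show "0 < \<Phi>' (inverse (q y) *\<^sub>R y) y" if "y \<in> U" for y by (rule nz[OF that])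
    qed (rule L'(1) oU n)+
    moreover have "x0 \<in> U" using x0 r by (simp add: U_def y0_def)
    ultimately show ?thesis by blast
  qed
  have "C_smooth_norm k q"
    unfolding C_smooth_norm_def
    by (intro CK_imp_C_smooth_on CK_local local) auto
  with ren h_le le_b show thesis by (intro that[of q]) (simp_all add: h_def)
qed

section \<open>Support functionals and separability of the dual space\<close>

definition sublinear :: "('a::real_vector \<Rightarrow> real) \<Rightarrow> bool" where
  "sublinear p \<longleftrightarrow> (\<forall>x y. p (x + y) \<le> p x + p y) \<and> (\<forall>a x. 0 \<le> a \<longrightarrow> p (a *\<^sub>R x) = a * p x)"

lemma sublinearD:
  assumes "sublinear p"
  shows "p (x + y) \<le> p x + p y" "0 \<le> a \<Longrightarrow> p (a *\<^sub>R x) = a * p x" "p 0 = 0" "- p (- x) \<le> p x"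
proof -
  show add: "p (x + y) \<le> p x + p y" for x y using assms unfolding sublinear_def by blast
  show sc: "p (a *\<^sub>R x) = a * p x" if "0 \<le> a" for a x using assms that unfolding sublinear_def by blast
  show z: "p 0 = 0" using sc[of 0 0] by simp
  show "- p (- x) \<le> p x" using add[of x "- x"] z by simp
qed

text \<open>The largest sublinear minorant \<open>q\<close> of \<open>p\<close> with \<open>q (- y) = - p y\<close>. A minimal sublinear functional
  coincides with it for every \<open>y\<close> and is therefore linear.\<close>

definition dirmin :: "('a::real_vector \<Rightarrow> real) \<Rightarrow> 'a \<Rightarrow> 'a \<Rightarrow> real" where
  "dirmin p y x = (INF t\<in>{0..}. p (x + t *\<^sub>R y) - t * p y)"

lemma dirmin:
  assumes p: "sublinear p"
  shows "sublinear (dirmin p y)" and "0 \<le> t \<Longrightarrow> dirmin p y x \<le> p (x + t *\<^sub>R y) - t * p y"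
proof -
  \<comment> \<open>Subadditivity for \<open>t *\<^sub>R y = (x + t *\<^sub>R y) + (- x)\<close>; it
    keeps the infimum finite.\<close>
  have low: "- p (- x) \<le> p (x + t *\<^sub>R y) - t * p y" if "0 \<le> t" for t x
    using sublinearD(1)[OF p, of "x + t *\<^sub>R y" "- x"] sublinearD(2)[OF p that, of y] by simp
  have bdd: "bdd_below ((\<lambda>t. p (x + t *\<^sub>R y) - t * p y) ` {0..})" for x
    using low by (intro bdd_belowI[of _ "- p (- x)"]) auto
  show le: "dirmin p y x \<le> p (x + t *\<^sub>R y) - t * p y" if "0 \<le> t" for t x
    unfolding dirmin_def using that by (intro cINF_lower bdd) auto
  have ge: "c \<le> dirmin p y x" if "\<And>t. 0 \<le> t \<Longrightarrow> c \<le> p (x + t *\<^sub>R y) - t * p y" for c x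
    unfolding dirmin_def using that by (intro cINF_greatest) auto
  have tri: "dirmin p y (x + z) \<le> dirmin p y x + dirmin p y z" for x z
  proof -
    have "dirmin p y (x + z) - (p (z + s *\<^sub>R y) - s * p y) \<le> dirmin p y x" if s: "0 \<le> s" for s
    proof (rule ge)
      fix t :: real assume t: "0 \<le> t"
      have "dirmin p y (x + z) \<le> p ((x + z) + (s + t) *\<^sub>R y) - (s + t) * p y" using s t by (intro le) simp
      also have "(x + z) + (s + t) *\<^sub>R y = (x + t *\<^sub>R y) + (z + s *\<^sub>R y)" by (simp add: algebra_simps)
      also have "p \<dots> \<le> p (x + t *\<^sub>R y) + p (z + s *\<^sub>R y)" by (rule sublinearD(1)[OF p])
      finally show "dirmin p y (x + z) - (p (z + s *\<^sub>R y) - s * p y) \<le> p (x + t *\<^sub>R y) - t * p y"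
        by (simp add: algebra_simps)
    qed
    then have "dirmin p y (x + z) - dirmin p y x \<le> dirmin p y z"
      by (intro ge) (simp add: algebra_simps)
    then show ?thesis by simp
  qed
  have hom: "dirmin p y (a *\<^sub>R x) \<le> a * dirmin p y x" if a: "0 < a" for a x
  proof -
    have "dirmin p y (a *\<^sub>R x) / a \<le> dirmin p y x"
    proof (rule ge)
      fix t :: real assume t: "0 \<le> t"
      have "dirmin p y (a *\<^sub>R x) \<le> p (a *\<^sub>R x + (a * t) *\<^sub>R y) - (a * t) * p y" using a t by (intro le) simp
      also have "a *\<^sub>R x + (a * t) *\<^sub>R y = a *\<^sub>R (x + t *\<^sub>R y)" by (simp add: algebra_simps)
      also have "p \<dots> = a * p (x + t *\<^sub>R y)" using sublinearD(2)[OF p] a by simp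
      finally show "dirmin p y (a *\<^sub>R x) / a \<le> p (x + t *\<^sub>R y) - t * p y"
        using a by (simp add: field_simps)
    qed
    then show ?thesis using a by (simp add: field_simps)
  qed
  have z: "dirmin p y 0 = 0"
  proof (rule antisym)
    show "dirmin p y 0 \<le> 0" using le[of 0 0] sublinearD(3)[OF p] by simp
    show "0 \<le> dirmin p y 0" using sublinearD(2)[OF p] by (intro ge) simp
  qed
  have "dirmin p y (a *\<^sub>R x) = a * dirmin p y x" if "0 \<le> a" for a x
  proof (cases "a = 0")
    case False
    then have a: "0 < a" using that by simp
    have "dirmin p y (inverse a *\<^sub>R (a *\<^sub>R x)) \<le> inverse a * dirmin p y (a *\<^sub>R x)" using a by (intro hom) simp
    then have "a * dirmin p y x \<le> dirmin p y (a *\<^sub>R x)" using a by (simp add: field_simps)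
    then show ?thesis using hom[OF a, of x] by simp
  qed (use z in simp)
  with tri show "sublinear (dirmin p y)" unfolding sublinear_def by blast
qed

text \<open>Subadditivity of the infimum is where the chain matters: of the members used at
  \<open>x\<close> and at \<open>y\<close>, the smaller one serves for both. The common bound
  \<open>p\<close> keeps the infimum finite.\<close>

lemma sublinear_INF_chain:
  assumes C: "C \<noteq> {}" "\<And>q. q \<in> C \<Longrightarrow> sublinear q" "\<And>q r. q \<in> C \<Longrightarrow> r \<in> C \<Longrightarrow> q \<le> r \<or> r \<le> q"
    and p: "\<And>q. q \<in> C \<Longrightarrow> q \<le> p"
  shows "sublinear (\<lambda>x. INF q\<in>C. q x)" "\<And>q. q \<in> C \<Longrightarrow> (\<lambda>x. INF q\<in>C. q x) \<le> q"
proof -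
  have low: "- p (- x) \<le> q x" if "q \<in> C" for q x
    using sublinearD(4)[OF C(2)[OF that], of x] le_funD[OF p[OF that], of "- x"] by simp
  have bdd: "bdd_below ((\<lambda>q. q x) ` C)" for x
    using low by (intro bdd_belowI[of _ "- p (- x)"]) auto
  have le: "(INF q\<in>C. q x) \<le> q x" if "q \<in> C" for q x by (rule cINF_lower[OF bdd that])
  show "(\<lambda>x. INF q\<in>C. q x) \<le> q" if "q \<in> C" for q using le[OF that] by (simp add: le_fun_def)
  have ge: "c \<le> (INF q\<in>C. q x)" if "\<And>q. q \<in> C \<Longrightarrow> c \<le> q x" for c x
    using C(1) that by (rule cINF_greatest)
  show "sublinear (\<lambda>x. INF q\<in>C. q x)"
    unfolding sublinear_def
  proof (intro conjI allI impI)
    fix x y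
    have "(INF q\<in>C. q (x + y)) - r y \<le> (INF q\<in>C. q x)" if r: "r \<in> C" for r
    proof (rule ge)
      fix q assume q: "q \<in> C"
      from C(3)[OF q r] show "(INF q\<in>C. q (x + y)) - r y \<le> q x"
      proof
        assume "q \<le> r"
        then have "q y \<le> r y" by (rule le_funD)
        then show ?thesis using le[OF q, of "x + y"] sublinearD(1)[OF C(2)[OF q], of x y] by simp
      next
        assume "r \<le> q"
        then have "r x \<le> q x" by (rule le_funD)
        then show ?thesis using le[OF r, of "x + y"] sublinearD(1)[OF C(2)[OF r], of x y] by simp
      qed
    qed
    then have "(INF q\<in>C. q (x + y)) - (INF q\<in>C. q x) \<le> (INF q\<in>C. q y)"
      by (intro ge) (simp add: algebra_simps)
    then show "(INF q\<in>C. q (x + y)) \<le> (INF q\<in>C. q x) + (INF q\<in>C. q y)" by simp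
  next
    fix a :: real and x assume a: "0 \<le> a"
    have "(\<lambda>q. q (a *\<^sub>R x)) ` C = (\<lambda>q. a * q x) ` C"
      using sublinearD(2)[OF C(2) a] by (intro image_cong) auto
    then have 1: "(INF q\<in>C. q (a *\<^sub>R x)) = (INF q\<in>C. a * q x)" by simp
    show "(INF q\<in>C. q (a *\<^sub>R x)) = a * (INF q\<in>C. q x)"
    proof (cases "a = 0")
      case True
      then show ?thesis using 1 C(1) by simp
    next
      case False
      then have a: "0 < a" using a by simp
      have bdda: "bdd_below ((\<lambda>q. a * q x) ` C)"
      proof (rule bdd_belowI)
        fix r assume "r \<in> (\<lambda>q. a * q x) ` C"
        then obtain q where q: "r = a * q x" "q \<in> C" by blast
        show "a * - p (- x) \<le> r" unfolding q(1) using a by (intro mult_left_mono low q) simp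
      qed
      have "(INF q\<in>C. a * q x) = a * (INF q\<in>C. q x)"
      proof (rule antisym)
        have "(INF q\<in>C. a * q x) / a \<le> (INF q\<in>C. q x)"
        proof (rule ge)
          fix q assume "q \<in> C"
          then have "(INF q\<in>C. a * q x) \<le> a * q x" by (rule cINF_lower[OF bdda])
          then show "(INF q\<in>C. a * q x) / a \<le> q x" using a by (simp add: field_simps)
        qed
        then show "(INF q\<in>C. a * q x) \<le> a * (INF q\<in>C. q x)" using a by (simp add: field_simps)
        show "a * (INF q\<in>C. q x) \<le> (INF q\<in>C. a * q x)"
          using C(1) by (rule cINF_greatest) (use le a in \<open>simp add: mult_left_mono\<close>)
      qed
      then show ?thesis using 1 by simp
    qed
  qed
qed

text \<open>Minimising below \<open>dirmin p x0\<close> instead of \<open>p\<close> forces the value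
  at \<open>x0\<close>: it gives \<open>f (- x0) \<le> - p x0\<close>, and the reverse estimate is
  \<open>f x0 \<le> p x0\<close>.\<close>

lemma Hahn_Banach_sublinear:
  assumes p: "sublinear p"
  obtains f where "linear f" "\<And>x. f x \<le> p x" "f x0 = p x0"
proof -
  define p0 where "p0 = dirmin p x0"
  have p0: "sublinear p0" unfolding p0_def by (rule dirmin(1)[OF p])
  define A where "A = {q. sublinear q \<and> q \<le> p0}"
  \<comment> \<open>Zorn's lemma for the reversed order, so that a chain is bounded by its pointwise
    infimum.\<close>
  have "\<exists>m\<in>A. \<forall>a\<in>A. a \<le> m \<longrightarrow> a = m"
  proof (rule predicate_Zorn[where P = "\<lambda>a b. b \<le> a"])
    show "partial_order_on A (relation_of (\<lambda>a b. b \<le> a) A)"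
      unfolding partial_order_on_def preorder_on_def refl_on_def trans_def antisym_def relation_of_def
      by auto
    fix C assume C: "C \<in> Chains (relation_of (\<lambda>a b. b \<le> a) A)"
    have CA: "C \<subseteq> A" and ch: "\<And>a b. a \<in> C \<Longrightarrow> b \<in> C \<Longrightarrow> a \<le> b \<or> b \<le> a"
      using C unfolding Chains_def relation_of_def by auto
    show "\<exists>u\<in>A. \<forall>a\<in>C. u \<le> a"
    proof (cases "C = {}")
      case True
      then show ?thesis using p0 by (auto simp: A_def)
    next
      case False
      have h: "sublinear (\<lambda>x. INF q\<in>C. q x)" "\<And>q. q \<in> C \<Longrightarrow> (\<lambda>x. INF q\<in>C. q x) \<le> q"
        using sublinear_INF_chain[of C p0] False CA ch by (auto simp: A_def)
      obtain q where "q \<in> C" using False by blast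
      then have "(\<lambda>x. INF q\<in>C. q x) \<le> p0" using h(2)[of q] CA by (auto simp: A_def intro: order_trans)
      then show ?thesis using h unfolding A_def by blast
    qed
  qed
  then obtain m where m: "sublinear m" "m \<le> p0" and min: "\<And>a. sublinear a \<Longrightarrow> a \<le> m \<Longrightarrow> a = m"
    unfolding A_def by (auto intro: order_trans)
  have "m x + m y \<le> m (x + y)" for x y
  proof -
    have "dirmin m y \<le> m"
      using dirmin(2)[OF m(1), of 0 y] by (intro le_funI) simp
    then have "dirmin m y = m" by (intro min dirmin(1) m)
    then show ?thesis using dirmin(2)[OF m(1), of 1 y x] by simp
  qed
  then have add: "m (x + y) = m x + m y" for x y
    using sublinearD(1)[OF m(1), of x y] by (simp add: antisym)
  have neg: "m (- x) = - m x" for x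
    using add[of x "- x"] sublinearD(3)[OF m(1)] by simp
  have "m (a *\<^sub>R x) = a * m x" for a x
  proof (cases "0 \<le> a")
    case False
    then have "m ((- a) *\<^sub>R x) = (- a) * m x" by (intro sublinearD(2)[OF m(1)]) simp
    then show ?thesis using neg[of "a *\<^sub>R x"] by simp
  qed (rule sublinearD(2)[OF m(1)])
  then have lin: "linear m" using add by (intro linearI) auto
  have le: "m x \<le> p x" for x
    using le_funD[OF m(2), of x] dirmin(2)[OF p, of 0 x0 x] by (simp add: p0_def)
  have "m (- x0) \<le> - p x0"
    using le_funD[OF m(2), of "- x0"] dirmin(2)[OF p, of 1 x0 "- x0"] sublinearD(3)[OF p] by (simp add: p0_def)
  then have "m x0 = p x0" using neg[of x0] le[of x0] by simp
  then show thesis using that lin le by blast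
qed

lemma support_functional:
  fixes u :: "'a::real_normed_vector \<Rightarrow> real"
  assumes u: "seminorm u"
  obtains f :: "'a \<Rightarrow>\<^sub>L real" where "\<And>x. \<bar>blinfun_apply f x\<bar> \<le> u x" "blinfun_apply f x0 = u x0"
proof -
  have "sublinear u" unfolding sublinear_def using seminormD(2,3)[OF u] by simp
  then obtain f where f: "linear f" "\<And>x. f x \<le> u x" "f x0 = u x0"
    using Hahn_Banach_sublinear[of u x0] by metis
  have ab: "\<bar>f x\<bar> \<le> u x" for x
    using f(2)[of x] f(2)[of "- x"] linear_neg[OF f(1), of x] seminormD(5)[OF u, of x] by simp
  obtain L where L: "\<And>x. u x \<le> L * norm x" using u unfolding seminorm_def by blast
  have "bounded_linear f"
    using f(1) order_trans[OF ab L]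
    by (intro bounded_linear_intro[where K = L]) (auto simp: linear_add linear_scale mult.commute)
  then have "blinfun_apply (Blinfun f) = f" by (rule bounded_linear_Blinfun_apply)
  then show thesis using that[of "Blinfun f"] ab f(3) by simp
qed

text \<open>From \<open>x\<close> move to a point of \<open>S x\<close> that at least halves the
  distance of \<open>\<psi>\<close> to its infimum over \<open>S x\<close>. The decreasing values
  make the points Cauchy. The limit \<open>w\<close> lies in every \<open>S (y n)\<close>, and so
  would any \<open>z\<close> violating the claim at \<open>w\<close>.\<close>

theorem Ekeland:
  fixes \<psi> :: "'a::complete_space \<Rightarrow> real"
  assumes cont: "continuous_on UNIV \<psi>" and bdd: "\<And>x. b \<le> \<psi> x" and \<eta>: "0 < \<eta>"
  obtains y where "\<And>z. \<psi> y \<le> \<psi> z + \<eta> * dist y z"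
proof -
  define S where "S = (\<lambda>x. {z. \<psi> z + \<eta> * dist x z \<le> \<psi> x})"
  have xS: "x \<in> S x" for x by (simp add: S_def)
  have bddS: "bdd_below (\<psi> ` S x)" for x using bdd by (intro bdd_belowI[of _ b]) auto
  have "\<exists>z\<in>S x. \<psi> z \<le> (\<psi> x + Inf (\<psi> ` S x)) / 2" for x
  proof (cases "Inf (\<psi> ` S x) < \<psi> x")
    case True
    then have "Inf (\<psi> ` S x) < (\<psi> x + Inf (\<psi> ` S x)) / 2" by simp
    then have "\<exists>r\<in>\<psi> ` S x. r < (\<psi> x + Inf (\<psi> ` S x)) / 2"
      using cInf_lessD[of "\<psi> ` S x"] xS[of x] by blast
    then show ?thesis by (auto intro: less_imp_le)
  next
    case False
    then show ?thesis using xS by (intro bexI[of _ x]) auto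
  qed
  then obtain nxt where nxt: "\<And>x. nxt x \<in> S x" "\<And>x. \<psi> (nxt x) \<le> (\<psi> x + Inf (\<psi> ` S x)) / 2" by metis
  define y where "y = (\<lambda>n. (nxt ^^ n) undefined)"
  have ySuc: "y (Suc n) = nxt (y n)" for n by (simp add: y_def)
  define a where "a = (\<lambda>n. \<psi> (y n))"
  have step: "\<eta> * dist (y n) (y (Suc n)) \<le> a n - a (Suc n)" for n
    using nxt(1)[of "y n"] by (simp add: S_def a_def ySuc)
  have tele: "\<eta> * dist (y n) (y (n + j)) \<le> a n - a (n + j)" for n j
  proof (induction j)
    case (Suc j)
    have "\<eta> * dist (y n) (y (n + Suc j)) \<le> \<eta> * (dist (y n) (y (n + j)) + dist (y (n + j)) (y (Suc (n + j))))"
      using \<eta> dist_triangle by (intro mult_left_mono) auto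
    also have "\<dots> \<le> (a n - a (n + j)) + (a (n + j) - a (Suc (n + j)))"
      using Suc step[of "n + j"] by (simp add: distrib_left)
    finally show ?case by simp
  qed simp
  have adec: "a (Suc n) \<le> a n" for n
    using step[of n] \<eta> by (smt (verit) mult_nonneg_nonneg zero_le_dist)
  then have "decseq a" by (rule decseq_SucI)
  moreover have "\<forall>i. b \<le> a i" using bdd by (simp add: a_def)
  ultimately obtain l where l: "a \<longlonglongrightarrow> l" by (rule decseq_convergent)
  have "Cauchy y"
    unfolding Cauchy_altdef2
  proof (intro allI impI)
    fix e :: real assume e: "0 < e"
    have "Cauchy a" using l by (rule LIMSEQ_imp_Cauchy)
    moreover have "0 < \<eta> * e" using \<eta> e by simp
    ultimately obtain N where N: "\<And>n. n \<ge> N \<Longrightarrow> dist (a n) (a N) < \<eta> * e" unfolding Cauchy_altdef2 by meson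
    have "dist (y n) (y N) < e" if n: "n \<ge> N" for n
    proof -
      have "\<eta> * dist (y N) (y n) \<le> a N - a n" using tele[of N "n - N"] n by simp
      also have "\<dots> < \<eta> * e" using N[OF n] by (simp add: dist_real_def)
      finally show ?thesis using \<eta> by (simp add: dist_commute)
    qed
    then show "\<exists>N. \<forall>n\<ge>N. dist (y n) (y N) < e" by blast
  qed
  then obtain w where w: "y \<longlonglongrightarrow> w" using Cauchy_convergent convergent_def by blast
  have aw: "a \<longlonglongrightarrow> \<psi> w"
    unfolding a_def using cont w continuous_on_tendsto_compose[of UNIV \<psi> y w sequentially] by simp
  have wS: "\<psi> w + \<eta> * dist (y n) w \<le> a n" for n
  proof (rule LIMSEQ_le_const2)
    show "(\<lambda>j. a (j + n) + \<eta> * dist (y n) (y (j + n))) \<longlonglongrightarrow> \<psi> w + \<eta> * dist (y n) w"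
      using LIMSEQ_ignore_initial_segment[OF aw, of n] LIMSEQ_ignore_initial_segment[OF w, of n]
      by (intro tendsto_intros)
    show "\<exists>N. \<forall>j\<ge>N. a (j + n) + \<eta> * dist (y n) (y (j + n)) \<le> a n"
      using tele[of n] by (intro exI[of _ 0]) (simp add: algebra_simps)
  qed
  show thesis
  proof (rule that)
    fix z
    show "\<psi> w \<le> \<psi> z + \<eta> * dist w z"
    proof (rule ccontr)
      assume "\<not> \<psi> w \<le> \<psi> z + \<eta> * dist w z"
      then have lt: "\<psi> z + \<eta> * dist w z < \<psi> w" by simp
      have zS: "z \<in> S (y n)" for n
      proof -
        have "\<eta> * dist (y n) z \<le> \<eta> * dist (y n) w + \<eta> * dist w z"
          using \<eta> dist_triangle[of "y n" z w] mult_left_mono[of "dist (y n) z" "dist (y n) w + dist w z" \<eta>]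
          by (simp add: distrib_left)
        then show ?thesis using lt wS[of n] by (simp add: S_def a_def)
      qed
      \<comment> \<open>The halving rule, solved for the infimum over \<open>S (y n)\<close>. Its
        limit gives \<open>\<psi> w \<le> \<psi> z\<close>, contradicting the choice of
        \<open>z\<close>.\<close>
      have "2 * a (Suc n) - a n \<le> \<psi> z" for n
      proof -
        have "Inf (\<psi> ` S (y n)) \<le> \<psi> z" using zS by (intro cInf_lower bddS) auto
        then show ?thesis using nxt(2)[of "y n"] by (simp add: a_def ySuc field_simps)
      qed
      moreover have "(\<lambda>n. 2 * a (Suc n) - a n) \<longlonglongrightarrow> 2 * \<psi> w - \<psi> w"
        using aw LIMSEQ_Suc[OF aw] by (intro tendsto_intros)
      ultimately have "2 * \<psi> w - \<psi> w \<le> \<psi> z" by (intro LIMSEQ_le_const2) auto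
      then show False using lt \<eta> zero_le_dist[of w z] by (smt (verit) mult_nonneg_nonneg)
    qed
  qed
qed

text \<open>One-sided difference quotients bound the derivative from below in the direction
  \<open>h\<close>, and likewise for \<open>- h\<close>. Applied at an Ekeland point, it makes the
  derivative small.\<close>

lemma has_derivative_lower_bound:
  fixes \<psi> :: "'a::real_normed_vector \<Rightarrow> real"
  assumes d: "(\<psi> has_derivative A) (at y)" and lb: "\<And>z. \<psi> y \<le> \<psi> z + \<eta> * dist y z"
  shows "\<bar>A h\<bar> \<le> \<eta> * norm h"
proof -
  have lin: "linear A" by (rule has_derivative_linear[OF d])
  have low: "- \<eta> * norm h \<le> A h" for h
  proof -
    have "((\<lambda>t. y + t *\<^sub>R h) has_derivative (\<lambda>t. t *\<^sub>R h)) (at 0)"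
      using has_derivative_add[OF has_derivative_const[of y]
          bounded_linear_imp_has_derivative[OF bounded_linear_scaleR_left[of h]]] by simp
    moreover have "(\<psi> has_derivative A) (at (y + 0 *\<^sub>R h))" using d by simp
    ultimately have "((\<lambda>t. \<psi> (y + t *\<^sub>R h)) has_derivative (\<lambda>t. A (t *\<^sub>R h))) (at 0)"
      by (rule has_derivative_compose)
    then have "((\<lambda>t. \<psi> (y + t *\<^sub>R h)) has_field_derivative A h) (at 0)"
      unfolding has_field_derivative_def by (simp add: linear_scale[OF lin] mult.commute[of _ "A h"])
    then have "((\<lambda>t. (\<psi> (y + t *\<^sub>R h) - \<psi> (y + 0 *\<^sub>R h)) / (t - 0)) \<longlongrightarrow> A h) (at_right 0)"
      unfolding has_field_derivative_iff by (rule tendsto_mono[OF at_le, rotated]) simp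
    moreover have "\<forall>\<^sub>F t in at_right (0::real). - \<eta> * norm h \<le> (\<psi> (y + t *\<^sub>R h) - \<psi> (y + 0 *\<^sub>R h)) / (t - 0)"
      using eventually_at_right_less[of "0::real"]
    proof eventually_elim
      case (elim t)
      have "\<psi> y \<le> \<psi> (y + t *\<^sub>R h) + \<eta> * (t * norm h)"
        using lb[of "y + t *\<^sub>R h"] elim by (simp add: dist_norm)
      then show ?case using elim by (simp add: field_simps)
    qed
    ultimately show ?thesis by (rule tendsto_lowerbound) simp
  qed
  from low[of h] low[of "- h"] linear_neg[OF lin, of h] show ?thesis by simp
qed

text \<open>By Ekeland's principle applied to \<open>p\<^sup>2 - f\<close>, the derivatives of \<open>p\<^sup>2\<close> are norm dense in the
  dual space; they depend continuously on the base point.\<close>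

theorem separable_dual:
  fixes p :: "'a::banach \<Rightarrow> real"
  assumes p: "renorming p" "C_smooth_norm k p" "1 \<le> k"
    and sep: "separable_space (euclidean :: 'a topology)"
  obtains a :: "nat \<Rightarrow> 'a \<Rightarrow>\<^sub>L real" where "\<And>f e. 0 < e \<Longrightarrow> \<exists>n. norm (f - a n) < e"
proof -
  have sn: "seminorm p" by (rule renorming_seminorm[OF p(1)])
  obtain c C where cC: "0 < c" "0 < C" "\<And>x. c * norm x \<le> p x" "\<And>x. p x \<le> C * norm x"
    using p(1) unfolding renorming_def by blast
  let ?D = "Dv (\<lambda>x hs. p x)"
  have ck: "CK (Suc 0) 0 (UNIV - {0}) (\<lambda>x hs. p x)"
  proof (rule C_smooth_on_imp_CK)
    show "C_smooth_on k (UNIV - {0}) p" using p(2) unfolding C_smooth_norm_def .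
    show "enat (Suc 0) \<le> k" using p(3) by (simp add: one_enat_def)
  qed (simp add: open_Diff)
  have d: "(p has_derivative (\<lambda>h. ?D y [h])) (at y)" if "y \<noteq> 0" for y
    using has_derivative_Dv[OF ck, of y] that by simp
  define Dp where "Dp = (\<lambda>y. Blinfun (\<lambda>h. ?D y [h]))"
  have Dp: "blinfun_apply (Dp y) h = ?D y [h]" if "y \<noteq> 0" for y h
    unfolding Dp_def using bounded_linear_Blinfun_apply[OF has_derivative_bounded_linear[OF d[OF that]]] by simp
  \<comment> \<open>The derivative of the square of \<open>p\<close>; unlike \<open>p\<close> itself
    the square is differentiable at 0, with derivative 0.\<close>
  define J where "J = (\<lambda>y. if y = 0 then 0 else (2 * p y) *\<^sub>R Dp y)"
  have dJ: "((\<lambda>x. p x * p x) has_derivative blinfun_apply (J y)) (at y)" for y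
  proof (cases "y = 0")
    case True
    have bl: "bounded_linear (\<lambda>h::'a. 0::real)" by (rule bounded_linear_zero)
    have "((\<lambda>x. p x * p x) has_derivative (\<lambda>h. 0)) (at 0)"
      unfolding has_derivative_at_iff_eventually[OF bl]
    proof (intro allI impI)
      fix e :: real assume e: "0 < e"
      have "\<forall>\<^sub>F x in nhds (0::'a). x \<in> ball 0 (e / C\<^sup>2)"
        using e cC by (intro eventually_nhds_in_open) auto
      then show "\<forall>\<^sub>F x in nhds 0. \<bar>p x * p x - p 0 * p 0 - 0\<bar> \<le> e * norm (x - 0)"
      proof eventually_elim
        case (elim x)
        then have "C\<^sup>2 * norm x \<le> e" using cC by (simp add: field_simps)
        have "p x * p x \<le> (C * norm x) * (C * norm x)"
          using cC seminormD(1)[OF sn] by (intro mult_mono) auto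
        also have "\<dots> = (C\<^sup>2 * norm x) * norm x" by (simp add: power2_eq_square)
        also have "\<dots> \<le> e * norm x" using \<open>C\<^sup>2 * norm x \<le> e\<close> by (intro mult_right_mono) auto
        finally show ?case using seminormD(1,4)[OF sn] by simp
      qed
    qed
    moreover have "blinfun_apply (J y) = (\<lambda>h. 0)" using True by (simp add: J_def fun_eq_iff)
    ultimately show ?thesis using True by simp
  next
    case False
    have "((\<lambda>x. p x * p x) has_derivative (\<lambda>h. p y * ?D y [h] + ?D y [h] * p y)) (at y)"
      by (rule has_derivative_mult[OF d[OF False] d[OF False]])
    moreover have "blinfun_apply (J y) = (\<lambda>h. p y * ?D y [h] + ?D y [h] * p y)"
      using False by (simp add: J_def fun_eq_iff Dp blinfun.scaleR_left)
    ultimately show ?thesis by simp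
  qed
  have dense: "\<exists>y. norm (f - J y) \<le> e" if e: "0 < e" for f e
  proof -
    define \<psi> where "\<psi> = (\<lambda>x. p x * p x - blinfun_apply f x)"
    have d\<psi>: "(\<psi> has_derivative (\<lambda>h. blinfun_apply (J y) h - blinfun_apply f h)) (at y)" for y
      unfolding \<psi>_def
      by (intro has_derivative_diff dJ bounded_linear_imp_has_derivative blinfun.bounded_linear_right)
    have "continuous_on UNIV \<psi>"
      using has_derivative_continuous[OF d\<psi>] by (simp add: continuous_at_imp_continuous_on)
    \<comment> \<open>The minimum over real \<open>s\<close> of
      \<open>c\<^sup>2 * s\<^sup>2 - norm f * s\<close>. The quadratic growth of the square of
      \<open>p\<close> is what makes \<open>\<psi>\<close> bounded below.\<close>
    moreover have "- ((norm f)\<^sup>2 / (4 * c\<^sup>2)) \<le> \<psi> x" for x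
    proof -
      have "blinfun_apply f x \<le> norm f * norm x" using norm_blinfun[of f x] by simp
      moreover have "(c * norm x) * (c * norm x) \<le> p x * p x"
        using cC by (intro mult_mono) (auto intro: seminormD(1)[OF sn])
      moreover have "norm f * norm x \<le> (c * norm x) * (c * norm x) + (norm f)\<^sup>2 / (4 * c\<^sup>2)"
      proof -
        have "0 \<le> (c * norm x - norm f / (2 * c))\<^sup>2" by simp
        also have "\<dots> = (c * norm x) * (c * norm x) + (norm f)\<^sup>2 / (4 * c\<^sup>2) - norm f * norm x"
        proof -
          have "2 * (c * norm x) * (norm f / (2 * c)) = norm f * norm x" using cC by simp
          moreover have "(norm f / (2 * c))\<^sup>2 = (norm f)\<^sup>2 / (4 * c\<^sup>2)" by (simp add: power_divide power_mult_distrib)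
          moreover have "(c * norm x)\<^sup>2 = (c * norm x) * (c * norm x)" by (rule power2_eq_square)
          ultimately show ?thesis unfolding power2_diff by linarith
        qed
        finally show ?thesis by simp
      qed
      ultimately show ?thesis unfolding \<psi>_def by linarith
    qed
    ultimately obtain y where y: "\<And>z. \<psi> y \<le> \<psi> z + e * dist y z"
      using Ekeland[of \<psi> "- ((norm f)\<^sup>2 / (4 * c\<^sup>2))" e] e by blast
    have "norm (f - J y) \<le> e"
    proof (rule norm_blinfun_bound)
      show "norm (blinfun_apply (f - J y) h) \<le> e * norm h" for h
        using has_derivative_lower_bound[OF d\<psi> y, of h] by (simp add: blinfun.diff_left)
    qed (use e in simp)
    then show ?thesis by blast
  qed
  have contJ: "isCont J y" if y: "y \<noteq> 0" for y
  proof -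
    have m: "mcont 1 ?D y" using CK_mcont[OF CK_Dv[OF ck], of y] y by simp
    have "(Dp \<longlongrightarrow> Dp y) (at y)"
    proof (rule tendstoI)
      fix e :: real assume e: "0 < e"
      have "\<forall>\<^sub>F z in nhds y. \<forall>hs. length hs = 1 \<longrightarrow> \<bar>?D z hs - ?D y hs\<bar> \<le> e / 2 * pnorm hs"
        using m[unfolded mcont_def, rule_format, OF half_gt_zero[OF e]] .
      moreover have "\<forall>\<^sub>F z in nhds y. z \<in> - {0}" using y by (intro eventually_nhds_in_open) auto
      ultimately have "\<forall>\<^sub>F z in nhds y. dist (Dp z) (Dp y) < e"
      proof eventually_elim
        case (elim z)
        have "norm (Dp z - Dp y) \<le> e / 2"
        proof (rule norm_blinfun_bound)
          show "norm (blinfun_apply (Dp z - Dp y) h) \<le> e / 2 * norm h" for h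
            using elim(1)[rule_format, of "[h]"] elim(2) y by (simp add: blinfun.diff_left Dp)
        qed (use e in simp)
        then show ?case using e by (simp add: dist_norm)
      qed
      then show "\<forall>\<^sub>F z in at y. dist (Dp z) (Dp y) < e" by (simp add: eventually_at_filter eventually_mono)
    qed
    then have "((\<lambda>z. (2 * p z) *\<^sub>R Dp z) \<longlongrightarrow> (2 * p y) *\<^sub>R Dp y) (at y)"
      using seminorm_isCont[OF sn, of y] unfolding isCont_def by (intro tendsto_intros)
    moreover have "\<forall>\<^sub>F z in at y. (2 * p z) *\<^sub>R Dp z = J z"
    proof -
      have "\<forall>\<^sub>F z in nhds y. z \<in> - {0}" using y by (intro eventually_nhds_in_open) auto
      then show ?thesis unfolding eventually_at_filter by eventually_elim (simp add: J_def)
    qed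
    ultimately show ?thesis unfolding isCont_def using y by (simp add: J_def tendsto_cong)
  qed
  obtain Q :: "'a set" where Q: "countable Q" "closure Q = UNIV"
    using sep unfolding separable_space_def by auto
  \<comment> \<open>Continuity of \<open>J\<close> was shown off 0 only, so the value
    \<open>J 0 = 0\<close> is added by hand.\<close>
  define A where "A = insert 0 (J ` Q)"
  have "countable A" "A \<noteq> {}" using Q by (auto simp: A_def)
  have near: "\<exists>g\<in>A. norm (f - g) < e" if e: "0 < e" for f e
  proof -
    obtain y where y: "norm (f - J y) \<le> e / 2" using dense[of "e / 2" f] e by auto
    show ?thesis
    proof (cases "y = 0")
      case True
      then show ?thesis using y e by (intro bexI[of _ 0]) (auto simp: A_def J_def)
    next
      case False
      obtain \<delta> where \<delta>: "0 < \<delta>" "\<And>z. dist z y < \<delta> \<Longrightarrow> dist (J z) (J y) < e / 2"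
        using contJ[OF False, unfolded continuous_at_eps_delta, rule_format, OF half_gt_zero[OF e]] by blast
      have "y \<in> closure Q" using Q by simp
      then obtain z where z: "z \<in> Q" "dist z y < \<delta>" using \<delta>(1) unfolding closure_approachable by blast
      have "norm (f - J z) \<le> norm (f - J y) + dist (J z) (J y)"
        using norm_triangle_ineq[of "f - J y" "J y - J z"] by (simp add: dist_norm norm_minus_commute)
      then have "norm (f - J z) < e" using y \<delta>(2)[OF z(2)] by simp
      then show ?thesis using z by (auto simp: A_def)
    qed
  qed
  show thesis
  proof (rule that)
    fix f :: "'a \<Rightarrow>\<^sub>L real" and e :: real assume "0 < e"
    from near[OF this] obtain g where g: "g \<in> A" "norm (f - g) < e" by blast
    have "range (from_nat_into A) = A"
      by (rule range_from_nat_into[OF \<open>A \<noteq> {}\<close> \<open>countable A\<close>])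
    then obtain n where "g = from_nat_into A n" using g(1) by blast
    then show "\<exists>n. norm (f - from_nat_into A n) < e" using g(2) by blast
  qed
qed

section \<open>Schauder bases\<close>

definition coord :: "(nat \<Rightarrow> 'a::real_normed_vector) \<Rightarrow> nat \<Rightarrow> 'a \<Rightarrow> real" where
  "coord e i x = (THE a. (\<lambda>i. a i *\<^sub>R e i) sums x) i"

definition bproj :: "(nat \<Rightarrow> 'a::real_normed_vector) \<Rightarrow> nat \<Rightarrow> 'a \<Rightarrow> 'a" where
  "bproj e n x = (\<Sum>i<n. coord e i x *\<^sub>R e i)"

lemma coord_sums:
  assumes "schauder_basis e"
  shows "(\<lambda>i. coord e i x *\<^sub>R e i) sums x"
  using theI'[of "\<lambda>a. (\<lambda>i. a i *\<^sub>R e i) sums x"] assms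
  unfolding schauder_basis_def coord_def by blast

lemma coord_unique:
  assumes "schauder_basis e" "(\<lambda>i. a i *\<^sub>R e i) sums x"
  shows "coord e i x = a i"
  using coord_sums[OF assms(1), of x] assms unfolding schauder_basis_def by metis

lemma bproj_tendsto:
  assumes "schauder_basis e" shows "(\<lambda>n. bproj e n x) \<longlonglongrightarrow> x"
  using coord_sums[OF assms, of x] unfolding sums_def bproj_def .

lemma coord_linear:
  assumes b: "schauder_basis e"
  shows "coord e i (x + y) = coord e i x + coord e i y" "coord e i (c *\<^sub>R x) = c * coord e i x"
proof -
  have "(\<lambda>i. (coord e i x + coord e i y) *\<^sub>R e i) sums (x + y)"
    using sums_add[OF coord_sums[OF b, of x] coord_sums[OF b, of y]] by (simp add: scaleR_left_distrib)
  then show "coord e i (x + y) = coord e i x + coord e i y" by (rule coord_unique[OF b])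
  have "(\<lambda>i. (c * coord e i x) *\<^sub>R e i) sums (c *\<^sub>R x)"
    using bounded_linear.sums[OF bounded_linear_scaleR_right coord_sums[OF b, of x], of c] by simp
  then show "coord e i (c *\<^sub>R x) = c * coord e i x" by (rule coord_unique[OF b])
qed

lemma bproj_linear:
  assumes b: "schauder_basis e" shows "linear (bproj e n)"
  by (rule linearI) (simp_all add: bproj_def coord_linear[OF b] scaleR_left_distrib sum.distrib scaleR_sum_right)

lemma coord_basis:
  assumes b: "schauder_basis e"
  shows "coord e i (e j) = (if i = j then 1 else 0)"
proof -
  have "(\<lambda>i. (if i = j then 1 else 0) *\<^sub>R e i) sums (\<Sum>i\<in>{j}. (if i = j then 1 else 0) *\<^sub>R e i)"
    by (rule sums_finite) auto
  then show ?thesis using coord_unique[OF b, of "\<lambda>i. if i = j then 1 else 0" "e j"] by simp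
qed

lemma basis_nonzero:
  assumes b: "schauder_basis e" shows "e i \<noteq> 0"
  using coord_basis[OF b, of i i] coord_linear(2)[OF b, of i 0 0] by auto

text \<open>Continuity of the single projections is not yet known, so uniform boundedness does not
  apply directly. Baire's theorem yields an approximate statement: every \<open>y\<close> is within
  half its norm of some \<open>u\<close> with all projections bounded by a multiple of
  \<open>norm y\<close>. Iterating writes \<open>x\<close> as a series of such \<open>u\<close>, and
  uniqueness of coefficients identifies the summed projections with those of
  \<open>x\<close>.\<close>

theorem bproj_uniformly_bounded:
  fixes e :: "nat \<Rightarrow> 'a::banach"
  assumes b: "schauder_basis e"
  obtains C where "0 < C" "\<And>n x. norm (bproj e n x) \<le> C * norm x"
proof -
  define A where "A = (\<lambda>m::nat. {x. \<forall>n. norm (bproj e n x) \<le> real m})"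
  have cover: "\<exists>m. x \<in> A m" for x
  proof -
    obtain K where "\<And>n. norm (bproj e n x) \<le> K"
      using convergent_imp_Bseq[of "\<lambda>n. bproj e n x"] bproj_tendsto[OF b, of x]
      unfolding convergent_def Bseq_def by blast
    moreover obtain m where "K \<le> real m" using real_arch_simple by blast
    ultimately show ?thesis unfolding A_def by (blast intro: order_trans)
  qed
  \<comment> \<open>The sets \<open>A m\<close> are not known to be closed at this point, hence the
    closures.\<close>
  have "\<exists>m. interior (closure (A m)) \<noteq> {}"
  proof (rule ccontr)
    assume "\<not> (\<exists>m. interior (closure (A m)) \<noteq> {})"
    then have "euclidean interior_of \<Union>(range (\<lambda>m. closure (A m))) = {}"
      by (intro Baire_category_alt) (auto simp: completely_metrizable_space_euclidean)
    moreover have "\<Union>(range (\<lambda>m. closure (A m))) = UNIV"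
      using cover closure_subset by (force intro!: UNIV_eq_I)
    ultimately show False by simp
  qed
  then obtain m x0 where "x0 \<in> interior (closure (A m))" by blast
  then obtain r where r: "0 < r" "cball x0 r \<subseteq> closure (A m)" by (auto simp: mem_interior_cball)
  \<comment> \<open>With \<open>v\<close> and \<open>w\<close> from \<open>A m\<close> close to
    \<open>x0 + s *\<^sub>R y\<close> and \<open>x0\<close>, the vector \<open>(v - w) / s\<close>
    has projections bounded by \<open>2 * m / s\<close>, where
    \<open>s = r / norm y\<close>.\<close>
  define B where "B = 2 * real m / r"
  have B: "0 \<le> B" using r by (simp add: B_def)
  note lin = bproj_linear[OF b]
  have approx: "\<exists>u. norm (y - u) \<le> norm y / 2 \<and> (\<forall>n. norm (bproj e n u) \<le> B * norm y)" for y
  proof (cases "y = 0")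
    case True
    then show ?thesis using linear_0[OF lin] by (intro exI[of _ 0]) simp
  next
    case False
    define s where "s = r / norm y"
    have s: "0 < s" using False r by (simp add: s_def)
    have "norm (s *\<^sub>R y) = r" using False r by (simp add: s_def)
    then have "x0 + s *\<^sub>R y \<in> closure (A m)" "x0 \<in> closure (A m)" using r by (auto simp: dist_norm)
    moreover have "0 < r / 4" using r by simp
    ultimately obtain v w where v: "v \<in> A m" "dist v (x0 + s *\<^sub>R y) < r / 4" and w: "w \<in> A m" "dist w x0 < r / 4"
      unfolding closure_approachable by blast
    define u where "u = inverse s *\<^sub>R (v - w)"
    have "s *\<^sub>R (y - u) = (x0 + s *\<^sub>R y - v) + (w - x0)" using s by (simp add: u_def algebra_simps)
    then have "s * norm (y - u) \<le> norm (x0 + s *\<^sub>R y - v) + norm (w - x0)"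
      using s norm_triangle_ineq[of "x0 + s *\<^sub>R y - v" "w - x0"] norm_scaleR[of s "y - u"] by simp
    also have "\<dots> \<le> r / 2" using v(2) w(2) by (simp add: dist_norm norm_minus_commute)
    also have "\<dots> = s * (norm y / 2)" using False by (simp add: s_def)
    finally have 1: "norm (y - u) \<le> norm y / 2" using s by simp
    have 2: "norm (bproj e n u) \<le> B * norm y" for n
    proof -
      have "norm (bproj e n u) = inverse s * norm (bproj e n v - bproj e n w)"
        using s by (simp add: u_def linear_scale[OF lin] linear_diff[OF lin])
      also have "\<dots> \<le> inverse s * (real m + real m)"
        using v(1) w(1) s by (intro mult_left_mono order_trans[OF norm_triangle_ineq4] add_mono) (auto simp: A_def)
      also have "\<dots> = B * norm y" using False r by (simp add: B_def s_def field_simps)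
      finally show ?thesis .
    qed
    from 1 2 show ?thesis by blast
  qed
  then obtain U where U: "\<And>y. norm (y - U y) \<le> norm y / 2" "\<And>y n. norm (bproj e n (U y)) \<le> B * norm y" by metis
  have "norm (bproj e n x) \<le> (2 * B + 1) * norm x" for n x
  proof -
    define y where "y = (\<lambda>k. ((\<lambda>z. z - U z) ^^ k) x)"
    define u where "u = (\<lambda>k. U (y k))"
    have ySuc: "y (Suc k) = y k - u k" for k by (simp add: y_def u_def)
    have ynorm: "norm (y k) \<le> norm x * (1/2) ^ k" for k
    proof (induction k)
      case (Suc k)
      then show ?case using U(1)[of "y k"] unfolding ySuc u_def by simp
    qed (simp add: y_def)
    have unorm: "norm (bproj e n (u k)) \<le> (B * norm x) * (1/2) ^ k" for n k
      using U(2)[of n "y k"] mult_left_mono[OF ynorm[of k] B] unfolding u_def by (simp add: mult.assoc)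
    have "(\<lambda>k. y k) \<longlonglongrightarrow> 0"
    proof (rule Lim_null_comparison)
      show "\<forall>\<^sub>F k in sequentially. norm (y k) \<le> norm x * (1/2) ^ k" using ynorm by simp
      have "(\<lambda>k. norm x * (1/2) ^ k) \<longlonglongrightarrow> norm x * 0" by (intro tendsto_intros LIMSEQ_power_zero) simp
      then show "(\<lambda>k. norm x * (1/2) ^ k) \<longlonglongrightarrow> 0" by simp
    qed
    have ysum: "(\<Sum>k<K. u k) = x - y K" for K
      by (induction K) (simp_all add: ySuc, simp add: y_def)
    have tail: "norm (y K) \<le> norm x * (1/2) ^ K" for K by (rule ynorm)
    have geo: "summable (\<lambda>k. (B * norm x) * (1/2::real) ^ k)" by (intro summable_mult summable_geometric) simp
    have sumS: "summable (\<lambda>k. bproj e n (u k))" for n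
      by (rule summable_comparison_test'[OF geo, of 0]) (rule unorm)
    define s where "s = (\<lambda>n. \<Sum>k. bproj e n (u k))"
    \<comment> \<open>A coordinate times its basis vector is the difference of two consecutive
      projections, so it inherits their geometric bound.\<close>
    have cs: "summable (\<lambda>k. coord e i (u k))" for i
    proof -
      have "norm (norm (e i) * coord e i (u k)) \<le> 2 * ((B * norm x) * (1/2) ^ k)" for k
      proof -
        have "norm (norm (e i) * coord e i (u k)) = norm (bproj e (Suc i) (u k) - bproj e i (u k))"
          by (simp add: bproj_def abs_mult)
        also have "\<dots> \<le> norm (bproj e (Suc i) (u k)) + norm (bproj e i (u k))" by (rule norm_triangle_ineq4)
        also have "\<dots> \<le> 2 * ((B * norm x) * (1/2) ^ k)" using unorm[of "Suc i" k] unorm[of i k] by simp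
        finally show ?thesis .
      qed
      then have "summable (\<lambda>k. norm (e i) * coord e i (u k))"
        by (intro summable_comparison_test'[OF summable_mult[OF geo, of 2], of 0]) auto
      then show ?thesis using basis_nonzero[OF b, of i] by simp
    qed
    define c where "c = (\<lambda>i. \<Sum>k. coord e i (u k))"
    have s_eq: "s n = (\<Sum>i<n. c i *\<^sub>R e i)" for n
    proof -
      have "(\<lambda>k. bproj e n (u k)) sums (\<Sum>i<n. c i *\<^sub>R e i)"
        unfolding bproj_def c_def
        by (intro sums_sum bounded_linear.sums[OF bounded_linear_scaleR_left] summable_sums cs)
      then show ?thesis unfolding s_def by (rule sums_unique[symmetric])
    qed
    \<comment> \<open>An interchange of limits: the tails of the series are cut at \<open>K\<close>
      uniformly in \<open>n\<close>, after which \<open>n\<close> tends to infinity in a finite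
      sum.\<close>
    have "s \<longlonglongrightarrow> x"
    proof (rule LIMSEQ_I)
      fix \<epsilon> :: real assume \<epsilon>: "0 < \<epsilon>"
      have "(\<lambda>K. (2 * B * norm x + norm x) * (1/2) ^ K) \<longlonglongrightarrow> (2 * B * norm x + norm x) * 0"
        by (intro tendsto_intros LIMSEQ_power_zero) simp
      then have "\<forall>\<^sub>F K in sequentially. (2 * B * norm x + norm x) * (1/2) ^ K < \<epsilon> / 2"
        using \<epsilon> by (intro order_tendstoD(2)) auto
      then obtain K where K: "(2 * B * norm x + norm x) * (1/2) ^ K < \<epsilon> / 2"
        unfolding eventually_sequentially by blast
      have tailsum: "norm (s n - (\<Sum>k<K. bproj e n (u k))) \<le> 2 * B * norm x * (1/2) ^ K" for n
      proof -
        have "s n - (\<Sum>k<K. bproj e n (u k)) = (\<Sum>k. bproj e n (u (k + K)))"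
          unfolding s_def using suminf_split_initial_segment[OF sumS, of n K] by simp
        also have "norm \<dots> \<le> (\<Sum>k. (B * norm x * (1/2) ^ K) * (1/2) ^ k)"
        proof (rule norm_suminf_le)
          show "summable (\<lambda>k. (B * norm x * (1/2) ^ K) * (1/2::real) ^ k)" by (intro summable_mult summable_geometric) simp
          show "norm (bproj e n (u (k + K))) \<le> (B * norm x * (1/2) ^ K) * (1/2) ^ k" for k
            using unorm[of n "k + K"] by (simp add: power_add mult_ac)
        qed
        also have "\<dots> = (B * norm x * (1/2) ^ K) * 2"
          using suminf_mult[of "\<lambda>k. (1/2::real) ^ k"] suminf_geometric[of "1/2::real"] by (simp add: summable_geometric)
        finally show ?thesis by (simp add: mult_ac)
      qed
      have "(\<lambda>n. \<Sum>k<K. bproj e n (u k)) \<longlonglongrightarrow> (\<Sum>k<K. u k)"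
        by (intro tendsto_sum bproj_tendsto[OF b])
      then obtain N where N: "\<And>n. n \<ge> N \<Longrightarrow> norm ((\<Sum>k<K. bproj e n (u k)) - (\<Sum>k<K. u k)) < \<epsilon> / 2"
        using LIMSEQ_D[OF _ half_gt_zero[OF \<epsilon>]] by blast
      have "norm (s n - x) < \<epsilon>" if n: "n \<ge> N" for n
      proof -
        have "s n - x = (s n - (\<Sum>k<K. bproj e n (u k))) + ((\<Sum>k<K. bproj e n (u k)) - (\<Sum>k<K. u k)) + - y K"
          by (simp add: ysum)
        also have "norm \<dots> \<le> norm (s n - (\<Sum>k<K. bproj e n (u k))) + norm ((\<Sum>k<K. bproj e n (u k)) - (\<Sum>k<K. u k)) + norm (y K)"
          by (intro order_trans[OF norm_triangle_ineq] add_mono) auto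
        also have "\<dots> < 2 * B * norm x * (1/2) ^ K + \<epsilon> / 2 + norm x * (1/2) ^ K"
          using tailsum[of n] N[OF n] tail[of K] by linarith
        also have "\<dots> \<le> \<epsilon>" using K by (simp add: algebra_simps)
        finally show ?thesis .
      qed
      then show "\<exists>N. \<forall>n\<ge>N. norm (s n - x) < \<epsilon>" by blast
    qed
    then have "(\<lambda>i. c i *\<^sub>R e i) sums x" unfolding sums_def s_eq[abs_def] .
    then have "coord e i x = c i" for i by (rule coord_unique[OF b])
    then have "bproj e n x = s n" by (simp add: bproj_def s_eq)
    also have "norm (s n) \<le> (\<Sum>k. (B * norm x) * (1/2) ^ k)"
      unfolding s_def by (rule norm_suminf_le[OF unorm geo])
    also have "\<dots> = (B * norm x) * 2"
      using suminf_mult[of "\<lambda>k. (1/2::real) ^ k"] suminf_geometric[of "1/2::real"] by (simp add: summable_geometric)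
    also have "\<dots> \<le> (2 * B + 1) * norm x" by (simp add: algebra_simps)
    finally show ?thesis .
  qed
  then show thesis using that[of "2 * B + 1"] B by simp
qed

lemma C_seminorm_precomp:
  assumes u: "C_seminorm k u" and T: "bounded_linear T"
  shows "C_seminorm k (\<lambda>x. u (T x))"
proof -
  have s: "seminorm u" using u unfolding C_seminorm_def by blast
  have "open {x. u x \<noteq> 0}"
    by (rule open_seminorm_support[OF s])
  from CK_precomp[OF this T] have "CK n 0 {x. u (T x) \<noteq> 0} (\<lambda>x hs. u (T x))" if "enat n \<le> k" for n
    using u that unfolding C_seminorm_def by (auto simp: vimage_def)
  then show ?thesis unfolding C_seminorm_def using seminorm_precomp[OF s T] by blast
qed

lemma C_seminorm_scale:
  assumes u: "C_seminorm k u" and r: "0 < r"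
  shows "C_seminorm k (\<lambda>x. r * u x)"
proof -
  have s: "seminorm u" using u unfolding C_seminorm_def by blast
  have o: "open {x. u x \<noteq> 0}"
    by (rule open_seminorm_support[OF s])
  have "seminorm (\<lambda>x. r * u x)" by (rule seminorm_scale[OF s less_imp_le[OF r]])
  moreover have "CK n 0 {x. r * u x \<noteq> 0} (\<lambda>x hs. r * u x)" if "enat n \<le> k" for n
  proof -
    have "CK n 0 {x. u x \<noteq> 0} (\<lambda>x hs. u x)" using u that unfolding C_seminorm_def by blast
    from CK_mult[OF o CK_const[OF bounded_multilinear_0] this, of "\<lambda>hs. r"]
    show ?thesis using r by simp
  qed
  ultimately show ?thesis unfolding C_seminorm_def by blast
qed

lemma C_seminorm_renorming:
  assumes "renorming p" "C_smooth_norm k p"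
  shows "C_seminorm k p"
proof -
  have "{x. p x \<noteq> 0} = UNIV - {0}"
    using assms(1) unfolding renorming_def is_norm_def by auto
  then show ?thesis
    using assms(2) renorming_seminorm[OF assms(1)] unfolding C_seminorm_def C_smooth_norm_def
    by (auto intro!: C_smooth_on_imp_CK simp: open_Diff)
qed

lemma C_seminorm_zero: "C_seminorm k (\<lambda>x. 0)"
proof -
  have "CK n 0 {} F" for n F by (rule CK_local) simp
  then show ?thesis unfolding C_seminorm_def seminorm_def by (auto intro!: exI[of _ "0::real"])
qed

lemma C_seminorm_functional:
  assumes f: "bounded_linear f"
  shows "C_seminorm k (\<lambda>x. \<bar>f x\<bar>)"
proof -
  obtain K where K: "\<And>x. norm (f x) \<le> norm x * K" using bounded_linear.bounded[OF f] by blast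
  have lin: "linear f" by (rule bounded_linear.linear[OF f])
  have "seminorm (\<lambda>x. \<bar>f x\<bar>)"
    unfolding seminorm_def
  proof (intro conjI allI exI[of _ K])
    show "\<bar>f (x + y)\<bar> \<le> \<bar>f x\<bar> + \<bar>f y\<bar>" for x y
      unfolding linear_add[OF lin] by (rule abs_triangle_ineq)
    show "\<bar>f x\<bar> \<le> K * norm x" for x using K[of x] by (simp add: mult.commute)
  qed (simp_all add: linear_scale[OF lin] abs_mult)
  moreover have "CK n 0 {x. \<bar>f x\<bar> \<noteq> 0} (\<lambda>x hs. \<bar>f x\<bar>)" for n
  proof (rule CK_local)
    fix x assume x: "x \<in> {x. \<bar>f x\<bar> \<noteq> 0}"
    have c: "continuous_on UNIV f" by (rule linear_continuous_on[OF f])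
    have o: "open {x. 0 < f x}" "open {x. f x < 0}"
      by (intro open_Collect_less continuous_on_const c)+
    have p: "CK n 0 {x. 0 < f x} (\<lambda>x hs. \<bar>f x\<bar>)"
    proof (rule CK_cong[where F = "\<lambda>x hs. f x"])
      show "CK n 0 {x. 0 < f x} (\<lambda>x hs. f x)" by (rule CK_linear[OF f])
    qed (use o in simp_all)
    have m: "CK n 0 {x. f x < 0} (\<lambda>x hs. \<bar>f x\<bar>)"
    proof (rule CK_cong[where F = "\<lambda>x hs. - f x"])
      show "CK n 0 {x. f x < 0} (\<lambda>x hs. - f x)" by (rule CK_linear[OF bounded_linear_minus[OF f]])
    qed (use o in simp_all)
    have "x \<in> {x. 0 < f x} \<or> x \<in> {x. f x < 0}" using x by auto
    then show "\<exists>U. x \<in> U \<and> CK n 0 U (\<lambda>x hs. \<bar>f x\<bar>)"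
    proof
      assume "x \<in> {x. 0 < f x}"
      then show ?thesis by (intro exI[of _ "{x. 0 < f x}"] conjI p)
    next
      assume "x \<in> {x. f x < 0}"
      then show ?thesis by (intro exI[of _ "{x. f x < 0}"] conjI m)
    qed
  qed
  ultimately show ?thesis unfolding C_seminorm_def by simp
qed

lemma coord_bounded:
  fixes e :: "nat \<Rightarrow> 'a::banach"
  assumes b: "schauder_basis e"
  obtains L where "0 \<le> L" "\<And>x. \<bar>coord e i x\<bar> \<le> L * norm x"
proof -
  obtain C where C: "0 < C" "\<And>n x. norm (bproj e n x) \<le> C * norm x"
    by (rule bproj_uniformly_bounded[OF b]) (rule that)
  have "\<bar>coord e i x\<bar> \<le> (2 * C / norm (e i)) * norm x" for x
  proof -
    have "\<bar>coord e i x\<bar> * norm (e i) = norm (bproj e (Suc i) x - bproj e i x)" by (simp add: bproj_def)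
    also have "\<dots> \<le> C * norm x + C * norm x"
      by (rule order_trans[OF norm_triangle_ineq4 add_mono[OF C(2) C(2)]])
    finally have "\<bar>coord e i x\<bar> * norm (e i) \<le> 2 * C * norm x" by simp
    then have "\<bar>coord e i x\<bar> \<le> 2 * C * norm x / norm (e i)"
      using basis_nonzero[OF b, of i] by (subst pos_le_divide_eq) auto
    then show ?thesis by simp
  qed
  moreover have "0 \<le> 2 * C / norm (e i)" using C(1) by simp
  ultimately show thesis by (intro that)
qed

lemma coord_bounded_linear:
  fixes e :: "nat \<Rightarrow> 'a::banach"
  assumes b: "schauder_basis e" shows "bounded_linear (coord e i)"
proof -
  obtain L where L: "0 \<le> L" "\<And>x. \<bar>coord e i x\<bar> \<le> L * norm x" by (rule coord_bounded[OF b, of i]) (rule that)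
  show ?thesis
  proof (rule bounded_linear_intro[where K = L])
    show "norm (coord e i x) \<le> norm x * L" for x using L(2)[of x] by (simp add: mult.commute)
  qed (simp_all add: coord_linear[OF b])
qed

lemma bproj_bounded_linear:
  fixes e :: "nat \<Rightarrow> 'a::banach"
  assumes b: "schauder_basis e" shows "bounded_linear (bproj e n)"
  unfolding bproj_def[abs_def]
  by (intro bounded_linear_sum) (rule bounded_linear_compose[OF bounded_linear_scaleR_left coord_bounded_linear[OF b]])

lemma coord_bproj:
  assumes b: "schauder_basis e"
  shows "coord e i (bproj e n x) = (if i < n then coord e i x else 0)"
proof -
  have "linear (coord e i)" using coord_linear[OF b] by (intro linearI) auto
  then have "coord e i (bproj e n x) = (\<Sum>j<n. coord e j x * coord e i (e j))"
    unfolding bproj_def by (simp add: linear_sum linear_scale)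
  also have "\<dots> = (\<Sum>j<n. if j = i then coord e j x else 0)"
    by (intro sum.cong) (auto simp: coord_basis[OF b])
  also have "\<dots> = (if i < n then coord e i x else 0)" by simp
  finally show ?thesis .
qed

lemma bproj_bproj:
  assumes b: "schauder_basis e" shows "bproj e n (bproj e n x) = bproj e n x"
proof -
  have "bproj e n (bproj e n x) = (\<Sum>i<n. coord e i (bproj e n x) *\<^sub>R e i)" by (rule bproj_def)
  also have "\<dots> = (\<Sum>i<n. coord e i x *\<^sub>R e i)" by (intro sum.cong) (auto simp: coord_bproj[OF b])
  finally show ?thesis unfolding bproj_def[of e n x] .
qed

lemma finite_grid:
  fixes B t :: real assumes "0 < t"
  obtains G where "finite G" "\<And>r. \<bar>r\<bar> \<le> B \<Longrightarrow> \<exists>g\<in>G. \<bar>g - r\<bar> \<le> t"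
proof
  let ?G = "(\<lambda>z. t * real_of_int z) ` {- \<lceil>B / t\<rceil> - 1..\<lceil>B / t\<rceil>}"
  show "finite ?G" by simp
  fix r assume r: "\<bar>r\<bar> \<le> B"
  define z where "z = \<lfloor>r / t\<rfloor>"
  have z: "real_of_int z \<le> r / t" "r / t < real_of_int z + 1" unfolding z_def by linarith+
  have "r / t \<le> B / t" "- (B / t) \<le> r / t" using r assms by (auto simp: field_simps)
  then have "z \<in> {- \<lceil>B / t\<rceil> - 1..\<lceil>B / t\<rceil>}" using z by (simp add: z_def) linarith
  moreover have "\<bar>t * real_of_int z - r\<bar> \<le> t" using z assms by (simp add: field_simps abs_le_iff)
  ultimately show "\<exists>g\<in>?G. \<bar>g - r\<bar> \<le> t" by blast
qed

text \<open>On the range of \<open>bproj e n\<close> a functional is determined by its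
  \<open>n\<close> values at the basis vectors. These lie in bounded intervals and are rounded to
  grids of width \<open>t\<close>, so fine that the errors weighted by the bounds \<open>L i\<close>
  of the coordinates add up to at most \<open>s\<close>.\<close>

lemma finite_net:
  fixes e :: "nat \<Rightarrow> 'a::banach"
  assumes b: "schauder_basis e" and s: "0 < s"
  obtains G :: "('a \<Rightarrow> real) set" where "finite G" "\<And>g. g \<in> G \<Longrightarrow> bounded_linear g"
    "\<And>f. linear f \<Longrightarrow> (\<And>y. \<bar>f y\<bar> \<le> B * norm y) \<Longrightarrow> \<exists>g\<in>G. \<forall>y. \<bar>g y - f (bproj e n y)\<bar> \<le> s * norm y"
proof -
  have "\<exists>L. 0 \<le> L \<and> (\<forall>x. \<bar>coord e i x\<bar> \<le> L * norm x)" for i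
    by (rule coord_bounded[OF b, of i]) blast
  then obtain L where L: "\<And>i. 0 \<le> L i" "\<And>i x. \<bar>coord e i x\<bar> \<le> L i * norm x" by metis
  define t where "t = s / (1 + (\<Sum>i<n. L i))"
  have SL: "0 \<le> (\<Sum>i<n. L i)" using L(1) by (simp add: sum_nonneg)
  have t: "0 < t" using s SL by (simp add: t_def)
  have "\<exists>G. finite G \<and> (\<forall>r. \<bar>r\<bar> \<le> B * norm (e i) \<longrightarrow> (\<exists>g\<in>G. \<bar>g - r\<bar> \<le> t))" for i
    by (rule finite_grid[OF t, of "B * norm (e i)"]) blast
  then obtain H where H: "\<And>i. finite (H i)" "\<And>i r. \<bar>r\<bar> \<le> B * norm (e i) \<Longrightarrow> \<exists>g\<in>H i. \<bar>g - r\<bar> \<le> t" by metis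
  let ?G = "(\<lambda>c y. \<Sum>i<n. c i * coord e i y) ` (PiE {..<n} H)"
  show thesis
  proof (rule that)
    show "finite ?G" using H(1) by (intro finite_imageI finite_PiE) auto
    show "bounded_linear g" if g0: "g \<in> ?G" for g
    proof -
      obtain c where g: "g = (\<lambda>y. \<Sum>i<n. c i * coord e i y)" using g0 by blast
      show ?thesis unfolding g
        by (intro bounded_linear_sum) (rule bounded_linear_compose[OF bounded_linear_mult_right coord_bounded_linear[OF b]])
    qed
    fix f :: "'a \<Rightarrow> real" assume f: "linear f" "\<And>y. \<bar>f y\<bar> \<le> B * norm y"
    have "\<forall>i. \<exists>g. g \<in> H i \<and> \<bar>g - f (e i)\<bar> \<le> t" using H(2)[OF f(2)] by blast
    then obtain c where c: "\<And>i. c i \<in> H i" "\<And>i. \<bar>c i - f (e i)\<bar> \<le> t" by metis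
    have "(\<lambda>y. \<Sum>i<n. c i * coord e i y) \<in> ?G"
      using c(1) by (intro image_eqI[of _ _ "restrict c {..<n}"]) (auto simp: fun_eq_iff)
    moreover have "\<bar>(\<Sum>i<n. c i * coord e i y) - f (bproj e n y)\<bar> \<le> s * norm y" for y
    proof -
      have "f (bproj e n y) = (\<Sum>i<n. f (e i) * coord e i y)"
        unfolding bproj_def by (simp add: linear_sum[OF f(1)] linear_scale[OF f(1)] mult.commute)
      then have "\<bar>(\<Sum>i<n. c i * coord e i y) - f (bproj e n y)\<bar> = \<bar>\<Sum>i<n. (c i - f (e i)) * coord e i y\<bar>"
        by (simp add: sum_subtractf left_diff_distrib)
      also have "\<dots> \<le> (\<Sum>i<n. \<bar>(c i - f (e i)) * coord e i y\<bar>)" by (rule sum_abs)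
      also have "\<dots> \<le> (\<Sum>i<n. t * (L i * norm y))"
        unfolding abs_mult using c(2) L t by (intro sum_mono mult_mono) auto
      also have "\<dots> = (t * (\<Sum>i<n. L i)) * norm y" by (simp add: sum_distrib_left sum_distrib_right mult.assoc)
      also have "\<dots> \<le> s * norm y"
      proof (rule mult_right_mono)
        have "t * (\<Sum>i<n. L i) \<le> t * (1 + (\<Sum>i<n. L i))" using t by simp
        also have "\<dots> = s" using SL by (simp add: t_def)
        finally show "t * (\<Sum>i<n. L i) \<le> s" .
      qed simp
      finally show ?thesis .
    qed
    ultimately show "\<exists>g\<in>?G. \<forall>y. \<bar>g y - f (bproj e n y)\<bar> \<le> s * norm y"
      by (intro bexI[of _ "\<lambda>y. \<Sum>i<n. c i * coord e i y"] allI)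
  qed
qed

section \<open>Uniform approximation by smooth norms\<close>

text \<open>Write \<open>P\<^sub>n\<close> for the basis projections and \<open>T\<^sub>n = id - P\<^sub>n\<close>. The seminorms \<open>\<bar>f\<bar> + \<rho> p \<circ> T\<^sub>n\<close>, with \<open>f\<close> from a
  finite set of functionals that are almost bounded by \<open>\<omega>\<close> on the range of \<open>P\<^sub>n\<close>, tend to at most \<open>\<omega>\<close> pointwise.
  To exceed \<open>\<omega> x\<close>, let \<open>F\<close> support \<open>\<omega>\<close> at \<open>x\<close> and take \<open>f\<close> near \<open>(1 + \<delta>\<^sub>n/2) F\<close> on the range of \<open>P\<^sub>n\<close> and equal to an
  element \<open>a\<close> of a countable dense set of functionals on the range of \<open>T\<^sub>n\<close>: the error \<open>\<parallel>F - a\<parallel> \<parallel>T\<^sub>n x\<parallel>\<close> is absorbed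
  by \<open>\<rho> p (T\<^sub>n x)\<close>, however slowly \<open>T\<^sub>n x\<close> tends to \<open>0\<close>.\<close>

theorem smooth_approximation:
  fixes e :: "nat \<Rightarrow> 'a::banach" and \<omega> p :: "'a \<Rightarrow> real"
  assumes b: "schauder_basis e" and p: "renorming p" "C_smooth_norm k p" and k: "1 \<le> k"
    and sep: "separable_space (euclidean :: 'a topology)" and \<omega>: "renorming \<omega>" and \<epsilon>: "0 < \<epsilon>"
  obtains q where "renorming q" "C_smooth_norm k q" "\<And>x. \<omega> x \<le> q x" "\<And>x. q x \<le> (1 + \<epsilon>) * \<omega> x"
proof -
  have s\<omega>: "seminorm \<omega>" and sp: "seminorm p" using renorming_seminorm \<omega> p by auto
  obtain \<kappa> K where \<kappa>: "0 < \<kappa>" and K: "0 < K" and \<omega>b: "\<And>x. \<kappa> * norm x \<le> \<omega> x" "\<And>x. \<omega> x \<le> K * norm x"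
    using \<omega> unfolding renorming_def by auto
  obtain c1 C1 where c1: "0 < c1" and C1: "0 < C1" and pb: "\<And>x. c1 * norm x \<le> p x" "\<And>x. p x \<le> C1 * norm x"
    using p(1) unfolding renorming_def by auto
  obtain C where C: "0 < C" "\<And>n x. norm (bproj e n x) \<le> C * norm x"
    by (rule bproj_uniformly_bounded[OF b]) (rule that)
  obtain a :: "nat \<Rightarrow> 'a \<Rightarrow>\<^sub>L real" where a: "\<And>f d. 0 < d \<Longrightarrow> \<exists>n. norm (f - a n) < d"
    by (rule separable_dual[OF p k sep]) (rule that)
  define P where "P = bproj e"
  define T where "T = (\<lambda>n x. x - P n x)"
  have Pb: "norm (P n x) \<le> C * norm x" for n x using C(2) by (simp add: P_def)
  have Tb: "norm (T n x) \<le> (1 + C) * norm x" for n x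
    using norm_triangle_ineq4[of x "P n x"] Pb[of n x] by (simp add: T_def algebra_simps)
  have blP: "bounded_linear (P n)" for n unfolding P_def by (rule bproj_bounded_linear[OF b])
  have blT: "bounded_linear (T n)" for n
    unfolding T_def by (intro bounded_linear_sub bounded_linear_ident blP)
  have PP: "P n (P n x) = P n x" for n x unfolding P_def by (rule bproj_bproj[OF b])
  have TP: "T n (P n x) = 0" for n x by (simp add: T_def PP)
  have PT: "P n x + T n x = x" for n x by (simp add: T_def)
  have Plim: "(\<lambda>n. P n x) \<longlonglongrightarrow> x" for x unfolding P_def by (rule bproj_tendsto[OF b])
  have Tlim: "(\<lambda>n. norm (T n x)) \<longlonglongrightarrow> 0" for x
    using tendsto_norm[OF tendsto_diff[OF tendsto_const[of x] Plim[of x]]] by (simp add: T_def)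
  \<comment> \<open>The functional and the tail term may each exceed their target by
    \<open>\<epsilon>' / 4\<close> times \<open>\<omega> x\<close>; \<open>\<rho>\<close> is chosen
    for the latter.\<close>
  define \<epsilon>' where "\<epsilon>' = min \<epsilon> 1"
  have \<epsilon>': "0 < \<epsilon>'" "\<epsilon>' \<le> 1" "\<epsilon>' \<le> \<epsilon>" using \<epsilon> by (auto simp: \<epsilon>'_def)
  define \<rho> where "\<rho> = \<epsilon>' * \<kappa> / (4 * C1 * (1 + C))"
  have \<rho>: "0 < \<rho>" using \<epsilon>' \<kappa> C1 C by (simp add: \<rho>_def)
  have \<rho>T: "\<rho> * p (T n x) \<le> \<epsilon>' / 4 * \<omega> x" for n x
  proof -
    have "p (T n x) \<le> C1 * ((1 + C) * norm x)"
      using pb(2)[of "T n x"] mult_left_mono[OF Tb[of n x], of C1] C1 by linarith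
    then have "\<rho> * p (T n x) \<le> \<rho> * (C1 * ((1 + C) * norm x))" using \<rho> by (intro mult_left_mono) auto
    also have "\<dots> = \<epsilon>' / 4 * (\<kappa> * norm x)"
    proof -
      have "\<epsilon>' * \<kappa> / (4 * C1 * D) * (C1 * (D * norm x)) = \<epsilon>' / 4 * (\<kappa> * norm x)" if "0 < D" for D
        using C1 that by simp
      then show ?thesis using C(1) unfolding \<rho>_def by simp
    qed
    also have "\<dots> \<le> \<epsilon>' / 4 * \<omega> x" using \<omega>b \<epsilon>' by (intro mult_left_mono) auto
    finally show ?thesis .
  qed

  \<comment> \<open>The finite families of functionals\<close>
  define \<delta> where "\<delta> = (\<lambda>n. inverse (real (Suc n)))"
  have \<delta>: "0 < \<delta> n" "\<delta> n \<le> 1" for n by (simp_all add: \<delta>_def divide_simps)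
  have \<delta>lim: "\<delta> \<longlonglongrightarrow> 0" unfolding \<delta>_def by (rule LIMSEQ_inverse_real_of_nat)
  \<comment> \<open>The rounding error is then at most \<open>\<delta> n / 16\<close> times
    \<open>\<omega>\<close>, small against the excess \<open>\<delta> n / 2\<close> built into the
    functionals.\<close>
  define s where "s = (\<lambda>n. \<delta> n * \<kappa> / 16)"
  have s: "0 < s n" for n using \<delta> \<kappa> by (simp add: s_def)
  have "\<exists>G. finite G \<and> (\<forall>g\<in>G. bounded_linear g) \<and> (\<forall>f. linear f \<longrightarrow> (\<forall>y. \<bar>f y\<bar> \<le> 2 * K * norm y) \<longrightarrow>
      (\<exists>g\<in>G. \<forall>y. \<bar>g y - f (P n y)\<bar> \<le> s n * norm y))" for n
  proof (rule finite_net[OF b s, of "2 * K" n n])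
    fix G :: "('a \<Rightarrow> real) set"
    assume "finite G" "\<And>g. g \<in> G \<Longrightarrow> bounded_linear g"
      "\<And>f. linear f \<Longrightarrow> (\<And>y. \<bar>f y\<bar> \<le> 2 * K * norm y) \<Longrightarrow> \<exists>g\<in>G. \<forall>y. \<bar>g y - f (bproj e n y)\<bar> \<le> s n * norm y"
    then show ?thesis by (intro exI[of _ G]) (simp add: P_def)
  qed
  then have "\<exists>G. \<forall>n. finite (G n) \<and> (\<forall>g\<in>G n. bounded_linear g) \<and> (\<forall>f. linear f \<longrightarrow> (\<forall>y. \<bar>f y\<bar> \<le> 2 * K * norm y) \<longrightarrow>
      (\<exists>g\<in>G n. \<forall>y. \<bar>g y - f (P n y)\<bar> \<le> s n * norm y))" by (intro choice allI)
  then obtain G where G0: "\<forall>n. finite (G n) \<and> (\<forall>g\<in>G n. bounded_linear g) \<and> (\<forall>f. linear f \<longrightarrow> (\<forall>y. \<bar>f y\<bar> \<le> 2 * K * norm y) \<longrightarrow>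
      (\<exists>g\<in>G n. \<forall>y. \<bar>g y - f (P n y)\<bar> \<le> s n * norm y))" ..
  have G: "\<And>n. finite (G n)" "\<And>n g. g \<in> G n \<Longrightarrow> bounded_linear g" using G0 by auto
  note net = spec[OF G0, THEN conjunct2, THEN conjunct2, rule_format]
  define Fin where "Fin = (\<lambda>n. {f \<in> (\<lambda>(j, g) y. blinfun_apply (a j) (T n y) + g y) ` ({..n} \<times> G n).
      (\<forall>y. \<bar>f y\<bar> \<le> (1 + \<epsilon>' / 4) * \<omega> y) \<and> (\<forall>y. \<bar>f (P n y)\<bar> \<le> (1 + \<delta> n) * \<omega> (P n y))})"
  have finFin: "finite (Fin n)" for n unfolding Fin_def using G(1) by simp
  have FinD: "bounded_linear f" "\<And>y. \<bar>f y\<bar> \<le> (1 + \<epsilon>' / 4) * \<omega> y" "\<And>y. \<bar>f (P n y)\<bar> \<le> (1 + \<delta> n) * \<omega> (P n y)"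
    if f: "f \<in> Fin n" for f n
  proof -
    obtain j g where jg: "f = (\<lambda>y. blinfun_apply (a j) (T n y) + g y)" "g \<in> G n"
      using f unfolding Fin_def by auto
    show "bounded_linear f" unfolding jg(1)
      by (rule bounded_linear_add[OF bounded_linear_compose[OF blinfun.bounded_linear_right blT] G(2)[OF jg(2)]])
    show "\<And>y. \<bar>f y\<bar> \<le> (1 + \<epsilon>' / 4) * \<omega> y" "\<And>y. \<bar>f (P n y)\<bar> \<le> (1 + \<delta> n) * \<omega> (P n y)"
      using f unfolding Fin_def by auto
  qed
  define I where "I = Sigma UNIV Fin"
  define u where "u = (\<lambda>(n::nat, f::'a \<Rightarrow> real) x. \<bar>f x\<bar>)"
  define v where "v = (\<lambda>(n::nat, f::'a \<Rightarrow> real) x. \<rho> * p (T n x))"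
  \<comment> \<open>Tends to 0 as gluing requires, yet never exceeds \<open>\<epsilon>' / 4\<close>,
    which the factor \<open>1 + \<epsilon>'\<close> can absorb in the end.\<close>
  define \<tau> where "\<tau> = (\<lambda>(n::nat, f::'a \<Rightarrow> real). \<epsilon>' / 4 * \<delta> n)"
  have I_iff: "(n, f) \<in> I \<longleftrightarrow> f \<in> Fin n" for n f by (simp add: I_def)

  \<comment> \<open>Bounds from above, global and asymptotic\<close>
  have upper: "u i x + v i x \<le> (1 + \<epsilon>' / 2) * \<omega> x" if iI: "i \<in> I" for i x
  proof -
    obtain n f where i: "i = (n, f)" "f \<in> Fin n" using iI by (cases i) (auto simp: I_def)
    have "\<bar>f x\<bar> + \<rho> * p (T n x) \<le> (1 + \<epsilon>' / 4) * \<omega> x + \<epsilon>' / 4 * \<omega> x"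
      by (rule add_mono[OF FinD(2)[OF i(2)] \<rho>T])
    then show ?thesis by (simp add: u_def v_def i(1) algebra_simps)
  qed
  have small: "finite {i \<in> I. c < u i x + v i x}" if c: "\<omega> x < c" for c x
  proof -
    have "(\<lambda>n. (1 + \<delta> n) * \<omega> (P n x) + 2 * (K * norm (T n x)) + \<rho> * (C1 * norm (T n x)))
        \<longlonglongrightarrow> (1 + 0) * \<omega> x + 2 * (K * 0) + \<rho> * (C1 * 0)"
      by (intro tendsto_intros \<delta>lim Tlim isCont_tendsto_compose[OF seminorm_isCont[OF s\<omega>] Plim])
    then have "\<forall>\<^sub>F n in sequentially. (1 + \<delta> n) * \<omega> (P n x) + 2 * (K * norm (T n x)) + \<rho> * (C1 * norm (T n x)) < c"
      using c by (intro order_tendstoD(2)) auto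
    then obtain N where N: "\<And>n. n \<ge> N \<Longrightarrow> (1 + \<delta> n) * \<omega> (P n x) + 2 * (K * norm (T n x)) + \<rho> * (C1 * norm (T n x)) < c"
      unfolding eventually_sequentially by blast
    have "{i \<in> I. c < u i x + v i x} \<subseteq> Sigma {..N} Fin"
    proof
      fix i assume "i \<in> {i \<in> I. c < u i x + v i x}"
      then obtain n f where i: "i = (n, f)" "f \<in> Fin n" and lt: "c < \<bar>f x\<bar> + \<rho> * p (T n x)"
        by (cases i) (auto simp: I_iff u_def v_def)
      have "n \<le> N"
      proof (rule ccontr)
        assume "\<not> n \<le> N"
        have "f (P n x + T n x) = f (P n x) + f (T n x)"
          by (rule linear_add[OF bounded_linear.linear[OF FinD(1)[OF i(2)]]])
        then have "\<bar>f x\<bar> \<le> \<bar>f (P n x)\<bar> + \<bar>f (T n x)\<bar>" unfolding PT by linarith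
        moreover have "\<bar>f (T n x)\<bar> \<le> 2 * (K * norm (T n x))"
        proof -
          have "\<bar>f (T n x)\<bar> \<le> (1 + \<epsilon>' / 4) * \<omega> (T n x)" by (rule FinD(2)[OF i(2)])
          also have "\<dots> \<le> 2 * (K * norm (T n x))"
            using \<epsilon>' \<omega>b seminormD(1)[OF s\<omega>] by (intro mult_mono) auto
          finally show ?thesis .
        qed
        moreover have "\<rho> * p (T n x) \<le> \<rho> * (C1 * norm (T n x))" using pb(2) \<rho> by (intro mult_left_mono) auto
        moreover have "\<bar>f (P n x)\<bar> \<le> (1 + \<delta> n) * \<omega> (P n x)" by (rule FinD(3)[OF i(2)])
        ultimately show False using N[of n] \<open>\<not> n \<le> N\<close> lt by linarith
      qed
      then show "i \<in> Sigma {..N} Fin" using i by simp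
    qed
    moreover have "finite (Sigma {..N} Fin)" using finFin by (intro finite_SigmaI) auto
    ultimately show ?thesis by (rule finite_subset)
  qed

  \<comment> \<open>A member strictly above \<open>\<omega>\<close> at a given nonzero point\<close>
  have large: "\<exists>i\<in>I. \<omega> x < u i x + v i x" if x: "x \<noteq> 0" for x
  proof -
    obtain F :: "'a \<Rightarrow>\<^sub>L real" where F: "\<And>y. \<bar>blinfun_apply F y\<bar> \<le> \<omega> y" "blinfun_apply F x = \<omega> x"
      by (rule support_functional[OF s\<omega>, of x]) (rule that)
    define f where "f = blinfun_apply F"
    have blf: "bounded_linear f" unfolding f_def by (rule blinfun.bounded_linear_right)
    have linf: "linear f" by (rule bounded_linear.linear[OF blf])
    have f: "\<bar>f y\<bar> \<le> \<omega> y" for y using F(1) by (simp add: f_def)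
    have nx: "0 < norm x" using x by simp
    have \<omega>x: "0 < \<omega> x" using mult_pos_pos[OF \<kappa> nx] \<omega>b(1)[of x] by linarith
    \<comment> \<open>The first bound lets \<open>\<rho> * p (T n x)\<close> absorb the error made
      by \<open>a j\<close> on the tail; the second keeps the new functional within the global bound
      \<open>hup\<close>.\<close>
    define \<mu> where "\<mu> = min (\<rho> * c1) (\<epsilon>' * \<kappa> / (16 * (1 + C)))"
    have \<mu>: "0 < \<mu>" using \<rho> c1 \<epsilon>' \<kappa> C by (simp add: \<mu>_def)
    obtain j where j: "norm (F - a j) < \<mu>" using a[OF \<mu>] by blast
    have aj: "\<bar>blinfun_apply (a j) y - f y\<bar> \<le> \<mu> * norm y" for y
    proof -
      have "norm (blinfun_apply (F - a j) y) \<le> norm (F - a j) * norm y" by (rule norm_blinfun)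
      also have "\<dots> \<le> \<mu> * norm y" using j by (intro mult_right_mono) auto
      finally show ?thesis by (simp add: blinfun.diff_left f_def abs_minus_commute)
    qed
    have "(\<lambda>n. f (P n x)) \<longlonglongrightarrow> f x"
      by (rule bounded_linear.tendsto[OF blf Plim])
    then have ev1: "\<forall>\<^sub>F n in sequentially. \<omega> x / 2 < f (P n x)"
      using \<omega>x F(2) by (intro order_tendstoD(1)) (auto simp: f_def)
    \<comment> \<open>For \<open>\<delta> n\<close> below this constant the excess
      \<open>\<delta> n / 2 * f (P n y)\<close> is at most
      \<open>\<epsilon>' / 16 * (\<kappa> * norm y)\<close>.\<close>
    have "0 < \<epsilon>' * \<kappa> / (8 * K * C)" using \<epsilon>' \<kappa> K C by simp
    then have ev2: "\<forall>\<^sub>F n in sequentially. \<delta> n < \<epsilon>' * \<kappa> / (8 * K * C)" by (rule order_tendstoD(2)[OF \<delta>lim])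
    have ev3: "\<forall>\<^sub>F n in sequentially. \<delta> n < \<epsilon>'" by (rule order_tendstoD(2)[OF \<delta>lim \<epsilon>'(1)])
    obtain n where n: "\<omega> x / 2 < f (P n x)" "\<delta> n < \<epsilon>' * \<kappa> / (8 * K * C)" "\<delta> n < \<epsilon>'" "j \<le> n"
      using eventually_happens[OF eventually_conj[OF ev1 eventually_conj[OF ev2 eventually_conj[OF ev3 eventually_ge_at_top[of j]]]]]
      by auto
    have "\<exists>g\<in>G n. \<forall>y. \<bar>g y - (1 + \<delta> n / 2) * f (P n y)\<bar> \<le> s n * norm y"
    proof (rule net)
      show "linear (\<lambda>y. (1 + \<delta> n / 2) * f y)"
        by (intro bounded_linear.linear bounded_linear_compose[OF bounded_linear_mult_right blf])
      fix y
      have "(1 + \<delta> n / 2) * \<bar>f y\<bar> \<le> 2 * (K * norm y)"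
        using \<delta>[of n] order_trans[OF f \<omega>b(2)] by (intro mult_mono) auto
      then show "\<bar>(1 + \<delta> n / 2) * f y\<bar> \<le> 2 * K * norm y" using \<delta>[of n] by (simp add: abs_mult)
    qed
    then obtain g where g: "g \<in> G n" "\<And>y. \<bar>g y - (1 + \<delta> n / 2) * f (P n y)\<bar> \<le> s n * norm y" by blast
    define h where "h = (\<lambda>y. blinfun_apply (a j) (T n y) + g y)"
    have split: "f y = f (P n y) + f (T n y)" for y
      using linear_add[OF linf, of "P n y" "T n y"] unfolding PT .
    have e1: "\<bar>blinfun_apply (a j) (T n y) - f (T n y)\<bar> \<le> \<mu> * norm (T n y)" for y by (rule aj)
    have e2: "\<bar>g y - f (P n y) - \<delta> n / 2 * f (P n y)\<bar> \<le> s n * norm y" for y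
      using g(2)[of y] by (simp add: algebra_simps)
    \<comment> \<open>The tail error, the excess and the rounding error each cost at most
      \<open>\<epsilon>' / 16\<close> times \<open>\<omega> y\<close>, together less than the
      permitted quarter.\<close>
    have hup: "\<bar>h y\<bar> \<le> (1 + \<epsilon>' / 4) * \<omega> y" for y
    proof -
      have "\<mu> * norm (T n y) \<le> \<epsilon>' * \<kappa> / (16 * (1 + C)) * ((1 + C) * norm y)"
        using Tb \<mu> \<epsilon>' \<kappa> C by (intro mult_mono) (auto simp: \<mu>_def)
      also have "\<dots> = \<epsilon>' / 16 * (\<kappa> * norm y)"
      proof -
        have D: "\<epsilon>' * \<kappa> / (16 * D) * (D * norm y) = \<epsilon>' / 16 * (\<kappa> * norm y)" if "0 < D" for D
          using that by simp
        show ?thesis using C(1) by (intro D) simp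
      qed
      finally have b1: "\<mu> * norm (T n y) \<le> \<epsilon>' / 16 * (\<kappa> * norm y)" .
      have "\<bar>\<delta> n / 2 * f (P n y)\<bar> \<le> (\<epsilon>' * \<kappa> / (8 * K * C)) / 2 * (K * (C * norm y))"
        unfolding abs_mult
      proof (rule mult_mono)
        have "\<bar>\<delta> n / 2\<bar> = \<delta> n / 2" using \<delta>(1)[of n] by simp
        also have "\<dots> \<le> \<epsilon>' * \<kappa> / (8 * K * C) / 2"
          using less_imp_le[OF n(2)] by (rule divide_right_mono) simp
        finally show "\<bar>\<delta> n / 2\<bar> \<le> \<epsilon>' * \<kappa> / (8 * K * C) / 2" .
        have "\<bar>f (P n y)\<bar> \<le> K * norm (P n y)" by (rule order_trans[OF f \<omega>b(2)])
        also have "\<dots> \<le> K * (C * norm y)" using Pb K by (intro mult_left_mono) auto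
        finally show "\<bar>f (P n y)\<bar> \<le> K * (C * norm y)" .
      qed (use \<epsilon>' \<kappa> K C in auto)
      also have "\<dots> = \<epsilon>' / 16 * (\<kappa> * norm y)" using K C by (simp add: field_simps)
      finally have b2: "\<bar>\<delta> n / 2 * f (P n y)\<bar> \<le> \<epsilon>' / 16 * (\<kappa> * norm y)" .
      have "s n * norm y \<le> (\<epsilon>' * \<kappa> / 16) * norm y"
        using n(3) \<kappa> unfolding s_def by (intro mult_right_mono divide_right_mono) auto
      then have b3: "s n * norm y \<le> \<epsilon>' / 16 * (\<kappa> * norm y)" by simp
      have "\<bar>h y\<bar> \<le> \<bar>f y\<bar> + 3 * (\<epsilon>' / 16 * (\<kappa> * norm y))"
        using e1[of y] e2[of y] b1 b2 b3 split[of y] unfolding h_def by linarith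
      also have "\<dots> \<le> \<omega> y + 3 * (\<epsilon>' / 16 * \<omega> y)"
        using f[of y] \<omega>b(1)[of y] \<epsilon>' by (intro add_mono mult_left_mono) auto
      also have "\<dots> \<le> (1 + \<epsilon>' / 4) * \<omega> y"
        using mult_nonneg_nonneg[OF less_imp_le[OF \<epsilon>'(1)] seminormD(1)[OF s\<omega>, of y]] by (simp add: algebra_simps)
      finally show ?thesis .
    qed
    have hP: "\<bar>h (P n y)\<bar> \<le> (1 + \<delta> n) * \<omega> (P n y)" for y
    proof -
      have "h (P n y) = g (P n y)" by (simp add: h_def TP)
      then have "\<bar>h (P n y)\<bar> \<le> \<bar>f (P n y)\<bar> + \<bar>\<delta> n / 2 * f (P n y)\<bar> + s n * norm (P n y)"
        using e2[of "P n y"] unfolding PP by linarith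
      also have "\<dots> \<le> \<omega> (P n y) + \<delta> n / 2 * \<omega> (P n y) + \<delta> n / 16 * \<omega> (P n y)"
      proof (intro add_mono f)
        show "\<bar>\<delta> n / 2 * f (P n y)\<bar> \<le> \<delta> n / 2 * \<omega> (P n y)"
          unfolding abs_mult using \<delta>[of n] f by (intro mult_mono) auto
        show "s n * norm (P n y) \<le> \<delta> n / 16 * \<omega> (P n y)"
          using mult_left_mono[OF \<omega>b(1)[of "P n y"], of "\<delta> n / 16"] \<delta>[of n] by (simp add: s_def mult_ac)
      qed
      also have "\<dots> \<le> (1 + \<delta> n) * \<omega> (P n y)"
        using mult_nonneg_nonneg[OF less_imp_le[OF \<delta>(1)[of n]] seminormD(1)[OF s\<omega>, of "P n y"]] by (simp add: algebra_simps)
      finally show ?thesis .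
    qed
    have "h \<in> (\<lambda>(j, g) y. blinfun_apply (a j) (T n y) + g y) ` ({..n} \<times> G n)"
      using n(4) g(1) unfolding h_def by (intro image_eqI[of _ _ "(j, g)"]) auto
    then have "h \<in> Fin n" unfolding Fin_def using hup hP by blast
    moreover have "\<omega> x < \<bar>h x\<bar> + \<rho> * p (T n x)"
    proof -
      have "\<mu> * norm (T n x) \<le> \<rho> * c1 * norm (T n x)" by (intro mult_right_mono) (auto simp: \<mu>_def)
      also have "\<dots> \<le> \<rho> * p (T n x)" using mult_left_mono[OF pb(1)[of "T n x"], of \<rho>] \<rho> by (simp add: mult.assoc)
      finally have t1: "\<mu> * norm (T n x) \<le> \<rho> * p (T n x)" .
      have "\<delta> n / 2 * (\<omega> x / 2) \<le> \<delta> n / 2 * f (P n x)" using n(1) \<delta>[of n] by (intro mult_left_mono) auto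
      moreover have "s n * norm x \<le> \<delta> n / 16 * \<omega> x"
        using mult_left_mono[OF \<omega>b(1)[of x], of "\<delta> n / 16"] \<delta>[of n] by (simp add: s_def mult_ac)
      moreover have "\<delta> n / 16 * \<omega> x < \<delta> n / 2 * (\<omega> x / 2)" using \<delta>[of n] \<omega>x by simp
      ultimately have t2: "s n * norm x < \<delta> n / 2 * f (P n x)" by linarith
      have "f x = \<omega> x" using F(2) by (simp add: f_def)
      then show ?thesis using t1 t2 e1[of x] e2[of x] split[of x] unfolding h_def by linarith
    qed
    ultimately show ?thesis by (intro bexI[of _ "(n, h)"]) (auto simp: I_iff u_def v_def)
  qed

  \<comment> \<open>Gluing the seminorms\<close>
  have Cu: "C_seminorm k (u i)" if "i \<in> I" for i
    using that FinD(1) C_seminorm_functional by (cases i) (auto simp: I_iff u_def)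
  have Cv: "C_seminorm k (v i)" if "i \<in> I" for i
    unfolding v_def
    by (cases i) (auto intro!: C_seminorm_scale[OF C_seminorm_precomp[OF C_seminorm_renorming[OF p] blT] \<rho>])
  have \<tau>: "0 < \<tau> i" "\<tau> i \<le> \<epsilon>' / 4" for i
    using \<epsilon>' \<delta>[of "fst i"] by (auto simp: \<tau>_def split: prod.split)
  obtain q where q: "renorming q" "C_smooth_norm k q" "\<And>i x. i \<in> I \<Longrightarrow> u i x + v i x \<le> q x"
    "\<And>b x. 0 < b \<Longrightarrow> (\<And>i. i \<in> I \<Longrightarrow> u i x + v i x \<le> (1 - \<tau> i) * b) \<Longrightarrow> q x \<le> b"
  proof (rule smooth_gluing[where I = I and u = u and v = v and L = "2 * K" and \<kappa> = \<kappa> and \<tau> = \<tau> and k = k])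
    show "u i x + v i x \<le> 2 * K * norm x" if "i \<in> I" for i x
    proof -
      have "u i x + v i x \<le> (1 + \<epsilon>' / 2) * \<omega> x" by (rule upper[OF that])
      also have "\<dots> \<le> 2 * (K * norm x)" using \<epsilon>' \<omega>b(2)[of x] seminormD(1)[OF s\<omega>] by (intro mult_mono) auto
      finally show ?thesis by simp
    qed
    show "finite {i \<in> I. c < \<tau> i}" if c: "0 < c" for c
    proof -
      have "\<forall>\<^sub>F n in sequentially. \<delta> n < c" by (rule order_tendstoD(2)[OF \<delta>lim c])
      then obtain N where N: "\<And>n. n \<ge> N \<Longrightarrow> \<delta> n < c" unfolding eventually_sequentially by blast
      have "{i \<in> I. c < \<tau> i} \<subseteq> Sigma {..N} Fin"
      proof
        fix i assume i: "i \<in> {i \<in> I. c < \<tau> i}"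
        then obtain n f where nf: "i = (n, f)" "f \<in> Fin n" "c < \<epsilon>' / 4 * \<delta> n" by (cases i) (auto simp: I_iff \<tau>_def)
        have "\<epsilon>' / 4 * \<delta> n \<le> 1 * \<delta> n" using \<epsilon>' \<delta>[of n] by (intro mult_right_mono) auto
        then have "n \<le> N" using N[of n] nf(3) by (cases "n \<le> N") auto
        then show "i \<in> Sigma {..N} Fin" using nf by simp
      qed
      moreover have "finite (Sigma {..N} Fin)" using finFin by (intro finite_SigmaI) auto
      ultimately show ?thesis by (rule finite_subset)
    qed
    show "\<exists>i\<in>I. \<exists>c. c < u i x + v i x \<and> \<kappa> * norm x \<le> u i x + v i x \<and> finite {j \<in> I. c < u j x + v j x}"
      if x: "x \<noteq> 0" for x
    proof -
      obtain i where i: "i \<in> I" "\<omega> x < u i x + v i x" using large[OF x] by blast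
      define c where "c = (\<omega> x + (u i x + v i x)) / 2"
      have "\<omega> x < c" "c < u i x + v i x" using i(2) by (auto simp: c_def)
      then show ?thesis using i \<omega>b(1)[of x] small[of x c] by (intro bexI[of _ i] exI[of _ c] conjI) auto
    qed
    show "\<tau> i \<le> 1 / 2" if "i \<in> I" for i using \<tau>(2)[of i] \<epsilon>' by simp
    fix q assume "renorming q" "C_smooth_norm k q" "\<And>i x. i \<in> I \<Longrightarrow> u i x + v i x \<le> q x"
      "\<And>b x. 0 < b \<Longrightarrow> (\<And>i. i \<in> I \<Longrightarrow> u i x + v i x \<le> (1 - \<tau> i) * b) \<Longrightarrow> q x \<le> b"
    then show thesis by (rule that)
  qed (use k Cu Cv K \<kappa> \<tau> in simp_all)
  have sq: "seminorm q" by (rule renorming_seminorm[OF q(1)])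
  show thesis
  proof (rule that[OF q(1,2)])
    show "\<omega> x \<le> q x" for x
    proof (cases "x = 0")
      case True
      then show ?thesis using seminormD(4)[OF sq] seminormD(4)[OF s\<omega>] by simp
    next
      case False
      obtain i where "i \<in> I" "\<omega> x < u i x + v i x" using large[OF False] by blast
      then show ?thesis using q(3)[of i x] by simp
    qed
    show "q x \<le> (1 + \<epsilon>) * \<omega> x" for x
    proof (cases "x = 0")
      case True
      then show ?thesis using seminormD(4)[OF sq] seminormD(4)[OF s\<omega>] by simp
    next
      case False
      have \<omega>x: "0 < \<omega> x" using mult_pos_pos[OF \<kappa>, of "norm x"] False \<omega>b(1)[of x] by simp
      have "q x \<le> (1 + \<epsilon>') * \<omega> x"
      proof (rule q(4))
        show "0 < (1 + \<epsilon>') * \<omega> x" using \<omega>x \<epsilon>' by simp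
        fix i assume i: "i \<in> I"
        \<comment> \<open>The right side is
          \<open>1 + 3 / 4 * \<epsilon>' - \<epsilon>'\<^sup>2 / 4\<close>, which suffices because
          \<open>\<epsilon>' \<le> 1\<close>.\<close>
        have "1 + \<epsilon>' / 2 \<le> (1 - \<epsilon>' / 4) * (1 + \<epsilon>')"
        proof -
          have "\<epsilon>' * \<epsilon>' \<le> \<epsilon>' * 1" using \<epsilon>' by (intro mult_left_mono) auto
          moreover have "(1 - \<epsilon>' / 4) * (1 + \<epsilon>') = 1 + 3 / 4 * \<epsilon>' - \<epsilon>' * \<epsilon>' / 4" by (simp add: field_simps)
          ultimately show ?thesis by linarith
        qed
        also have "\<dots> \<le> (1 - \<tau> i) * (1 + \<epsilon>')" using \<tau>(2)[of i] \<epsilon>' by (intro mult_right_mono) auto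
        finally have "(1 + \<epsilon>' / 2) * \<omega> x \<le> ((1 - \<tau> i) * (1 + \<epsilon>')) * \<omega> x"
          using \<omega>x by (intro mult_right_mono) auto
        then show "u i x + v i x \<le> (1 - \<tau> i) * ((1 + \<epsilon>') * \<omega> x)"
          using upper[OF i, of x] by (simp add: mult.assoc)
      qed
      also have "\<dots> \<le> (1 + \<epsilon>) * \<omega> x" using \<epsilon>' \<omega>x by (intro mult_right_mono) auto
      finally show ?thesis .
    qed
  qed
qed

section \<open>Approximation improving on the tails\<close>

text \<open>Infimal convolution over the splittings \<open>x = Q z + (x - Q z)\<close>, indexed by
  \<open>z\<close> so that the range of \<open>Q\<close> need not be handled as a space. The choice
  \<open>z = 0\<close> bounds it by \<open>B\<close>.\<close>

lemma inf_convolution_seminorm: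
  fixes A B :: "'a::real_normed_vector \<Rightarrow> real"
  assumes A: "seminorm A" and B: "seminorm B" and Q: "linear Q"
  defines "W \<equiv> \<lambda>x. INF z. A z + B (x - Q z)"
  shows "seminorm W" "W x \<le> A z + B (x - Q z)" "(\<And>z. c \<le> A z + B (x - Q z)) \<Longrightarrow> c \<le> W x"
proof -
  have nn: "0 \<le> A z + B (x - Q z)" for x z using seminormD(1)[OF A] seminormD(1)[OF B] by simp
  have bdd: "bdd_below (range (\<lambda>z. A z + B (x - Q z)))" for x
    using nn by (intro bdd_belowI[of _ 0]) auto
  show le: "W x \<le> A z + B (x - Q z)" for x z unfolding W_def by (rule cINF_lower[OF bdd]) simp
  show ge: "c \<le> W x" if "\<And>z. c \<le> A z + B (x - Q z)" for c x
    unfolding W_def using that by (intro cINF_greatest) auto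
  have tri: "W (x + y) \<le> W x + W y" for x y
  proof -
    have "W (x + y) - (A z' + B (y - Q z')) \<le> W x" for z'
    proof (rule ge)
      fix z
      have "W (x + y) \<le> A (z + z') + B ((x + y) - Q (z + z'))" by (rule le)
      also have "(x + y) - Q (z + z') = (x - Q z) + (y - Q z')" by (simp add: linear_add[OF Q])
      also have "A (z + z') + B ((x - Q z) + (y - Q z')) \<le> (A z + A z') + (B (x - Q z) + B (y - Q z'))"
        by (intro add_mono seminormD(3)[OF A] seminormD(3)[OF B])
      finally show "W (x + y) - (A z' + B (y - Q z')) \<le> A z + B (x - Q z)" by simp
    qed
    then have "W (x + y) - W x \<le> W y" by (intro ge) (simp add: algebra_simps)
    then show ?thesis by simp
  qed
  have hom: "W (a *\<^sub>R x) \<le> \<bar>a\<bar> * W x" if a: "a \<noteq> 0" for a x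
  proof -
    have "W (a *\<^sub>R x) / \<bar>a\<bar> \<le> W x"
    proof (rule ge)
      fix z
      have "W (a *\<^sub>R x) \<le> A (a *\<^sub>R z) + B (a *\<^sub>R x - Q (a *\<^sub>R z))" by (rule le)
      also have "a *\<^sub>R x - Q (a *\<^sub>R z) = a *\<^sub>R (x - Q z)" by (simp add: linear_scale[OF Q] scaleR_diff_right)
      also have "A (a *\<^sub>R z) + B (a *\<^sub>R (x - Q z)) = (A z + B (x - Q z)) * \<bar>a\<bar>"
        unfolding seminormD(2)[OF A] seminormD(2)[OF B] by (simp add: algebra_simps)
      finally show "W (a *\<^sub>R x) / \<bar>a\<bar> \<le> A z + B (x - Q z)" using a by (subst pos_divide_le_eq) auto
    qed
    then show ?thesis using a by (simp add: pos_divide_le_eq mult.commute)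
  qed
  have W0: "W 0 = 0"
    using le[of 0 0] ge[of 0 0, OF nn] seminormD(4)[OF A] seminormD(4)[OF B] linear_0[OF Q] by simp
  have "W (a *\<^sub>R x) = \<bar>a\<bar> * W x" for a x
  proof (cases "a = 0")
    case False
    have "W (inverse a *\<^sub>R (a *\<^sub>R x)) \<le> \<bar>inverse a\<bar> * W (a *\<^sub>R x)" by (rule hom) (use False in simp)
    then have "W x \<le> W (a *\<^sub>R x) / \<bar>a\<bar>" using False by (simp add: divide_inverse mult.commute)
    then have "\<bar>a\<bar> * W x \<le> W (a *\<^sub>R x)" using False by (subst (asm) pos_le_divide_eq) (auto simp: mult.commute)
    then show ?thesis using hom[OF False, of x] by simp
  qed (simp add: W0)
  moreover obtain K where K: "\<And>x. B x \<le> K * norm x" using B unfolding seminorm_def by auto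
  have "W x \<le> K * norm x" for x
    using le[of x 0] K[of x] seminormD(4)[OF A] linear_0[OF Q] by simp
  ultimately show "seminorm W"
    unfolding seminorm_def using ge[of 0, OF nn] tri by (intro conjI exI[of _ K] allI) auto
qed

lemma coord_tail_space:
  fixes e :: "nat \<Rightarrow> 'a::banach"
  assumes b: "schauder_basis e" and x: "x \<in> tail_space e N" and i: "i < N"
  shows "coord e i x = 0"
proof -
  have bl: "bounded_linear (coord e i)" by (rule coord_bounded_linear[OF b])
  have "closed {x. coord e i x = 0}"
    by (intro closed_Collect_eq continuous_on_const linear_continuous_on bl)
  moreover have "span (e ` {N..}) \<subseteq> {x. coord e i x = 0}"
  proof (rule span_minimal)
    show "e ` {N..} \<subseteq> {x. coord e i x = 0}" using i by (auto simp: coord_basis[OF b])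
    show "subspace {x. coord e i x = 0}"
      using linear_0[OF bounded_linear.linear[OF bl]] by (intro subspaceI) (auto simp: coord_linear[OF b])
  qed
  ultimately have "closure (span (e ` {N..})) \<subseteq> {x. coord e i x = 0}" by (intro closure_minimal)
  then show ?thesis using x unfolding tail_space_def by auto
qed

text \<open>On the \<open>N\<close>-th tail space the coordinates below \<open>N\<close> vanish, and
  for \<open>i \<ge> N\<close> the weight contains the minimum of
  \<open>\<epsilon> 0, ..., \<epsilon> i\<close>, which is at most \<open>\<epsilon> N\<close>. The
  remaining factors make the series geometric with sum at most
  \<open>\<epsilon> N * norm x\<close>.\<close>

lemma tail_decreasing_seminorm:
  fixes e :: "nat \<Rightarrow> 'a::banach" and \<epsilon> :: "nat \<Rightarrow> real"
  assumes b: "schauder_basis e" and \<epsilon>: "\<And>N. 0 < \<epsilon> N"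
  obtains r where "seminorm r" "\<And>x. x \<noteq> 0 \<Longrightarrow> 0 < r x" "\<And>N x. x \<in> tail_space e N \<Longrightarrow> r x \<le> \<epsilon> N * norm x"
    "\<And>x. r x \<le> \<epsilon> 0 * norm x"
proof -
  have "\<exists>L. 0 \<le> L \<and> (\<forall>x. \<bar>coord e i x\<bar> \<le> L * norm x)" for i
    by (rule coord_bounded[OF b, of i]) blast
  then obtain L where L: "\<And>i. 0 \<le> L i" "\<And>i x. \<bar>coord e i x\<bar> \<le> L i * norm x" by metis
  define m where "m = (\<lambda>i. Min (\<epsilon> ` {..i}))"
  have m: "0 < m i" for i unfolding m_def using \<epsilon> by (subst Min_gr_iff) auto
  have m_le: "m i \<le> \<epsilon> N" if "N \<le> i" for i N unfolding m_def using that by (intro Min_le) auto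
  define c where "c = (\<lambda>i. m i * (1/2) ^ Suc i / (L i + 1))"
  have c: "0 < c i" for i using m[of i] L(1)[of i] by (simp add: c_def)
  define a where "a = (\<lambda>i x. c i * \<bar>coord e i x\<bar>)"
  have a0: "0 \<le> a i x" for i x using c[of i] by (simp add: a_def)
  have a_le: "a i x \<le> (\<epsilon> N * norm x) * (1/2) ^ Suc i" if "N \<le> i" for i x N
  proof -
    have "\<bar>coord e i x\<bar> \<le> (L i + 1) * norm x" using L(2)[of i x] by (simp add: distrib_right add_increasing2)
    then have le: "a i x \<le> c i * ((L i + 1) * norm x)" unfolding a_def using c[of i] by (intro mult_left_mono) auto
    have "L i + 1 \<noteq> 0" using L(1)[of i] by linarith
    then have "c i * (L i + 1) = m i * (1/2) ^ Suc i"
      unfolding c_def by (rule nonzero_eq_divide_eq[THEN iffD1, OF _ refl])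
    then have "c i * ((L i + 1) * norm x) = m i * (1/2) ^ Suc i * norm x" by (simp only: mult.assoc[symmetric])
    with le have "a i x \<le> m i * (1/2) ^ Suc i * norm x" by simp
    also have "\<dots> \<le> \<epsilon> N * (1/2) ^ Suc i * norm x" using m_le[OF that] by (intro mult_right_mono) auto
    finally show ?thesis by (simp add: mult_ac)
  qed
  have geo: "(\<lambda>i. K * (1/2) ^ Suc i) sums K" for K :: real
    using sums_mult[OF power_half_series, of K] by simp
  have sm: "summable (\<lambda>i. a i x)" for x
    by (rule summable_comparison_test'[OF sums_summable[OF geo[of "\<epsilon> 0 * norm x"]], of 0])
      (use a0 a_le[of 0] in auto)
  define r where "r = (\<lambda>x. \<Sum>i. a i x)"
  have r_le: "r x \<le> \<epsilon> N * norm x" if x: "x \<in> tail_space e N" for x N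
  proof -
    have "a i x \<le> (\<epsilon> N * norm x) * (1/2) ^ Suc i" for i
    proof (cases "N \<le> i")
      case False
      then show ?thesis using coord_tail_space[OF b x, of i] \<epsilon>[of N] by (simp add: a_def)
    qed (rule a_le)
    then have "r x \<le> (\<Sum>i. (\<epsilon> N * norm x) * (1/2) ^ Suc i)"
      unfolding r_def by (intro suminf_le sm sums_summable[OF geo])
    then show ?thesis using sums_unique[OF geo[of "\<epsilon> N * norm x"]] by simp
  qed
  have r0: "r x \<le> \<epsilon> 0 * norm x" for x
  proof -
    have "r x \<le> (\<Sum>i. (\<epsilon> 0 * norm x) * (1/2) ^ Suc i)"
      unfolding r_def by (intro suminf_le sm sums_summable[OF geo] a_le) simp
    then show ?thesis using sums_unique[OF geo[of "\<epsilon> 0 * norm x"]] by simp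
  qed
  have "seminorm r"
    unfolding seminorm_def
  proof (intro conjI allI exI[of _ "\<epsilon> 0"])
    show "0 \<le> r x" for x unfolding r_def by (intro suminf_nonneg sm a0)
    show "r (t *\<^sub>R x) = \<bar>t\<bar> * r x" for t x
    proof -
      have "a i (t *\<^sub>R x) = \<bar>t\<bar> * a i x" for i by (simp add: a_def coord_linear[OF b] abs_mult)
      then show ?thesis unfolding r_def using suminf_mult[OF sm, of "\<bar>t\<bar>" x] by simp
    qed
    show "r (x + y) \<le> r x + r y" for x y
    proof -
      have "a i (x + y) \<le> a i x + a i y" for i
        using mult_left_mono[OF abs_triangle_ineq[of "coord e i x" "coord e i y"], of "c i"] c[of i]
        by (simp add: a_def coord_linear[OF b] distrib_left)
      then have "r (x + y) \<le> (\<Sum>i. a i x + a i y)" unfolding r_def by (intro suminf_le sm summable_add)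
      then show ?thesis unfolding r_def using suminf_add[OF sm sm, of x y] by simp
    qed
  qed (rule r0)
  moreover have "0 < r x" if x: "x \<noteq> 0" for x
  proof -
    have "\<exists>i. coord e i x \<noteq> 0"
    proof (rule ccontr)
      assume "\<nexists>i. coord e i x \<noteq> 0"
      then have "(\<lambda>i. 0) sums x" using coord_sums[OF b, of x] by simp
      then show False using x sums_unique2[OF sums_zero] by blast
    qed
    then obtain i where "coord e i x \<noteq> 0" ..
    then have "0 < a i x" using c[of i] by (simp add: a_def)
    then show ?thesis unfolding r_def by (intro suminf_pos2[OF sm a0])
  qed
  ultimately show thesis using r_le r0 by (intro that)
qed

theorem theorem1p1:
  fixes e :: "nat \<Rightarrow> 'a::banach" and k :: enat and \<epsilon> :: "nat \<Rightarrow> real"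
  assumes "1 \<le> k"
    and "separable_space (euclidean :: 'a topology)"
    and "schauder_basis e"
    and "\<exists>p :: 'a \<Rightarrow> real. renorming p \<and> C_smooth_norm k p"
    and "\<And>N. 0 < \<epsilon> N"
  shows "\<exists>q :: 'a \<Rightarrow> real. renorming q \<and> C_smooth_norm k q \<and>
           (\<forall>N. \<forall>x\<in>tail_space e N. \<bar>q x - norm x\<bar> \<le> \<epsilon> N * norm x)"
proof -
  note k = assms(1) and sep = assms(2) and b = assms(3) and \<epsilon> = assms(5)
  obtain p :: "'a \<Rightarrow> real" where p: "renorming p" "C_smooth_norm k p" using assms(4) by blast
  obtain r where r: "seminorm r" "\<And>x. x \<noteq> 0 \<Longrightarrow> 0 < r x"
    "\<And>N x. x \<in> tail_space e N \<Longrightarrow> r x \<le> \<epsilon> N * norm x" "\<And>x. r x \<le> \<epsilon> 0 * norm x"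
    by (rule tail_decreasing_seminorm[OF b \<epsilon>]) (rule that)
  define M where "M = (\<lambda>x. norm x + r x)"
  have sM: "seminorm M" unfolding M_def by (rule seminorm_add[OF seminorm_norm r(1)])
  have M_ge: "norm x \<le> M x" for x using seminormD(1)[OF r(1)] by (simp add: M_def)
  have M_le: "M x \<le> (1 + \<epsilon> 0) * norm x" for x using r(4)[of x] by (simp add: M_def distrib_right)
  define P where "P = bproj e"
  have linP: "linear (P n)" for n unfolding P_def by (rule bproj_linear[OF b])
  have Plim: "(\<lambda>n. P n x) \<longlonglongrightarrow> x" for x unfolding P_def by (rule bproj_tendsto[OF b])
  define d where "d = (\<lambda>j. inverse (real (Suc (Suc j))))"
  have d: "0 < d j" "d j \<le> 1 / 2" for j by (simp_all add: d_def divide_simps)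
  have dlim: "d \<longlonglongrightarrow> 0"
    unfolding d_def using LIMSEQ_Suc[OF LIMSEQ_inverse_real_of_nat] .
  have d2: "0 < (d j)\<^sup>2" "(d j)\<^sup>2 \<le> 1 / 4" "(d j)\<^sup>2 \<le> d j / 2" for j
  proof -
    show "0 < (d j)\<^sup>2" using d[of j] by simp
    show le: "(d j)\<^sup>2 \<le> d j / 2" using mult_left_mono[OF d(2)[of j], of "d j"] d(1)[of j] by (simp add: power2_eq_square)
    then show "(d j)\<^sup>2 \<le> 1 / 4" using d(2)[of j] by simp
  qed
  txt \<open>The norms \<open>w j\<close> stay below \<open>M\<close> by a fixed factor, which leaves room for a uniform approximation
    even where \<open>M\<close> and the norm almost agree. They tend to the norm pointwise because of the first
    summand, but from strictly above: \<open>d\<^sup>2\<close> is negligible compared with \<open>d\<close>.\<close>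
  define A where "A = (\<lambda>j z. (1 + d j) * norm (P j z))"
  define B where "B = (\<lambda>j y. (1 - (d j)\<^sup>2) * M y)"
  define w where "w = (\<lambda>j x. INF z. A j z + B j (x - P j z))"
  have sA: "seminorm (A j)" for j
    unfolding A_def P_def using d[of j]
    by (intro seminorm_scale seminorm_precomp[OF seminorm_norm] bproj_bounded_linear[OF b]) simp
  have sB: "seminorm (B j)" for j
    unfolding B_def by (intro seminorm_scale sM) (use d2(2)[of j] in simp)
  have sw: "seminorm (w j)" for j unfolding w_def by (rule inf_convolution_seminorm(1)[OF sA sB linP])
  have w_le: "w j x \<le> A j z + B j (x - P j z)" for j x z
    unfolding w_def by (rule inf_convolution_seminorm(2)[OF sA sB linP])
  have w_ge: "c \<le> w j x" if "\<And>z. c \<le> A j z + B j (x - P j z)" for c j x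
    unfolding w_def by (rule inf_convolution_seminorm(3)[OF sA sB linP that])
  have w_M: "w j x \<le> (1 - (d j)\<^sup>2) * M x" for j x
    using w_le[of j x 0] linear_0[OF linP] by (simp add: A_def B_def)
  \<comment> \<open>Compared with the norm the loss is only \<open>(d j)\<^sup>2 * norm x\<close>.
    It is compensated by \<open>d j * norm (P j z)\<close> when \<open>P j z\<close> is large and by
    the \<open>r\<close> term when it is small.\<close>
  have lower: "norm x - (d j)\<^sup>2 * norm x + d j * norm (P j z) + (d j)\<^sup>2 * norm (P j z) + (1 - (d j)\<^sup>2) * r (x - P j z)
      \<le> A j z + B j (x - P j z)" for j x z
  proof -
    have "norm x - norm (P j z) \<le> norm (x - P j z)" by (rule norm_triangle_ineq2)
    then have "(1 - (d j)\<^sup>2) * (norm x - norm (P j z)) \<le> (1 - (d j)\<^sup>2) * norm (x - P j z)"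
      using d2(2)[of j] by (intro mult_left_mono) auto
    then show ?thesis unfolding A_def B_def M_def by (simp add: algebra_simps)
  qed
  have rw: "renorming (w j)" for j
  proof (rule renormingI[OF sw])
    fix x
    show "(3 / 4) * norm x \<le> w j x"
    proof (rule w_ge)
      fix z
      have "0 \<le> d j * norm (P j z)" "0 \<le> (d j)\<^sup>2 * norm (P j z)" "0 \<le> (1 - (d j)\<^sup>2) * r (x - P j z)"
        using less_imp_le[OF d(1)[of j]] d2(2)[of j] seminormD(1)[OF r(1)] by simp_all
      moreover have "(d j)\<^sup>2 * norm x \<le> 1 / 4 * norm x" using d2(2) by (intro mult_right_mono) auto
      ultimately show "(3 / 4) * norm x \<le> A j z + B j (x - P j z)" using lower[of x j z] by linarith
    qed
  qed simp
  have gap: "\<exists>j. norm x < w j x" if x: "x \<noteq> 0" for x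
  proof -
    define R where "R = r x"
    have R: "0 < R" using r(2)[OF x] by (simp add: R_def)
    \<comment> \<open>If \<open>norm (P j z) < t\<close>, then \<open>r (P j z) \<le> R / 2\<close>,
      so at least \<open>R / 2\<close> of \<open>r\<close> is left for \<open>x - P j z\<close>. The
      two conditions on \<open>d j\<close> below make the loss smaller than the gain in either
      case.\<close>
    define t where "t = R / (2 * \<epsilon> 0)"
    have t: "0 < t" using R \<epsilon>[of 0] by (simp add: t_def)
    have nx: "0 < norm x" using x by simp
    have "0 < min (t / 2) (R / 8) / norm x" using R t nx by simp
    then have "\<forall>\<^sub>F j in sequentially. d j < min (t / 2) (R / 8) / norm x" by (rule order_tendstoD(2)[OF dlim])
    then obtain j where "d j < min (t / 2) (R / 8) / norm x" unfolding eventually_sequentially by blast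
    then have j: "d j * norm x < t / 2" "d j * norm x < R / 8" using nx by (simp_all add: pos_less_divide_eq)
    \<comment> \<open>The excess must not depend on \<open>z\<close>; otherwise strictness would be
      lost in the infimum.\<close>
    define \<gamma> where "\<gamma> = min (d j * (t / 2)) (R / 4)"
    have \<gamma>: "0 < \<gamma>" using d(1)[of j] t R by (simp add: \<gamma>_def)
    have "norm x + \<gamma> \<le> w j x"
    proof (rule w_ge)
      fix z
      have n1: "0 \<le> (d j)\<^sup>2 * norm (P j z)" by simp
      have n2: "0 \<le> (1 - (d j)\<^sup>2) * r (x - P j z)" using d2(2)[of j] seminormD(1)[OF r(1)] by simp
      have n3: "0 \<le> d j * norm (P j z)" using d(1)[of j] by simp
      show "norm x + \<gamma> \<le> A j z + B j (x - P j z)"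
      proof (cases "t \<le> norm (P j z)")
        case True
        have "d j * t \<le> d j * norm (P j z)" using True d(1)[of j] by (intro mult_left_mono) auto
        moreover have "(d j)\<^sup>2 * norm x \<le> d j * (t / 2)"
          using mult_left_mono[OF less_imp_le[OF j(1)], of "d j"] d(1)[of j] by (simp add: power2_eq_square mult.assoc)
        moreover have "\<gamma> \<le> d j * (t / 2)" by (simp add: \<gamma>_def)
        moreover have "d j * (t / 2) = d j * t / 2" by simp
        ultimately show ?thesis using lower[of x j z] n1 n2 by linarith
      next
        case False
        have "r (P j z) \<le> \<epsilon> 0 * norm (P j z)" by (rule r(4))
        also have "\<dots> \<le> \<epsilon> 0 * t" using False \<epsilon>[of 0] by (intro mult_left_mono) auto
        also have "\<dots> = R / 2" using \<epsilon>[of 0] by (simp add: t_def)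
        finally have "R / 2 \<le> r (x - P j z)" using seminormD(3)[OF r(1), of "x - P j z" "P j z"] by (simp add: R_def)
        then have "(3 / 4) * (R / 2) \<le> (1 - (d j)\<^sup>2) * r (x - P j z)"
          using d2(2)[of j] R by (intro mult_mono) auto
        moreover have "(d j)\<^sup>2 * norm x \<le> d j * norm x" using d2(3)[of j] d(1)[of j] by (intro mult_right_mono) auto
        moreover have "\<gamma> \<le> R / 4" by (simp add: \<gamma>_def)
        ultimately show ?thesis using lower[of x j z] n1 n3 j(2) by linarith
      qed
    qed
    then show ?thesis using \<gamma> by (intro exI[of _ j]) simp
  qed

  \<comment> \<open>Smooth approximations of the \<open>w j\<close> and their gluing\<close>
  have "\<exists>q. renorming q \<and> C_smooth_norm k q \<and> (\<forall>x. w j x \<le> q x) \<and> (\<forall>x. q x \<le> (1 + (d j)\<^sup>2) * w j x)" for j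
  proof (rule smooth_approximation[OF b p k sep rw d2(1)])
    fix q assume "renorming q" "C_smooth_norm k q" "\<And>x. w j x \<le> q x" "\<And>x. q x \<le> (1 + (d j)\<^sup>2) * w j x"
    then show ?thesis by (intro exI[of _ q]) simp
  qed
  then have "\<exists>q. \<forall>j. renorming (q j) \<and> C_smooth_norm k (q j) \<and> (\<forall>x. w j x \<le> q j x) \<and>
      (\<forall>x. q j x \<le> (1 + (d j)\<^sup>2) * w j x)" by (intro choice allI)
  then obtain q where q: "\<forall>j. renorming (q j) \<and> C_smooth_norm k (q j) \<and> (\<forall>x. w j x \<le> q j x) \<and>
      (\<forall>x. q j x \<le> (1 + (d j)\<^sup>2) * w j x)" ..
  have q_ge: "w j x \<le> q j x" and q_le: "q j x \<le> (1 + (d j)\<^sup>2) * w j x" for j x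
    using spec[OF q, of j] by simp_all
  have Cq: "C_seminorm k (q j)" for j
    by (rule C_seminorm_renorming) (use spec[OF q, of j] in simp_all)
  \<comment> \<open>The approximation factor \<open>1 + (d j)\<^sup>2\<close> times
    \<open>1 - (d j)\<^sup>2\<close> still leaves a margin of fourth order in \<open>d j\<close>. It
    serves as \<open>\<tau>\<close> in the gluing, which with \<open>b = M x\<close> gives
    \<open>Q x \<le> M x\<close>.\<close>
  have q_M: "q j x \<le> (1 - (d j)\<^sup>2 * (d j)\<^sup>2) * M x" for j x
  proof -
    have "(1 + (d j)\<^sup>2) * w j x \<le> (1 + (d j)\<^sup>2) * ((1 - (d j)\<^sup>2) * M x)"
      by (intro mult_left_mono w_M) simp
    then show ?thesis using q_le[of j x] by (simp add: algebra_simps)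
  qed
  have q_small: "\<forall>\<^sub>F j in sequentially. q j x < c" if c: "norm x < c" for c x
  proof -
    \<comment> \<open>The bound on \<open>q j x\<close> obtained from the splitting
      \<open>z = x\<close> in the infimal convolution; it tends to \<open>norm x\<close>.\<close>
    have "(\<lambda>j. (1 + (d j)\<^sup>2) * ((1 + d j) * norm (P j x) + (1 + \<epsilon> 0) * norm (x - P j x)))
      \<longlonglongrightarrow> (1 + 0\<^sup>2) * ((1 + 0) * norm x + (1 + \<epsilon> 0) * norm (x - x))"
      by (intro tendsto_intros dlim Plim)
    then have "\<forall>\<^sub>F j in sequentially. (1 + (d j)\<^sup>2) * ((1 + d j) * norm (P j x) + (1 + \<epsilon> 0) * norm (x - P j x)) < c"
      using c by (intro order_tendstoD(2)) auto
    then show ?thesis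
    proof eventually_elim
      case (elim j)
      have "(1 - (d j)\<^sup>2) * M (x - P j x) \<le> 1 * ((1 + \<epsilon> 0) * norm (x - P j x))"
        using d2[of j] M_le seminormD(1)[OF sM] by (intro mult_mono) auto
      then have "w j x \<le> (1 + d j) * norm (P j x) + (1 + \<epsilon> 0) * norm (x - P j x)"
        using w_le[of j x x] by (simp add: A_def B_def)
      then have "(1 + (d j)\<^sup>2) * w j x \<le> (1 + (d j)\<^sup>2) * ((1 + d j) * norm (P j x) + (1 + \<epsilon> 0) * norm (x - P j x))"
        by (intro mult_left_mono) auto
      then show ?case using q_le[of j x] elim by linarith
    qed
  qed
  have fin: "finite {j. c < f j}" if "\<forall>\<^sub>F j in sequentially. f j < c" for c and f :: "nat \<Rightarrow> real"
  proof -
    obtain N where N: "\<And>j. j \<ge> N \<Longrightarrow> f j < c" using \<open>\<forall>\<^sub>F j in sequentially. f j < c\<close> unfolding eventually_sequentially by blast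
    have "{j. c < f j} \<subseteq> {..N}"
    proof
      fix j assume "j \<in> {j. c < f j}"
      then show "j \<in> {..N}" using N[of j] by (cases "j \<le> N") auto
    qed
    then show ?thesis by (rule finite_subset) simp
  qed
  obtain Q where Q: "renorming Q" "C_smooth_norm k Q" "\<And>j x. q j x \<le> Q x"
    "\<And>b x. 0 < b \<Longrightarrow> (\<And>j. q j x \<le> (1 - (d j)\<^sup>2 * (d j)\<^sup>2) * b) \<Longrightarrow> Q x \<le> b"
  proof (rule smooth_gluing[where I = UNIV and u = q and v = "\<lambda>j x. 0" and L = "1 + \<epsilon> 0" and \<kappa> = 1
        and \<tau> = "\<lambda>j. (d j)\<^sup>2 * (d j)\<^sup>2" and k = k])
    have dd: "(d j)\<^sup>2 * (d j)\<^sup>2 \<le> d j" for j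
    proof -
      have "(d j)\<^sup>2 * (d j)\<^sup>2 \<le> d j * 1" using d2[of j] d[of j] by (intro mult_mono) auto
      then show ?thesis by simp
    qed
    show "(d j)\<^sup>2 * (d j)\<^sup>2 \<le> 1 / 2" for j using dd[of j] d(2)[of j] by linarith
    show "q j x + 0 \<le> (1 + \<epsilon> 0) * norm x" for j x
    proof -
      have "(1 - (d j)\<^sup>2 * (d j)\<^sup>2) * M x \<le> 1 * M x" using seminormD(1)[OF sM] by (intro mult_right_mono) auto
      then show ?thesis using q_M[of j x] M_le[of x] by linarith
    qed
    show "finite {j \<in> UNIV. c < (d j)\<^sup>2 * (d j)\<^sup>2}" if c: "0 < c" for c
    proof -
      have "\<forall>\<^sub>F j in sequentially. d j < c" by (rule order_tendstoD(2)[OF dlim c])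
      then have "\<forall>\<^sub>F j in sequentially. (d j)\<^sup>2 * (d j)\<^sup>2 < c"
        by eventually_elim (rule le_less_trans[OF dd])
      from fin[OF this] show ?thesis by simp
    qed
    show "\<exists>i\<in>UNIV. \<exists>c. c < q i x + 0 \<and> 1 * norm x \<le> q i x + 0 \<and> finite {j \<in> UNIV. c < q j x + 0}"
      if x: "x \<noteq> 0" for x
    proof -
      obtain i where "norm x < w i x" using gap[OF x] by blast
      then have i: "norm x < q i x" using q_ge[of i x] by simp
      define c where "c = (norm x + q i x) / 2"
      have "norm x < c" "c < q i x" using i by (auto simp: c_def)
      then show ?thesis using i fin[OF q_small[of x c]] by (intro bexI[of _ i] exI[of _ c] conjI) auto
    qed
    fix Q assume Q: "renorming Q" "C_smooth_norm k Q" "\<And>i x. i \<in> UNIV \<Longrightarrow> q i x + 0 \<le> Q x"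
      "\<And>b x. 0 < b \<Longrightarrow> (\<And>i. i \<in> UNIV \<Longrightarrow> q i x + 0 \<le> (1 - (d i)\<^sup>2 * (d i)\<^sup>2) * b) \<Longrightarrow> Q x \<le> b"
    show thesis
    proof (rule that[OF Q(1,2)])
      show "q j x \<le> Q x" for j x using Q(3)[of j x] by simp
      show "Q x \<le> b" if "0 < b" "\<And>j. q j x \<le> (1 - (d j)\<^sup>2 * (d j)\<^sup>2) * b" for b x
        using that(2) by (intro Q(4)[OF that(1)]) simp
    qed
  qed (use k Cq C_seminorm_zero \<epsilon>[of 0] d2(1) in simp_all)
  have sQ: "seminorm Q" by (rule renorming_seminorm[OF Q(1)])
  have between: "norm x \<le> Q x \<and> Q x \<le> M x" for x
  proof (cases "x = 0")
    case True
    then show ?thesis using seminormD(4)[OF sQ] seminormD(4)[OF sM] by simp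
  next
    case False
    obtain i where "norm x < w i x" using gap[OF False] by blast
    then have "norm x \<le> Q x" using q_ge[of i x] Q(3)[of i x] by linarith
    moreover have "0 < norm x" using False by simp
    then have "0 < M x" using M_ge[of x] by linarith
    then have "Q x \<le> M x" by (rule Q(4)) (rule q_M)
    ultimately show ?thesis by simp
  qed
  have "\<bar>Q x - norm x\<bar> \<le> \<epsilon> N * norm x" if "x \<in> tail_space e N" for N x
    using between[of x] r(3)[OF that] by (simp add: M_def)
  then show ?thesis using Q(1,2) by (intro exI[of _ Q]) simp
qed

end
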